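(* Let $A$ be a finite dimensional, unital, associative, and commutative algebra over a field $k$, endowed with a non-degenerate and invariant inner product $\langle-,-\rangle$. Then the Hochschild cohomology $HH^*(A;A)$, with the product $\smile$, coproduct $\vee_0$, operator $\Delta$ and map $\sim$ induced by the cochain operations defined in the context, is a Frobenius algebra endowed with a compatible $BV$ operator $\Delta$ and an involution $\sim$. The operator $\Delta$ maps each eigenspace of $\sim$ into the other, i.e. $\Delta\left(HH^*(A;A)_\pm\right)\subset HH^*(A;A)_\mp$, where $HH^*(A;A)_\pm$ are the $\pm1$ eigenspaces of $\sim$. The map $\sim$ is both an anti-algebra and an anti-coalgebra map, that is, for homogeneous $f,g$, $$\widetilde{f\smile g}=(-1)^{|f||g|}\,\widetilde{g}\smile\widetilde{f},\qquad \vee_0\left(\widetilde{f}\right)=\sum_{(f)}(-1)^{|f'||f''|}\,\widetilde{f''}\otimes\widetilde{f'},$$ where $\vee_0(f)=\sum_{(f)}f'\otimes f''$.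
   Context: **Invariant inner product.** A non-degenerate bilinear form $\langle -,-\rangle: A\otimes A\to k$ with $\langle ab,c\rangle=\langle a,bc\rangle$ and $\langle ab,c\rangle=\langle b,ca\rangle$. It gives an $A$-bimodule isomorphism $\beta:A\to A^*$, $\beta(a)(b)=\langle a,b\rangle$, by which cochains with values in $A$ are identified with cochains with values in $A^*$. **Hochschild cohomology.** $HH^*(A;A)$ is the cohomology of the normalized complex $\overline{HC^*}(A;A)\subset\prod_{n\ge 0}\mathrm{Hom}(A^{\otimes n},A)$ of those $f$ vanishing when some argument is $1$, with differential $(\delta f)(a_1,\dots,a_n)=a_1 f(a_2,\dots,a_n)+\sum_{j=1}^{n-1}(-1)^j f(a_1,\dots,a_ja_{j+1},\dots,a_n)+(-1)^n f(a_1,\dots,a_{n-1})a_n$. A cochain in $\mathrm{Hom}(A^{\otimes n},A)$ has degree $|f|=n$. **Operations** (the actions of the corresponding chord diagrams): - Product: $(f\smile g)(a_1,\dots,a_{p+q})=f(a_1,\dots,a_p)\cdot g(a_{p+1},\dots,a_{p+q})$ for $|f|=p$, $|g|=q$. - Coproduct: let $\{e_i\},\{e^i\}$ be bases of $A$ with $\langle e_i,e^j\rangle=\delta_{ij}$. For $|f|=n$, $\vee_0(f)=\sum_{(f)}f'\otimes f''$ has its first factor in degree $0$ and its second factor in degree $n$, and is determined by $\sum_{(f)}\langle f',x\rangle\,\langle f''(a_1,\dots,a_n),y\rangle=\sum_i\langle f(a_1,\dots,a_n),\,y\,e_i\,x\,e^i\rangle$ for all $x,y,a_1,\dots,a_n\in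 A$. - Operator of degree $-1$: for $|f|=n\ge1$, $\Delta f$ is determined by $\langle(\Delta f)(a_1,\dots,a_{n-1}),a_n\rangle=\sum_{j=1}^{n}(-1)^{j(n-1)}\langle f(a_j,\dots,a_{n-1},a_n,a_1,\dots,a_{j-1}),1\rangle$, and $\Delta f=0$ for $n=0$. - Orientation reversal: $\sim:f\mapsto\widetilde f$, $\widetilde f(a_1,a_2,\dots,a_n)=(-1)^{n(n+1)/2}f(a_n,a_{n-1},\dots,a_1)$ for $|f|=n$. **Terminology.** Let $\tau_2$ be the transposition of two tensor factors with Koszul sign; tensor products of maps are evaluated with Koszul signs. "Frobenius algebra" means: $\smile$ is associative and graded commutative, $\vee_0$ is coassociative and graded cocommutative, and $\vee_0\circ\smile=(id\otimes\smile)\circ(\vee_0\otimes id)=(\smile\otimes id)\circ(id\otimes\vee_0)$. "Compatible $BV$ operator" means: $\Delta^2=0$; the $BV$ relation $\Delta\circ\smile\circ(\smile\otimes id)=\smile\circ(\Delta\circ\smile\otimes id)+\smile\circ(id\otimes\Delta\circ\smile)+\smile\circ(\Delta\circ\smile\otimes id)\circ(id\otimes\tau_2)-\smile\circ(\smile\otimes id)\circ(\Delta\otimes id\otimes id+id\otimes\Delta\otimes id+id\otimes id\otimes\Delta)$; and the dual $coBV$ relation $(\vee_0\otimes id)\circ\vee_0\circ\Delta=(\vee_0\circ\Delta\otimes id)\circ\vee_0+(id\otimes\vee_0\circ\Delta)\circ\vee_0+(id\otimes\tau_2)\circ(\vee_0\circ\Delta\otimes id)\circ\vee_0-(\Delta\otimes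 id\otimes id+id\otimes\Delta\otimes id+id\otimes id\otimes\Delta)\circ(\vee_0\otimes id)\circ\vee_0$. *)

theory Defs
  imports Complex_Main "HOL-Library.Function_Algebras"
begin

text \<open>
  The class \<open>{comm_ring, comm_monoid_mult}\<close> is that of unital commutative rings in which
  \<open>0 = 1\<close> is not excluded. \<open>Basis\<close> is an arbitrary finite basis of the algebra over the field.
\<close>

locale inner_product_algebra = finite_dimensional_vector_space scl Basis
  for scl :: "'k::field \<Rightarrow> 'a::{comm_ring, comm_monoid_mult} \<Rightarrow> 'a" (infixr "*s" 75)
    and Basis :: "'a set" +
  fixes ip :: "'a \<Rightarrow> 'a \<Rightarrow> 'k" ("\<langle>_, _\<rangle>")
  assumes scale_mult: "r *s (a * b) = (r *s a) * b"
    and ip_add_left: "\<langle>a + b, c\<rangle> = \<langle>a, c\<rangle> + \<langle>b, c\<rangle>"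
    and ip_add_right: "\<langle>a, b + c\<rangle> = \<langle>a, b\<rangle> + \<langle>a, c\<rangle>"
    and ip_scale_left: "\<langle>r *s a, b\<rangle> = r * \<langle>a, b\<rangle>"
    and ip_scale_right: "\<langle>a, r *s b\<rangle> = r * \<langle>a, b\<rangle>"
    and nondegenerate_left: "(\<And>b. \<langle>a, b\<rangle> = 0) \<Longrightarrow> a = 0"
    and nondegenerate_right: "(\<And>a. \<langle>a, b\<rangle> = 0) \<Longrightarrow> b = 0"
    and invariant: "\<langle>a * b, c\<rangle> = \<langle>a, b * c\<rangle>"
    and cyclic: "\<langle>a * b, c\<rangle> = \<langle>b, c * a\<rangle>"

text \<open>\<open>signed n x\<close> is \<open>(-1)\<^sup>n x\<close>.\<close>

definition signed :: "nat \<Rightarrow> 'b::group_add \<Rightarrow> 'b" where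
  "signed n x = (if even n then x else - x)"


section \<open>Normalized Hochschild cochains and the cochain operations\<close>

text \<open>
  A function on lists restricts to one function of \<open>n\<close> arguments for every \<open>n\<close>. An element of the
  product of the spaces \<open>Hom(A\<^sup>\<otimes>\<^sup>n, A)\<close> is hence a function on lists that is linear in each entry.
\<close>

type_synonym 'b cochain = "'b list \<Rightarrow> 'b"

context inner_product_algebra
begin

definition cochains :: "'a cochain set" where
  "cochains = {f.
     (\<forall>xs ys x y. f (xs @ (x + y) # ys) = f (xs @ x # ys) + f (xs @ y # ys)) \<and>
     (\<forall>xs ys c x. f (xs @ (c *s x) # ys) = c *s f (xs @ x # ys)) \<and>
     (\<forall>xs. 1 \<in> set xs \<longrightarrow> f xs = 0)}"

definition homogeneous :: "nat \<Rightarrow> 'a cochain \<Rightarrow> bool" where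
  "homogeneous n f \<longleftrightarrow> (\<forall>as. length as \<noteq> n \<longrightarrow> f as = 0)"

definition differential :: "'a cochain \<Rightarrow> 'a cochain" ("\<delta>") where
  "\<delta> f as = (if as = [] then 0 else
     let n = length as in
       hd as * f (tl as)
       + (\<Sum>j\<in>{1..<n}. signed j (f (take (j - 1) as @ (as ! (j - 1) * as ! j) # drop (j + 1) as)))
       + signed n (f (butlast as) * last as))"

definition cup :: "'a cochain \<Rightarrow> 'a cochain \<Rightarrow> 'a cochain" (infixl "\<smile>" 70) where
  "(f \<smile> g) as = (\<Sum>p\<le>length as. f (take p as) * g (drop p as))"

text \<open>
  The list \<open>rotate (j - 1) [a\<^sub>1, \<dots>, a\<^sub>n]\<close> is \<open>[a\<^sub>j, \<dots>, a\<^sub>n, a\<^sub>1, \<dots>, a\<^sub>j\<^sub>-\<^sub>1]\<close>. The component of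
  \<open>\<Delta> f\<close> with \<open>n - 1\<close> arguments depends on that of \<open>f\<close> with \<open>n \<ge> 1\<close> arguments only, so that
  \<open>\<Delta>\<close> vanishes on cochains of degree 0.
\<close>

definition is_Delta_value :: "'a cochain \<Rightarrow> 'a list \<Rightarrow> 'a \<Rightarrow> bool" where
  "is_Delta_value f as c \<longleftrightarrow> (\<forall>a. \<langle>c, a\<rangle> =
     (let n = length as + 1 in
       \<Sum>j = 1..n. signed (j * (n - 1)) \<langle>f (rotate (j - 1) (as @ [a])), 1\<rangle>))"

definition Delta :: "'a cochain \<Rightarrow> 'a cochain" where
  "Delta f as = (THE c. is_Delta_value f as c)"

definition reversal :: "'a cochain \<Rightarrow> 'a cochain" where
  "reversal f as = (let n = length as in signed (n * (n + 1) div 2) (f (rev as)))"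

definition dual_basis :: "'a \<Rightarrow> 'a" where
  "dual_basis e = (THE c. \<forall>e'\<in>Basis. \<langle>e', c\<rangle> = (if e' = e then 1 else 0))"

definition cocycles :: "'a cochain set" where
  "cocycles = {f \<in> cochains. \<delta> f = 0}"

definition coboundaries :: "'a cochain set" where
  "coboundaries = \<delta> ` cochains"

text \<open>
  The list \<open>ps\<close> of pairs \<open>(f', f'')\<close> of cocycles represents the element \<open>\<Sum> f' \<otimes> f''\<close>
  that is the coproduct of \<open>f\<close>. The factor \<open>f'\<close> has degree 0, so it is given by its value at \<open>[]\<close>.
\<close>

definition represents_coproduct ::
    "('a cochain \<times> 'a cochain) list \<Rightarrow> 'a cochain \<Rightarrow> bool" where
  "represents_coproduct ps f \<longleftrightarrow>
     (\<forall>(f', f'')\<in>set ps. f' \<in> cocycles \<and> homogeneous 0 f' \<and> f'' \<in> cocycles) \<and>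
     (\<forall>x y as. (\<Sum>(f', f'')\<leftarrow>ps. \<langle>f' [], x\<rangle> * \<langle>f'' as, y\<rangle>)
        = (\<Sum>e\<in>Basis. \<langle>f as, y * e * x * dual_basis e\<rangle>))"

text \<open>
  The Koszul sign operator \<open>f \<mapsto> (-1)\<^sup>|\<^sup>f\<^sup>| f\<close>, and the even and odd parts of a cochain. They express
  Koszul signs for cochains that need not be homogeneous.
\<close>

definition degree_sign :: "'a cochain \<Rightarrow> 'a cochain" where
  "degree_sign f as = signed (length as) (f as)"

definition even_part :: "'a cochain \<Rightarrow> 'a cochain" where
  "even_part f as = (if even (length as) then f as else 0)"

definition odd_part :: "'a cochain \<Rightarrow> 'a cochain" where
  "odd_part f as = (if odd (length as) then f as else 0)"


section \<open>Hochschild cohomology\<close>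

definition cohomologous :: "('a cochain \<times> 'a cochain) set" where
  "cohomologous = {(f, g). f \<in> cocycles \<and> g \<in> cocycles \<and> f - g \<in> coboundaries}"

definition HH :: "'a cochain set set" where
  "HH = cocycles // cohomologous"

definition cls :: "'a cochain \<Rightarrow> 'a cochain set" where
  "cls f = cohomologous `` {f}"

definition HH_degree :: "nat \<Rightarrow> 'a cochain set set" where
  "HH_degree n = {cls f | f. f \<in> cocycles \<and> homogeneous n f}"

definition induced :: "('a cochain \<Rightarrow> 'a cochain) \<Rightarrow> 'a cochain set \<Rightarrow> 'a cochain set" where
  "induced F X = (\<Union>f\<in>X. cls (F f))"

definition induced2 ::
    "('a cochain \<Rightarrow> 'a cochain \<Rightarrow> 'a cochain) \<Rightarrow> 'a cochain set \<Rightarrow> 'a cochain set \<Rightarrow> 'a cochain set" where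
  "induced2 F X Y = (\<Union>f\<in>X. \<Union>g\<in>Y. cls (F f g))"

definition hadd (infixl "\<oplus>" 65) where "hadd = induced2 (+)"
definition hscale (infixr "\<odot>" 75) where "hscale c = induced (\<lambda>f as. c *s f as)"
definition hcup (infixl "\<smile>\<^sub>H" 70) where "hcup = induced2 cup"
definition hDelta where "hDelta = induced Delta"
definition hreversal where "hreversal = induced reversal"
definition hsign where "hsign = induced degree_sign"
definition heven where "heven = induced even_part"
definition hodd where "hodd = induced odd_part"

end


section \<open>Tensor powers of the cohomology\<close>

text \<open>
  The library has no tensor product of vector spaces. The tensor power \<open>H\<^sup>\<otimes>\<^sup>n\<close> is built here as the
  span of the pure tensors \<open>x\<^sub>1 \<otimes> \<dots> \<otimes> x\<^sub>n\<close>, seen as the evaluation functionals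
  \<open>\<phi> \<mapsto> \<phi>(x\<^sub>1, \<dots>, x\<^sub>n)\<close> on the multilinear forms on \<open>H\<close>. Lemma \<open>tensor_eq_0_iff\<close> below says that
  this is the quotient of the free vector space on \<open>H\<^sup>n\<close> by the multilinearity relations. A form is
  again a function on lists, linear in each entry, so forms of all arities are treated at once.
\<close>

type_synonym ('h, 'k) tensor = "('h list \<Rightarrow> 'k) \<Rightarrow> 'k"

definition fun_scale :: "'k::field \<Rightarrow> ('b \<Rightarrow> 'k) \<Rightarrow> 'b \<Rightarrow> 'k" where
  "fun_scale c t = (\<lambda>x. c * t x)"

lemma vector_space_fun_scale: "vector_space fun_scale"
  by unfold_locales (auto simp: fun_scale_def fun_eq_iff algebra_simps)

context inner_product_algebra
begin

definition multilinear_form :: "('a cochain set list \<Rightarrow> 'k) \<Rightarrow> bool" where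
  "multilinear_form \<phi> \<longleftrightarrow>
     (\<forall>xs\<in>lists HH. \<forall>ys\<in>lists HH. \<forall>x\<in>HH. \<forall>y\<in>HH.
        \<phi> (xs @ (x \<oplus> y) # ys) = \<phi> (xs @ x # ys) + \<phi> (xs @ y # ys)) \<and>
     (\<forall>xs\<in>lists HH. \<forall>ys\<in>lists HH. \<forall>x\<in>HH. \<forall>c.
        \<phi> (xs @ (c \<odot> x) # ys) = c * \<phi> (xs @ x # ys))"

definition pure :: "'a cochain set list \<Rightarrow> ('a cochain set, 'k) tensor" where
  "pure xs = (\<lambda>\<phi>. if multilinear_form \<phi> then \<phi> xs else 0)"

definition tensor_power :: "nat \<Rightarrow> ('a cochain set, 'k) tensor set" where
  "tensor_power n = module.span fun_scale {pure xs | xs. xs \<in> lists HH \<and> length xs = n}"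

definition formal :: "'a cochain set list \<Rightarrow> 'a cochain set list \<Rightarrow> 'k" where
  "formal xs = (\<lambda>ys. if ys = xs then 1 else 0)"

definition multilinearity_relations :: "('a cochain set list \<Rightarrow> 'k) set" where
  "multilinearity_relations =
     {formal (xs @ (x \<oplus> y) # ys) - formal (xs @ x # ys) - formal (xs @ y # ys) | xs ys x y.
        xs \<in> lists HH \<and> ys \<in> lists HH \<and> x \<in> HH \<and> y \<in> HH} \<union>
     {formal (xs @ (c \<odot> x) # ys) - fun_scale c (formal (xs @ x # ys)) | xs ys c x.
        xs \<in> lists HH \<and> ys \<in> lists HH \<and> x \<in> HH}"

end

lemma separating_functional:
  fixes R :: "('b \<Rightarrow> 'k::field) set"
  assumes "t \<notin> module.span fun_scale R"
  obtains \<psi> where "Vector_Spaces.linear fun_scale (*) \<psi>" "\<psi> t = 1" "\<And>r. r \<in> R \<Longrightarrow> \<psi> r = 0"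
proof -
  interpret V: vector_space "fun_scale :: 'k \<Rightarrow> ('b \<Rightarrow> 'k) \<Rightarrow> _" by (rule vector_space_fun_scale)
  interpret P: vector_space_pair "fun_scale :: 'k \<Rightarrow> ('b \<Rightarrow> 'k) \<Rightarrow> _" "(*) :: 'k \<Rightarrow> 'k \<Rightarrow> 'k"
    by unfold_locales (auto simp: algebra_simps)
  obtain B where B: "B \<subseteq> R" "V.independent B" "R \<subseteq> V.span B"
    using V.maximal_independent_subset by metis
  then have t: "t \<notin> V.span B"
    using assms V.span_mono by blast
  have ind: "V.independent (insert t B)"
    using B t by (simp add: V.independent_insert)
  define \<psi> where "\<psi> = P.construct (insert t B) (\<lambda>b. if b = t then 1 else 0)"
  have lin: "Vector_Spaces.linear fun_scale (*) \<psi>"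
    unfolding \<psi>_def by (rule P.linear_construct[OF ind])
  have t1: "\<psi> t = 1"
    unfolding \<psi>_def by (simp add: P.construct_basis[OF ind])
  have B0: "\<psi> b = 0" if "b \<in> B" for b
    unfolding \<psi>_def using that t V.span_base by (auto simp: P.construct_basis[OF ind])
  interpret L: Vector_Spaces.linear fun_scale "(*)" \<psi> by (rule lin)
  have "\<psi> r = 0" if "r \<in> R" for r
  proof -
    have "r \<in> V.span B" using that B by blast
    then show ?thesis
    proof (induction rule: V.span_induct_alt)
      case base
      show ?case by (rule L.zero)
    next
      case (step c x y)
      then show ?case by (simp only: L.add L.scale B0 mult_zero_right add_0)
    qed
  qed
  with lin t1 show ?thesis using that by blast
qed

context inner_product_algebra
begin

lemma tensor_eq_0_iff:
  assumes "finite S" "S \<subseteq> lists HH"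
  shows "(\<Sum>xs\<in>S. fun_scale (c xs) (pure xs)) = 0 \<longleftrightarrow>
    (\<Sum>xs\<in>S. fun_scale (c xs) (formal xs)) \<in> module.span fun_scale multilinearity_relations"
    (is "?T = 0 \<longleftrightarrow> ?F \<in> _")
proof -
  interpret V: vector_space "fun_scale :: 'k \<Rightarrow> ('a cochain set list \<Rightarrow> 'k) \<Rightarrow> _"
    by (rule vector_space_fun_scale)
  have T: "?T \<phi> = (if multilinear_form \<phi> then \<Sum>xs\<in>S. c xs * \<phi> xs else 0)" for \<phi>
    using assms(1) by (induction S rule: finite_induct) (auto simp: pure_def fun_scale_def)
  have F: "?F ys = (if ys \<in> S then c ys else 0)" for ys
    using assms(1) by (induction S rule: finite_induct) (auto simp: formal_def fun_scale_def)
  show ?thesis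
  proof
    assume T0: "?T = 0"
    show "?F \<in> V.span multilinearity_relations"
    proof (rule ccontr)
      assume "?F \<notin> V.span multilinearity_relations"
      then obtain \<psi> where lin: "Vector_Spaces.linear fun_scale (*) \<psi>" and one: "\<psi> ?F = 1"
        and zero: "\<And>r. r \<in> multilinearity_relations \<Longrightarrow> \<psi> r = 0"
        by (rule separating_functional) (rule that)
      interpret L: Vector_Spaces.linear fun_scale "(*)" \<psi> by (rule lin)
      define \<phi> where "\<phi> xs = \<psi> (formal xs)" for xs
      have "multilinear_form \<phi>"
        unfolding multilinear_form_def
      proof (intro conjI ballI allI)
        fix xs ys x y assume "xs \<in> lists HH" "ys \<in> lists HH" "x \<in> HH" "y \<in> HH"
        then have "\<psi> (formal (xs @ (x \<oplus> y) # ys) - formal (xs @ x # ys) - formal (xs @ y # ys)) = 0"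
          by (intro zero) (unfold multilinearity_relations_def, blast)
        then show "\<phi> (xs @ (x \<oplus> y) # ys) = \<phi> (xs @ x # ys) + \<phi> (xs @ y # ys)"
          by (simp only: L.diff \<phi>_def) (simp add: algebra_simps)
      next
        fix xs ys x c assume "xs \<in> lists HH" "ys \<in> lists HH" "x \<in> HH"
        then have "\<psi> (formal (xs @ (c \<odot> x) # ys) - fun_scale c (formal (xs @ x # ys))) = 0"
          by (intro zero) (unfold multilinearity_relations_def, blast)
        then show "\<phi> (xs @ (c \<odot> x) # ys) = c * \<phi> (xs @ x # ys)"
          by (simp add: L.diff L.scale \<phi>_def)
      qed
      then have "?T \<phi> = (\<Sum>xs\<in>S. c xs * \<psi> (formal xs))"
        by (simp add: T \<phi>_def)
      also have "\<dots> = \<psi> ?F"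
        by (simp add: L.sum L.scale)
      finally show False using T0 one by simp
    qed
  next
    assume mem: "?F \<in> V.span multilinearity_relations"
    have supp: "finite {ys. r ys \<noteq> 0} \<and> (\<Sum>ys | r ys \<noteq> 0. r ys * \<phi> ys) = 0"
      if "r \<in> V.span multilinearity_relations" "multilinear_form \<phi>" for r \<phi>
    proof -
      define ev where "ev = (\<lambda>r :: 'a cochain set list \<Rightarrow> 'k. \<Sum>ys | r ys \<noteq> 0. r ys * \<phi> ys)"
      define Fin where "Fin = {r :: 'a cochain set list \<Rightarrow> 'k. finite {ys. r ys \<noteq> 0}}"
      have ev: "ev r = (\<Sum>ys\<in>A. r ys * \<phi> ys)" if "finite A" "{ys. r ys \<noteq> 0} \<subseteq> A" for r A
        unfolding ev_def using that by (intro sum.mono_neutral_left) auto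
      have Fadd: "r + s \<in> Fin \<and> ev (r + s) = ev r + ev s" if "r \<in> Fin" "s \<in> Fin" for r s
      proof -
        let ?A = "{ys. r ys \<noteq> 0} \<union> {ys. s ys \<noteq> 0}"
        have fin: "finite ?A" using that by (simp add: Fin_def)
        have sub: "{ys. (r + s) ys \<noteq> 0} \<subseteq> ?A" by auto
        have "ev (r + s) = ev r + ev s"
          by (subst (1 2 3) ev[OF fin]) (use sub in \<open>auto simp: sum.distrib algebra_simps\<close>)
        then show ?thesis using finite_subset[OF sub fin] by (simp add: Fin_def)
      qed
      have Fsc: "fun_scale a r \<in> Fin \<and> ev (fun_scale a r) = a * ev r" if "r \<in> Fin" for a r
      proof -
        have fin: "finite {ys. r ys \<noteq> 0}" using that by (simp add: Fin_def)
        have sub: "{ys. fun_scale a r ys \<noteq> 0} \<subseteq> {ys. r ys \<noteq> 0}" by (auto simp: fun_scale_def)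
        have "ev (fun_scale a r) = a * ev r"
          by (subst (1 2) ev[OF fin])
            (use sub in \<open>auto simp: fun_scale_def sum_distrib_left algebra_simps\<close>)
        then show ?thesis using finite_subset[OF sub fin] by (simp add: Fin_def)
      qed
      have Ffo: "formal xs \<in> Fin \<and> ev (formal xs) = \<phi> xs" for xs
        using ev[of "{xs}" "formal xs"] by (auto simp: Fin_def formal_def)
      have Fdi: "r - s \<in> Fin \<and> ev (r - s) = ev r - ev s" if "r \<in> Fin" "s \<in> Fin" for r s
      proof -
        have "r - s = r + fun_scale (- 1) s" by (auto simp: fun_scale_def fun_eq_iff)
        then show ?thesis
          using Fadd[OF that(1) Fsc[OF that(2), of "- 1", THEN conjunct1]] Fsc[OF that(2), of "- 1"]
          by simp
      qed
      have add: "\<phi> (xs @ (x \<oplus> y) # ys) = \<phi> (xs @ x # ys) + \<phi> (xs @ y # ys)"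
        if "set xs \<subseteq> HH" "set ys \<subseteq> HH" "x \<in> HH" "y \<in> HH" for xs ys x y
        using \<open>multilinear_form \<phi>\<close> that unfolding multilinear_form_def lists_eq_set by blast
      have scale: "\<phi> (xs @ (c \<odot> x) # ys) = c * \<phi> (xs @ x # ys)"
        if "set xs \<subseteq> HH" "set ys \<subseteq> HH" "x \<in> HH" for xs ys x c
        using \<open>multilinear_form \<phi>\<close> that unfolding multilinear_form_def lists_eq_set by blast
      have rel: "r \<in> Fin \<and> ev r = 0" if "r \<in> multilinearity_relations" for r
        using that unfolding multilinearity_relations_def lists_eq_set
        by (auto simp: Fdi Ffo Fsc add scale)
      have "r \<in> Fin \<and> ev r = 0"
        using that(1)
      proof (induction rule: V.span_induct_alt)
        case base
        show ?case by (simp add: Fin_def ev_def)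
      next
        case (step a x y)
        then show ?case using rel[of x] Fsc[of x a] Fadd[of "fun_scale a x" y] by (simp add: plus_fun_def)
      qed
      then show ?thesis by (simp add: Fin_def ev_def)
    qed
    have "?T \<phi> = 0" for \<phi>
    proof (cases "multilinear_form \<phi>")
      case True
      have "(\<Sum>xs\<in>S. c xs * \<phi> xs) = (\<Sum>ys | ?F ys \<noteq> 0. ?F ys * \<phi> ys)"
        using assms(1) by (intro sum.mono_neutral_cong_right) (auto simp: F)
      with supp[OF mem True] True show ?thesis by (simp add: T)
    next
      case False
      then show ?thesis unfolding T by simp
    qed
    then show "?T = 0" by (simp add: fun_eq_iff)
  qed
qed

text \<open>
  \<open>lin_ext F\<close> is the linear map on tensors with \<open>pure xs \<mapsto> F xs\<close>, for \<open>F\<close> multilinear.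
  On pure tensors, \<open>\<cdot>\<close> is concatenation.
\<close>

definition lin_ext ::
    "('a cochain set list \<Rightarrow> ('a cochain set, 'k) tensor) \<Rightarrow>
     ('a cochain set, 'k) tensor \<Rightarrow> ('a cochain set, 'k) tensor" where
  "lin_ext F t = (\<lambda>\<phi>. if multilinear_form \<phi> then t (\<lambda>xs. F xs \<phi>) else 0)"

definition tensor_mult ::
    "('a cochain set, 'k) tensor \<Rightarrow> ('a cochain set, 'k) tensor \<Rightarrow> ('a cochain set, 'k) tensor"
    (infixl "\<cdot>" 70) where
  "s \<cdot> t = lin_ext (\<lambda>xs. lin_ext (\<lambda>ys. pure (xs @ ys)) t) s"

text \<open>
  The tensor product of linear maps \<open>F\<close> and \<open>G\<close> with Koszul signs, where \<open>F\<close> is defined on the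
  tensor power of exponent \<open>m\<close> and \<open>G\<close> has degree \<open>d\<close> modulo 2:
  \<open>(F \<otimes> G)(x \<otimes> y) = (-1)\<^sup>d\<^sup>|\<^sup>x\<^sup>| F(x) \<otimes> G(y)\<close>.
\<close>

definition tensor_map ("(_ \<otimes>[_,_]/ _)" [71, 0, 0, 70] 70) where
  "(F \<otimes>[m,d] G) =
     lin_ext (\<lambda>zs. F (pure (map (hsign ^^ d) (take m zs))) \<cdot> G (pure (drop m zs)))"

text \<open>
  The transposition \<open>x \<otimes> y \<mapsto> (-1)\<^sup>|\<^sup>x\<^sup>|\<^sup>|\<^sup>y\<^sup>| y \<otimes> x\<close>, extended to inhomogeneous classes by splitting
  \<open>y\<close> into its even and its odd part.
\<close>

definition swap :: "('a cochain set, 'k) tensor \<Rightarrow> ('a cochain set, 'k) tensor" ("\<tau>") where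
  "\<tau> = lin_ext (\<lambda>zs. case zs of [X, Y] \<Rightarrow> pure [heven Y, X] + pure [hodd Y, hsign X] | _ \<Rightarrow> 0)"

definition coproduct_values :: "'a cochain set \<Rightarrow> ('a cochain set, 'k) tensor set" where
  "coproduct_values X = {\<Sum>(f', f'')\<leftarrow>ps. pure [cls f', cls f''] | f ps.
     f \<in> X \<and> represents_coproduct ps f}"

definition coproduct :: "'a cochain set \<Rightarrow> ('a cochain set, 'k) tensor" where
  "coproduct X = (THE t. t \<in> coproduct_values X)"

definition mu :: "('a cochain set, 'k) tensor \<Rightarrow> ('a cochain set, 'k) tensor" ("\<mu>") where
  "\<mu> = lin_ext (\<lambda>zs. case zs of [X, Y] \<Rightarrow> pure [X \<smile>\<^sub>H Y] | _ \<Rightarrow> 0)"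

definition vee :: "('a cochain set, 'k) tensor \<Rightarrow> ('a cochain set, 'k) tensor" ("\<nu>") where
  "\<nu> = lin_ext (\<lambda>zs. case zs of [X] \<Rightarrow> coproduct X | _ \<Rightarrow> 0)"

definition bv :: "('a cochain set, 'k) tensor \<Rightarrow> ('a cochain set, 'k) tensor" ("\<Delta>") where
  "\<Delta> = lin_ext (\<lambda>zs. case zs of [X] \<Rightarrow> pure [hDelta X] | _ \<Rightarrow> 0)"

definition tilde :: "('a cochain set, 'k) tensor \<Rightarrow> ('a cochain set, 'k) tensor" ("\<rho>") where
  "\<rho> = lin_ext (\<lambda>zs. case zs of [X] \<Rightarrow> pure [hreversal X] | _ \<Rightarrow> 0)"


section \<open>The asserted properties\<close>

definition descends :: "('a cochain \<Rightarrow> 'a cochain) \<Rightarrow> bool" where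
  "descends F \<longleftrightarrow> F ` cochains \<subseteq> cochains \<and> F ` cocycles \<subseteq> cocycles \<and>
     (\<lambda>f. cls (F f)) respects cohomologous"

definition descends2 :: "('a cochain \<Rightarrow> 'a cochain \<Rightarrow> 'a cochain) \<Rightarrow> bool" where
  "descends2 F \<longleftrightarrow>
     (\<forall>f\<in>cochains. \<forall>g\<in>cochains. F f g \<in> cochains) \<and>
     (\<forall>f\<in>cocycles. \<forall>g\<in>cocycles. F f g \<in> cocycles) \<and>
     (\<lambda>f g. cls (F f g)) respects2 cohomologous"

definition operations_induced :: bool where
  "operations_induced \<longleftrightarrow>
     equiv cocycles cohomologous \<and>
     descends2 (\<smile>) \<and> descends Delta \<and> descends reversal \<and>
     (\<forall>f\<in>cochains. \<forall>as. \<exists>!c. is_Delta_value f as c) \<and>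
     (\<forall>f\<in>cocycles. \<exists>ps. represents_coproduct ps f) \<and>
     (\<forall>X\<in>HH. \<exists>!t. t \<in> coproduct_values X)"

definition HH_linear :: "('a cochain set \<Rightarrow> 'a cochain set) \<Rightarrow> bool" where
  "HH_linear F \<longleftrightarrow> F ` HH \<subseteq> HH \<and>
     (\<forall>X\<in>HH. \<forall>Y\<in>HH. F (X \<oplus> Y) = F X \<oplus> F Y) \<and>
     (\<forall>c. \<forall>X\<in>HH. F (c \<odot> X) = c \<odot> F X)"

definition operations_linear :: bool where
  "operations_linear \<longleftrightarrow>
     (\<forall>X\<in>HH. HH_linear (\<lambda>Y. X \<smile>\<^sub>H Y) \<and> HH_linear (\<lambda>Y. Y \<smile>\<^sub>H X)) \<and>
     HH_linear hDelta \<and> HH_linear hreversal \<and>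
     (\<forall>X\<in>HH. \<forall>Y\<in>HH. coproduct (X \<oplus> Y) = coproduct X + coproduct Y) \<and>
     (\<forall>c. \<forall>X\<in>HH. coproduct (c \<odot> X) = fun_scale c (coproduct X))"

definition operations_graded :: bool where
  "operations_graded \<longleftrightarrow>
     (\<forall>p q. \<forall>X\<in>HH_degree p. \<forall>Y\<in>HH_degree q. X \<smile>\<^sub>H Y \<in> HH_degree (p + q)) \<and>
     (\<forall>n. \<forall>X\<in>HH_degree n. coproduct X \<in>
        module.span fun_scale {pure [U, V] | U V. U \<in> HH_degree 0 \<and> V \<in> HH_degree n}) \<and>
     (\<forall>X\<in>HH_degree 0. hDelta X = cls 0) \<and>
     (\<forall>n. \<forall>X\<in>HH_degree (n + 1). hDelta X \<in> HH_degree n) \<and>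
     (\<forall>n. \<forall>X\<in>HH_degree n. hreversal X \<in> HH_degree n)"

definition frobenius_algebra :: bool where
  "frobenius_algebra \<longleftrightarrow>
     (\<forall>X\<in>HH. \<forall>Y\<in>HH. \<forall>Z\<in>HH. (X \<smile>\<^sub>H Y) \<smile>\<^sub>H Z = X \<smile>\<^sub>H (Y \<smile>\<^sub>H Z)) \<and>
     (\<forall>p q. \<forall>X\<in>HH_degree p. \<forall>Y\<in>HH_degree q. X \<smile>\<^sub>H Y = (- 1) ^ (p * q) \<odot> (Y \<smile>\<^sub>H X)) \<and>
     (\<forall>t\<in>tensor_power 2. \<mu> (\<tau> t) = \<mu> t) \<and>
     (\<forall>t\<in>tensor_power 1. (\<nu> \<otimes>[1,0] id) (\<nu> t) = (id \<otimes>[1,0] \<nu>) (\<nu> t)) \<and>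
     (\<forall>t\<in>tensor_power 1. \<tau> (\<nu> t) = \<nu> t) \<and>
     (\<forall>t\<in>tensor_power 2. \<nu> (\<mu> t) = (id \<otimes>[1,0] \<mu>) ((\<nu> \<otimes>[1,0] id) t)) \<and>
     (\<forall>t\<in>tensor_power 2. \<nu> (\<mu> t) = (\<mu> \<otimes>[2,0] id) ((id \<otimes>[1,0] \<nu>) t))"

definition compatible_BV_operator :: bool where
  "compatible_BV_operator \<longleftrightarrow>
     (\<forall>X\<in>HH. hDelta (hDelta X) = cls 0) \<and>
     (\<forall>t\<in>tensor_power 3.
        \<Delta> (\<mu> ((\<mu> \<otimes>[2,0] id) t)) =
          \<mu> (((\<Delta> \<circ> \<mu>) \<otimes>[2,0] id) t)
          + \<mu> ((id \<otimes>[1,1] (\<Delta> \<circ> \<mu>)) t)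
          + \<mu> (((\<Delta> \<circ> \<mu>) \<otimes>[2,0] id) ((id \<otimes>[1,0] \<tau>) t))
          - \<mu> ((\<mu> \<otimes>[2,0] id)
              ((\<Delta> \<otimes>[1,0] (id \<otimes>[1,0] id)) t
               + (id \<otimes>[1,1] (\<Delta> \<otimes>[1,0] id)) t
               + (id \<otimes>[1,1] (id \<otimes>[1,1] \<Delta>)) t))) \<and>
     (\<forall>t\<in>tensor_power 1.
        (\<nu> \<otimes>[1,0] id) (\<nu> (\<Delta> t)) =
          ((\<nu> \<circ> \<Delta>) \<otimes>[1,0] id) (\<nu> t)
          + (id \<otimes>[1,1] (\<nu> \<circ> \<Delta>)) (\<nu> t)
          + (id \<otimes>[1,0] \<tau>) (((\<nu> \<circ> \<Delta>) \<otimes>[1,0] id) (\<nu> t))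
          - (let u = (\<nu> \<otimes>[1,0] id) (\<nu> t) in
               (\<Delta> \<otimes>[1,0] (id \<otimes>[1,0] id)) u
               + (id \<otimes>[1,1] (\<Delta> \<otimes>[1,0] id)) u
               + (id \<otimes>[1,1] (id \<otimes>[1,1] \<Delta>)) u))"

definition reversal_involution :: bool where
  "reversal_involution \<longleftrightarrow> (\<forall>X\<in>HH. hreversal (hreversal X) = X)"

definition eigenspace :: "'k \<Rightarrow> 'a cochain set set" where
  "eigenspace s = {X \<in> HH. hreversal X = s \<odot> X}"

definition Delta_swaps_eigenspaces :: bool where
  "Delta_swaps_eigenspaces \<longleftrightarrow>
     hDelta ` eigenspace 1 \<subseteq> eigenspace (- 1) \<and> hDelta ` eigenspace (- 1) \<subseteq> eigenspace 1"

definition reversal_anti_algebra_map :: bool where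
  "reversal_anti_algebra_map \<longleftrightarrow>
     (\<forall>p q. \<forall>X\<in>HH_degree p. \<forall>Y\<in>HH_degree q.
        hreversal (X \<smile>\<^sub>H Y) = (- 1) ^ (p * q) \<odot> (hreversal Y \<smile>\<^sub>H hreversal X))"

definition reversal_anti_coalgebra_map :: bool where
  "reversal_anti_coalgebra_map \<longleftrightarrow>
     (\<forall>X\<in>HH. coproduct (hreversal X) = (\<rho> \<otimes>[1,0] \<rho>) (\<tau> (coproduct X)))"

end

end

theory Submission
  imports Defs
begin

text \<open>
  Every operation on cochains is a signed sum over the ways of cutting the list of arguments into
  consecutive pieces (\<open>split_sum\<close>, \<open>split_sum3\<close>). The inner terms of the Hochschild differential
  merge two adjacent arguments (\<open>merge_sum\<close>). Applied to such a sum they act inside the single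
  pieces (\<open>merge_sum_split_sum3\<close>). The cocycle condition turns the merges inside the arguments of
  one cochain into products of its value with a neighbouring argument, and such an argument can be
  moved from one piece to the next (\<open>split_sum3_shift_left\<close>, \<open>split_sum3_shift_right\<close>), where it
  completes the differential of another cochain. All homotopies below are computed in this way.

  Commutativity of the product is Gerstenhaber's argument: inserting the value of \<open>g\<close> as one
  argument of \<open>f\<close>, in all places, is a homotopy between \<open>g \<smile> f\<close> and \<open>\<plusminus> f \<smile> g\<close>
  (\<open>cup_commute_coboundary\<close>).

  For the Batalin-Vilkovisky relation let \<open>\<theta> = \<langle>-, 1\<rangle>\<close>, and let \<open>B(f, y)\<close> be the cochain for which
  \<open>\<langle>B(f, y)(as), b\<rangle>\<close> is the signed sum over \<open>as = u @ v @ w\<close> of \<open>\<theta>(f(w @ b # u) * y(v))\<close>. Then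
  \<open>\<Delta> f = B(f, 1)\<close>, and since \<open>A\<close> is commutative, \<open>\<Delta>(f \<smile> y) = B(f, y) \<plusminus> B(y, f)\<close>: either \<open>f\<close> or \<open>y\<close>
  receives the marked argument \<open>b\<close> (\<open>Delta_cup\<close>). The homotopy that inserts the value of \<open>g\<close> into
  \<open>f\<close> in all places behind \<open>b\<close> has three boundary terms. The value of \<open>g\<close> can leave \<open>f\<close> at the
  end, it can be absorbed by \<open>b\<close>, and \<open>b\<close> can leave \<open>f\<close> at the beginning. Hence \<open>B(f, g \<smile> h)\<close> is
  homotopic to \<open>\<plusminus>(g \<smile> B(f, h) - (f \<circ> g) \<smile> h)\<close>, where \<open>f \<circ> g\<close> is the insertion of \<open>g\<close> into \<open>f\<close>
  (\<open>cyclic_sum_cup_coboundary\<close>). The case \<open>h = 1\<close> says that the deviation of \<open>\<Delta>\<close> from a derivation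
  is the bracket, the graded commutator of \<open>\<circ>\<close> (\<open>Delta_cup_coboundary\<close>). Comparing the formula for
  \<open>(g, h)\<close> with the case \<open>h = 1\<close> for \<open>g \<smile> h\<close> and for \<open>h\<close> shows that \<open>f \<circ> -\<close> is a derivation up to
  homotopy, while \<open>- \<circ> f\<close> is one exactly (\<open>insertion_cup\<close>). So the bracket is a derivation
  (\<open>bracket_cup_coboundary\<close>), and this is the Batalin-Vilkovisky relation
  (\<open>BV_defect_coboundary\<close>).

  The coproduct of \<open>f\<close> is \<open>\<Sum> e\<^sup>i \<otimes> e\<^sub>i \<chi> f\<close> with the Euler element \<open>\<chi> = \<Sum> e\<^sub>i e\<^sup>i\<close>. Multiplication
  by \<open>\<chi>\<close> is homotopic to zero in positive degrees (\<open>euler_homotopy\<close>), so the coproduct depends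
  only on the component \<open>f [] \<in> A\<close> of degree 0 (\<open>coproduct_unique\<close>). The coalgebra and Frobenius
  identities then follow from the symmetry and the invariance of \<open>\<Sum> e\<^sup>i \<otimes> e\<^sub>i\<close> (\<open>casimir_commute\<close>,
  \<open>casimir_mult\<close>). In the dual relation each term on the right applies \<open>\<Delta>\<close> to a class of degree 0
  and vanishes. The left hand side is built from \<open>\<chi>\<^sup>2 \<Delta> D\<close>, where the derivation \<open>D\<close> is the
  component of degree 1. As \<open>A\<close> is commutative, coboundaries of degree 1 are zero, hence
  \<open>\<chi> D = 0\<close>, and \<open>\<langle>\<chi>\<^sup>2 \<Delta> D, b\<rangle> = \<theta>(D(\<chi>\<^sup>2 b)) = 0\<close> by the Leibniz rule (\<open>euler_euler_Delta\<close>).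

  Reversal of the arguments commutes with the differential and turns a rotation into the inverse
  rotation, with a sign that makes it anticommute with \<open>\<Delta>\<close> (\<open>Delta_reversal\<close>).

  Identities between linear maps on tensor powers need to be checked on pure tensors only
  (\<open>tensor_power_eqI\<close>).
\<close>

section \<open>Sums over the decompositions of a list\<close>

lemma signed_zero [simp]: "signed n 0 = 0"
  by (simp add: signed_def)

lemma signed_0 [simp]: "signed 0 x = x"
  by (simp add: signed_def)

lemma signed_Suc [simp]: "signed (Suc n) x = - signed n x"
  by (simp add: signed_def)

lemma signed_add: "signed n (x + y :: 'b::ab_group_add) = signed n x + signed n y"
  by (simp add: signed_def)

lemma signed_minus: "signed n (- x) = - signed n x"
  by (simp add: signed_def)

lemma signed_diff: "signed n (x - y :: 'b::ab_group_add) = signed n x - signed n y"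
  by (simp add: signed_def)

lemma signed_signed: "signed m (signed n x) = signed (m + n) x"
  by (simp add: signed_def)

lemma signed_mult_left: "signed n x * (y :: 'b::ring) = signed n (x * y)"
  by (simp add: signed_def)

lemma signed_mult_right: "(x :: 'b::ring) * signed n y = signed n (x * y)"
  by (simp add: signed_def)

lemma signed_sum: "signed n (\<Sum>i\<in>I. x i :: 'b::ab_group_add) = (\<Sum>i\<in>I. signed n (x i))"
  by (simp add: signed_def sum_negf)

definition split_sum :: "('a list \<Rightarrow> 'a list \<Rightarrow> 'b::comm_monoid_add) \<Rightarrow> 'a list \<Rightarrow> 'b" where
  "split_sum X as = (\<Sum>p\<le>length as. X (take p as) (drop p as))"

lemma split_sum_Nil [simp]: "split_sum X [] = X [] []"
  by (simp add: split_sum_def)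

lemma split_sum_Cons: "split_sum X (a # xs) = X [] (a # xs) + split_sum (\<lambda>u. X (a # u)) xs"
  by (simp add: split_sum_def sum.atMost_Suc_shift del: sum.atMost_Suc)

lemma split_sum_cong:
  assumes "\<And>u v. u @ v = as \<Longrightarrow> X u v = Y u v"
  shows "split_sum X as = split_sum Y as"
  unfolding split_sum_def by (rule sum.cong) (auto intro: assms)

lemma split_sum_add:
  "split_sum (\<lambda>u v. X u v + Y u v) = (\<lambda>as. split_sum X as + split_sum Y as)"
  by (simp add: fun_eq_iff split_sum_def sum.distrib)

lemma split_sum_zero: "split_sum (\<lambda>u v. 0) = (\<lambda>as. 0)"
  by (simp add: fun_eq_iff split_sum_def)

lemma split_sum_minus:
  "split_sum (\<lambda>u v. - X u v :: 'b::ab_group_add) = (\<lambda>as. - split_sum X as)"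
  by (simp add: fun_eq_iff split_sum_def sum_negf)

lemma split_sum_diff:
  "split_sum (\<lambda>u v. X u v - Y u v :: 'b::ab_group_add) = (\<lambda>as. split_sum X as - split_sum Y as)"
  by (simp add: fun_eq_iff split_sum_def sum_subtractf)

lemma split_sum_signed:
  "signed n (split_sum X as :: 'b::ab_group_add) = split_sum (\<lambda>u v. signed n (X u v)) as"
  by (simp add: split_sum_def signed_sum)

lemma split_sum_mult_left: "c * split_sum X as = split_sum (\<lambda>u v. c * X u v :: 'b::ring) as"
  by (simp add: split_sum_def sum_distrib_left)

lemma split_sum_mult_right: "split_sum X as * c = split_sum (\<lambda>u v. X u v * c :: 'b::ring) as"
  by (simp add: split_sum_def sum_distrib_right)

lemma split_sum_first_Nil:
  "split_sum (\<lambda>u v. if u = [] then X v else 0) = X"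
proof
  fix as show "split_sum (\<lambda>u v. if u = [] then X v else 0) as = X as"
    by (cases as) (simp_all add: split_sum_Cons split_sum_zero)
qed

lemma split_sum_last_Nil:
  "split_sum (\<lambda>u v. if v = [] then X u else 0) = X"
proof
  fix as show "split_sum (\<lambda>u v. if v = [] then X u else 0) as = X as"
    by (induction as arbitrary: X) (simp_all add: split_sum_Cons)
qed

lemma split_sum_append_Cons:
  "split_sum X (xs @ b # ys) =
     split_sum (\<lambda>u v. X u (v @ b # ys)) xs + split_sum (\<lambda>u v. X (xs @ b # u) v) ys"
  by (induction xs arbitrary: X) (simp_all add: split_sum_Cons add.assoc)

lemma split_sum_snoc: "split_sum X (ys @ [a]) = split_sum (\<lambda>u v. X u (v @ [a])) ys + X (ys @ [a]) []"
  using split_sum_append_Cons[of X ys a "[]"] by simp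

lemma split_sum_assoc:
  "split_sum (\<lambda>u. split_sum (X u)) as = split_sum (\<lambda>s w. split_sum (\<lambda>u v. X u v w) s) as"
proof (induction as arbitrary: X)
  case (Cons a as)
  show ?case
    using Cons.IH[of "\<lambda>u. X (a # u)"]
    by (simp add: split_sum_Cons split_sum_add add.assoc)
qed simp

lemma split_sum_swap:
  "split_sum (\<lambda>v w. split_sum (\<lambda>r u. X r u v w) s) = (\<lambda>t. split_sum (\<lambda>r u. split_sum (X r u) t) s)"
  unfolding split_sum_def by (intro ext sum.swap)

text \<open>
  \<open>hd_case\<close> and \<open>last_case\<close> express terms that exist only if a piece is nonempty and that single
  out its first or its last entry.
\<close>

definition hd_case :: "('a \<Rightarrow> 'a list \<Rightarrow> 'b) \<Rightarrow> 'a list \<Rightarrow> 'b::zero" where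
  "hd_case Y v = (if v = [] then 0 else Y (hd v) (tl v))"

definition last_case :: "('a list \<Rightarrow> 'a \<Rightarrow> 'b) \<Rightarrow> 'a list \<Rightarrow> 'b::zero" where
  "last_case Y u = (if u = [] then 0 else Y (butlast u) (last u))"

lemma hd_case_simps [simp]: "hd_case Y [] = 0" "hd_case Y (a # v) = Y a v"
  by (simp_all add: hd_case_def)

lemma last_case_simps [simp]: "last_case Y [] = 0" "last_case Y (u @ [a]) = Y u a"
  by (simp_all add: last_case_def)

text \<open>
  The cut after a nonempty first piece is moved one entry to the left. An entry that has left the
  end of the first piece is then the head of the second one.
\<close>

lemma split_sum_shift:
  "split_sum (\<lambda>u v. last_case (\<lambda>u' a. Y u' a v) u) =
   split_sum (\<lambda>u. hd_case (Y u))"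
proof
  fix as show "split_sum (\<lambda>u v. last_case (\<lambda>u' a. Y u' a v) u) as = split_sum (\<lambda>u. hd_case (Y u)) as"
  proof (induction as arbitrary: Y)
  case (Cons a as)
  have "split_sum (\<lambda>u v. last_case (\<lambda>u' a. Y u' a v) (a # u)) as =
     split_sum (\<lambda>u v. (if u = [] then Y [] a v else 0) + last_case (\<lambda>u' b. Y (a # u') b v) u) as"
    by (rule split_sum_cong) (auto simp: last_case_def)
  then show ?case
    using Cons.IH[of "\<lambda>u. Y (a # u)"]
    by (simp add: split_sum_Cons split_sum_add split_sum_first_Nil)
  qed simp
qed

definition split_sum3 ::
    "('a list \<Rightarrow> 'a list \<Rightarrow> 'a list \<Rightarrow> 'b::comm_monoid_add) \<Rightarrow> 'a list \<Rightarrow> 'b" where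
  "split_sum3 X = split_sum (\<lambda>u. split_sum (X u))"

lemma split_sum3_cong:
  assumes "\<And>u v w. u @ v @ w = as \<Longrightarrow> X u v w = Y u v w"
  shows "split_sum3 X as = split_sum3 Y as"
  unfolding split_sum3_def by (intro split_sum_cong) (auto intro: assms)

lemma split_sum3_add:
  "split_sum3 (\<lambda>u v w. X u v w + Y u v w) = (\<lambda>as. split_sum3 X as + split_sum3 Y as)"
  by (simp add: split_sum3_def split_sum_add fun_eq_iff)

lemma split_sum3_zero: "split_sum3 (\<lambda>u v w. 0) = (\<lambda>as. 0)"
  by (simp add: split_sum3_def split_sum_zero fun_eq_iff)

lemma split_sum3_minus:
  "split_sum3 (\<lambda>u v w. - X u v w :: 'b::ab_group_add) = (\<lambda>as. - split_sum3 X as)"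
  by (simp add: split_sum3_def split_sum_minus fun_eq_iff)

lemma split_sum3_mult_left: "c * split_sum3 X as = split_sum3 (\<lambda>u v w. c * X u v w :: 'b::ring) as"
  by (simp add: split_sum3_def split_sum_mult_left)

lemma split_sum3_mult_right:
  "split_sum3 X as * c = split_sum3 (\<lambda>u v w. X u v w * c :: 'b::ring) as"
  by (simp add: split_sum3_def split_sum_mult_right)

lemma split_sum3_signed:
  "signed n (split_sum3 X as :: 'b::ab_group_add) = split_sum3 (\<lambda>u v w. signed n (X u v w)) as"
  by (simp add: split_sum3_def split_sum_signed)

lemma split_sum3_hd: "split_sum3 (\<lambda>u v w. hd_case (\<lambda>a u. X a u v w) u) as
    = hd_case (\<lambda>a. split_sum3 (X a)) as"
  by (cases as) (simp_all add: split_sum3_def split_sum_Cons split_sum_zero)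

lemma split_sum3_last:
  "split_sum3 (\<lambda>u v w. last_case (\<lambda>w a. X u v w a) w) as
    = last_case (\<lambda>as a. split_sum3 (\<lambda>u v w. X u v w a) as) as"
  by (cases as rule: rev_cases) (simp_all add: split_sum3_def split_sum_snoc)

lemma split_sum3_last_Nil:
  "split_sum3 (\<lambda>u v w. if w = [] then X u v else 0) as = split_sum X as"
  unfolding split_sum3_def split_sum_last_Nil ..

lemma split_sum3_alt: "split_sum3 X as = split_sum (\<lambda>s w. split_sum (\<lambda>u v. X u v w) s) as"
  by (simp add: split_sum3_def split_sum_assoc)

lemma split_sum3_shift_left:
  "split_sum3 (\<lambda>u v w. last_case (\<lambda>u' a. Y u' a v w) u) as =
   split_sum3 (\<lambda>u v w. hd_case (\<lambda>a v'. Y u a v' w) v) as"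
  by (simp add: split_sum3_alt split_sum_shift)

lemma split_sum3_shift_right:
  "split_sum3 (\<lambda>u v w. last_case (\<lambda>v' a. Y u v' a w) v) as =
   split_sum3 (\<lambda>u v. hd_case (Y u v)) as"
  by (simp add: split_sum3_def split_sum_shift)

text \<open>
  Sums over four pieces arise by cutting one of three pieces again. The next two lemmas regroup
  the pieces, so that a four-fold sum can be read as a composite of two operations.
\<close>

lemma split_sum3_refine_left:
  "split_sum3 (\<lambda>s v w. split_sum (\<lambda>r u. X r u v w) s) as =
   split_sum (\<lambda>r. split_sum3 (X r)) as"
  unfolding split_sum3_def
  by (subst split_sum_swap) (simp add: split_sum_assoc[of "\<lambda>r u. split_sum (X r u)"])

lemma split_sum3_refine_first:
  "split_sum3 (\<lambda>s v w. split_sum (\<lambda>u r. X u r v w) s) as =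
   split_sum3 (\<lambda>u y w. split_sum (\<lambda>r v. X u r v w) y) as"
  unfolding split_sum3_alt by (rule split_sum_cong) (simp add: split_sum_assoc)

lemma hd_case_additive: "L 0 = 0 \<Longrightarrow> L (hd_case Y v) = hd_case (\<lambda>a v. L (Y a v)) v"
  by (simp add: hd_case_def)

lemma last_case_additive: "L 0 = 0 \<Longrightarrow> L (last_case Y v) = last_case (\<lambda>v a. L (Y v a)) v"
  by (simp add: last_case_def)


section \<open>Alternating sums over products of adjacent entries\<close>

text \<open>
  The inner terms of the Hochschild differential, without the two outer ones. The recursion passes
  one entry at a time, so that every sign comes from a single step.
\<close>

fun merge_sum :: "('a::times list \<Rightarrow> 'b::ab_group_add) \<Rightarrow> 'a list \<Rightarrow> 'b" where
  "merge_sum f [] = 0"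
| "merge_sum f [a] = 0"
| "merge_sum f (a # b # xs) = - f ((a * b) # xs) - merge_sum (\<lambda>ys. f (a # ys)) (b # xs)"

lemma merge_sum_eq:
  "merge_sum f as = (\<Sum>j\<in>{1..<length as}.
     signed j (f (take (j - 1) as @ (as ! (j - 1) * as ! j) # drop (j + 1) as)))"
proof (induction f as rule: merge_sum.induct)
  case (3 f a b xs)
  let ?n = "length xs"
  have "(\<Sum>j\<in>{1..<length (a # b # xs)}.
     signed j (f (take (j - 1) (a # b # xs) @ ((a # b # xs) ! (j - 1) * (a # b # xs) ! j)
        # drop (j + 1) (a # b # xs)))) =
     (\<Sum>j\<in>{0..<Suc ?n}.
     signed (Suc j) (f (take j (a # b # xs) @ ((a # b # xs) ! j * (b # xs) ! j) # drop (j + 1) (b #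
         xs))))"
    unfolding length_Cons One_nat_def sum.shift_bounds_Suc_ivl by (simp del: sum.op_ivl_Suc)
  also have "\<dots> = - f ((a * b) # xs) + (\<Sum>j\<in>{1..<Suc ?n}.
     signed (Suc j) (f (take j (a # b # xs) @ ((a # b # xs) ! j * (b # xs) ! j) # drop (j + 1) (b #
         xs))))"
    by (subst sum.atLeast_Suc_lessThan) (simp_all del: sum.op_ivl_Suc)
  also have "(\<Sum>j\<in>{1..<Suc ?n}.
     signed (Suc j) (f (take j (a # b # xs) @ ((a # b # xs) ! j * (b # xs) ! j) # drop (j + 1) (b #
         xs))))
     = - (\<Sum>j\<in>{1..<Suc ?n}. signed j (f (a # take (j - 1) (b # xs) @ ((b # xs) ! (j - 1) * (b # xs) ! j)
        # drop (j + 1) (b # xs))))"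
    unfolding sum_negf[symmetric] by (rule sum.cong) (auto simp: take_Cons' nth_Cons')
  finally show ?case using 3 by simp
qed simp_all

lemma merge_sum_add: "merge_sum (\<lambda>x. f x + g x) as = merge_sum f as + merge_sum g as"
  by (simp add: merge_sum_eq signed_add sum.distrib)

lemma merge_sum_zero: "merge_sum (\<lambda>x. 0) as = 0"
  by (simp add: merge_sum_eq)

lemma merge_sum_minus: "merge_sum (\<lambda>x. - f x) as = - merge_sum f as"
  by (simp add: merge_sum_eq signed_minus sum_negf)

lemma merge_sum_additive:
  assumes "\<And>x y. L (x + y) = L x + L y"
  shows "merge_sum (\<lambda>x. L (f x)) as = L (merge_sum f as)"
proof -
  have 0: "L 0 = 0" using assms[of 0 0] by simp
  have m: "L (- x) = - L x" for x
    using assms[of x "- x"] by (simp add: 0 minus_unique)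
  have d: "L (x - y) = L x - L y" for x y
    using assms[of x "- y"] by (simp add: m)
  show ?thesis
    by (induction f as rule: merge_sum.induct) (simp_all add: 0 m d)
qed

text \<open>
  A merge shortens the list by one, so a sign that depends on the length is evaluated at the
  length decreased by one. For the empty list, where this is a default value, both sides vanish.
\<close>

lemma merge_sum_signed_length:
  "merge_sum (\<lambda>x. signed (c (length x)) (f x)) as = signed (c (length as - 1)) (merge_sum f as)"
proof (induction f as arbitrary: c rule: merge_sum.induct)
  case (3 f a b xs)
  show ?case using "3.IH"[of "\<lambda>n. c (Suc n)"] by (simp add: signed_diff signed_minus)
qed simp_all

text \<open>
  Every pair of adjacent entries of a decomposed list that has been merged beforehand lies in one
  piece, so no junction terms occur. This is the Leibniz rule with the Koszul sign of passing the
  first piece.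
\<close>

lemma merge_sum_split_sum:
  "merge_sum (split_sum X) as =
   split_sum (\<lambda>u v. merge_sum (\<lambda>u. X u v) u + signed (length u) (merge_sum (X u) v)) as"
proof (induction "length as" arbitrary: X as)
  case (Suc n)
  show ?case
  proof (cases as rule: remdups_adj.cases)
    case (3 a b xs)
    have IH: "merge_sum (split_sum (\<lambda>u. X (a # u))) (b # xs) =
       split_sum (\<lambda>u v. merge_sum (\<lambda>u. X (a # u) v) u + signed (length u)
           (merge_sum (X (a # u)) v)) (b # xs)"
      using Suc 3 by auto
    show ?thesis
      using IH unfolding 3
      by (simp add: split_sum_Cons merge_sum_add split_sum_add split_sum_minus split_sum_diff)
  qed (use Suc in \<open>auto simp: split_sum_Cons\<close>)
qed simp

lemma merge_sum_of_split_sum: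
  "merge_sum (\<lambda>u. split_sum (X u) s) as = split_sum (\<lambda>v w. merge_sum (\<lambda>u. X u v w) as) s"
  by (induction s arbitrary: X) (simp_all add: split_sum_Cons merge_sum_add)

lemma merge_sum_split_sum3:
  "merge_sum (split_sum3 X) as =
   split_sum3 (\<lambda>u v w. merge_sum (\<lambda>u. X u v w) u
      + signed (length u) (merge_sum (\<lambda>v. X u v w) v)
      + signed (length u + length v) (merge_sum (X u v) w)) as"
  by (simp add: split_sum3_def merge_sum_split_sum merge_sum_of_split_sum split_sum_add
      split_sum_signed signed_add signed_signed add.assoc)

text \<open>
  In contrast to the sum over all cuts, a fixed list \<open>xs @ ys\<close> has one adjacent pair that lies
  across the cut.
\<close>

lemma merge_sum_append:
  "merge_sum f (xs @ ys) = merge_sum (\<lambda>xs. f (xs @ ys)) xs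
     + signed (length xs) (merge_sum (\<lambda>ys. f (xs @ ys)) ys)
     + signed (length xs)
         (last_case (\<lambda>xs' a. hd_case (\<lambda>b ys'. f (xs' @ (a * b) # ys')) ys) xs)"
proof (induction "length xs" arbitrary: f xs)
  case (Suc n)
  show ?case
  proof (cases xs rule: remdups_adj.cases)
    case (2 a)
    then show ?thesis by (cases ys) (simp_all add: last_case_def)
  next
    case (3 a b zs)
    show ?thesis
      using Suc(1)[of "b # zs" "\<lambda>zs. f (a # zs)"] Suc(2) unfolding 3
      by (simp add: last_case_def algebra_simps)
  qed (use Suc in auto)
qed simp

lemma merge_sum_Cons:
  "merge_sum f (a # xs) = - hd_case (\<lambda>b ys. f ((a * b) # ys)) xs - merge_sum (\<lambda>ys. f (a # ys)) xs"
  by (cases xs) simp_all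

context inner_product_algebra
begin

section \<open>Duality for the inner product\<close>

lemma scale_mult_right: "a * (r *s b) = r *s (a * b)"
  by (metis scale_mult mult.commute)

lemma scale_mult_left: "(r *s a) * b = r *s (a * b)"
  by (simp add: scale_mult)

lemma ip_commute: "\<langle>a, b\<rangle> = \<langle>b, a\<rangle>"
  by (metis cyclic mult.commute mult_1_right)

lemma ip_zero [simp]: "\<langle>0, a\<rangle> = 0" "\<langle>a, 0\<rangle> = 0"
  using ip_scale_left[of 0 0 a] ip_scale_right[of a 0 0] by simp_all

lemma ip_minus: "\<langle>- a, b\<rangle> = - \<langle>a, b\<rangle>"
  using ip_add_left[of a "- a" b] by (simp add: add_eq_0_iff)

lemma ip_diff: "\<langle>a - b, c\<rangle> = \<langle>a, c\<rangle> - \<langle>b, c\<rangle>"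
  using ip_add_left[of a "- b" c] by (simp add: ip_minus)

lemma ip_signed: "\<langle>signed n a, b\<rangle> = signed n \<langle>a, b\<rangle>"
  by (simp add: signed_def ip_minus)

lemma ip_sum: "\<langle>\<Sum>i\<in>I. x i, b\<rangle> = (\<Sum>i\<in>I. \<langle>x i, b\<rangle>)"
  by (induction I rule: infinite_finite_induct) (simp_all add: ip_add_left)

lemma ip_eqI: "(\<And>b. \<langle>a, b\<rangle> = \<langle>c, b\<rangle>) \<Longrightarrow> a = c"
  using nondegenerate_left[of "a - c"] by (simp add: ip_diff)

lemma ip_mult_left: "\<langle>c * a, b\<rangle> = \<langle>a, c * b\<rangle>"
  by (metis invariant mult.commute)

lemma basis_expansion: obtains r where "a = (\<Sum>e\<in>Basis. r e *s e)"
proof -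
  have "a \<in> span Basis" by (simp add: span_Basis)
  then show ?thesis using that by (auto simp: span_finite[OF finite_Basis])
qed

lemma basis_coefficients:
  assumes "(\<Sum>e\<in>Basis. r e *s e) = (\<Sum>e\<in>Basis. q e *s e)" "e \<in> Basis"
  shows "r e = q e"
proof -
  have "(\<Sum>e\<in>Basis. (r e - q e) *s e) = 0"
    using assms(1) by (simp add: scale_left_diff_distrib sum_subtractf)
  then show ?thesis
    using independentD[OF independent_Basis finite_Basis order.refl, of "\<lambda>e. r e - q e"] assms(2)
    by simp
qed

text \<open>
  The map \<open>c \<mapsto> \<Sum>\<^sub>e \<langle>e, c\<rangle> e\<close> is injective by nondegeneracy, hence surjective in finite dimension.
  A preimage of \<open>e\<close> has the required inner products with the basis.
\<close>

lemma dual_basis_exists: "\<exists>c. \<forall>e'\<in>Basis. \<langle>e', c\<rangle> = (if e' = e then 1 else 0)" if "e \<in> Basis"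
proof -
  define L where "L c = (\<Sum>e\<in>Basis. \<langle>e, c\<rangle> *s e)" for c
  have lin: "Vector_Spaces.linear scl scl L"
    by unfold_locales (simp_all add: L_def ip_add_right ip_scale_right scale_left_distrib
        sum.distrib scale_sum_right)
  interpret L: Vector_Spaces.linear scl scl L by (rule lin)
  have "c = 0" if "L c = 0" for c
  proof (rule nondegenerate_right)
    fix a
    obtain r where r: "a = (\<Sum>e\<in>Basis. r e *s e)" by (rule basis_expansion)
    have "\<langle>e, c\<rangle> = 0" if "e \<in> Basis" for e
      using basis_coefficients[of "\<lambda>e. \<langle>e, c\<rangle>" "\<lambda>_. 0"] that \<open>L c = 0\<close> by (simp add: L_def)
    then show "\<langle>a, c\<rangle> = 0" by (simp add: r ip_sum ip_scale_left)
  qed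
  then have "inj L" by (simp add: L.inj_iff_eq_0)
  then have "surj L" using lin linear_inj_imp_surj by blast
  then obtain c where "L c = e" by (metis surj_def)
  moreover have "(\<Sum>e'\<in>Basis. (if e' = e then 1 else 0) *s e') = e"
    using that finite_Basis by (simp add: if_distrib[of "\<lambda>x. x *s _"] cong: if_cong)
  ultimately have "\<langle>e', c\<rangle> = (if e' = e then 1 else 0)" if "e' \<in> Basis" for e'
    using basis_coefficients[of "\<lambda>e. \<langle>e, c\<rangle>" "\<lambda>e'. if e' = e then 1 else 0"] that
    by (simp add: L_def)
  then show ?thesis by blast
qed

lemma ip_basis_eqI:
  assumes "\<And>e. e \<in> Basis \<Longrightarrow> \<langle>e, c\<rangle> = \<langle>e, d\<rangle>"
  shows "c = d"
proof (rule ip_eqI)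
  fix a
  obtain r where r: "a = (\<Sum>e\<in>Basis. r e *s e)" by (rule basis_expansion)
  have "\<langle>a, c\<rangle> = \<langle>a, d\<rangle>" by (simp add: r ip_sum ip_scale_left assms)
  then show "\<langle>c, a\<rangle> = \<langle>d, a\<rangle>" by (simp add: ip_commute)
qed

lemma ip_dual_basis:
  assumes "e \<in> Basis" "e' \<in> Basis"
  shows "\<langle>e', dual_basis e\<rangle> = (if e' = e then 1 else 0)"
proof -
  obtain c where c: "\<forall>e'\<in>Basis. \<langle>e', c\<rangle> = (if e' = e then 1 else 0)"
    using dual_basis_exists[OF assms(1)] by blast
  have "dual_basis e = c"
    unfolding dual_basis_def
    by (rule the_equality[where P = "\<lambda>c. \<forall>e'\<in>Basis. \<langle>e', c\<rangle> = (if e' = e then 1 else 0)", OF c])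
      (rule ip_basis_eqI, simp add: c)
  then show ?thesis using c assms(2) by simp
qed

lemma expand_dual_basis: "(\<Sum>e\<in>Basis. \<langle>a, e\<rangle> *s dual_basis e) = a"
proof (rule ip_basis_eqI)
  fix e' assume e': "e' \<in> Basis"
  have "\<langle>e', \<Sum>e\<in>Basis. \<langle>a, e\<rangle> *s dual_basis e\<rangle> = (\<Sum>e\<in>Basis. \<langle>a, e\<rangle> * \<langle>e', dual_basis e\<rangle>)"
    by (subst ip_commute) (simp add: ip_sum ip_scale_left ip_commute[of "dual_basis _"])
  also have "\<dots> = (\<Sum>e\<in>Basis. if e = e' then \<langle>a, e\<rangle> else 0)"
    by (rule sum.cong) (auto simp: ip_dual_basis e')
  finally show "\<langle>e', \<Sum>e\<in>Basis. \<langle>a, e\<rangle> *s dual_basis e\<rangle> = \<langle>e', a\<rangle>"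
    using e' finite_Basis by (simp add: ip_commute)
qed

lemma expand_basis: "(\<Sum>e\<in>Basis. \<langle>a, dual_basis e\<rangle> *s e) = a"
proof -
  obtain r where r: "a = (\<Sum>e\<in>Basis. r e *s e)" by (rule basis_expansion)
  have "\<langle>a, dual_basis e\<rangle> = r e" if "e \<in> Basis" for e
  proof -
    have "\<langle>a, dual_basis e\<rangle> = (\<Sum>e'\<in>Basis. if e' = e then r e' else 0)"
      unfolding r by (simp add: ip_sum ip_scale_left ip_dual_basis that mult.commute if_distrib cong:
          if_cong)
    then show ?thesis using that finite_Basis by simp
  qed
  then have "(\<Sum>e\<in>Basis. \<langle>a, dual_basis e\<rangle> *s e) = (\<Sum>e\<in>Basis. r e *s e)"
    by (intro sum.cong) simp_all
  then show ?thesis using r by simp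
qed

definition linear_endo :: "('a \<Rightarrow> 'a) \<Rightarrow> bool" where
  "linear_endo L \<longleftrightarrow> (\<forall>x y. L (x + y) = L x + L y) \<and> (\<forall>c x. L (c *s x) = c *s L x)"

text \<open>
  The element that represents the functional \<open>b \<mapsto> \<langle>L b, 1\<rangle>\<close>. With it, operations that are defined
  by their inner products with all \<open>b\<close> become explicit cochains with values in the algebra.
\<close>

definition repr :: "('a \<Rightarrow> 'a) \<Rightarrow> 'a" where
  "repr L = (\<Sum>e\<in>Basis. \<langle>L e, 1\<rangle> *s dual_basis e)"

lemma ip_repr:
  assumes "linear_endo L"
  shows "\<langle>repr L, b\<rangle> = \<langle>L b, 1\<rangle>"
proof -
  have L0: "L 0 = 0" using assms unfolding linear_endo_def by (metis add_cancel_right_left)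
  have Lsum: "L (\<Sum>i\<in>I. x i) = (\<Sum>i\<in>I. L (x i))" for x :: "'a \<Rightarrow> 'a" and I
    using assms by (induction I rule: infinite_finite_induct) (simp_all add: L0 linear_endo_def)
  have "\<langle>L b, 1\<rangle> = \<langle>L (\<Sum>e\<in>Basis. \<langle>b, dual_basis e\<rangle> *s e), 1\<rangle>"
    by (simp only: expand_basis)
  also have "\<dots> = (\<Sum>e\<in>Basis. \<langle>b, dual_basis e\<rangle> * \<langle>L e, 1\<rangle>)"
    using assms unfolding Lsum by (simp add: linear_endo_def ip_sum ip_scale_left)
  also have "\<dots> = \<langle>repr L, b\<rangle>"
    by (simp add: repr_def ip_sum ip_scale_left ip_commute[of b] mult.commute)
  finally show ?thesis by simp
qed

lemma repr_eqI:
  assumes "linear_endo L" "\<And>b. \<langle>c, b\<rangle> = \<langle>L b, 1\<rangle>"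
  shows "repr L = c"
  by (rule ip_eqI) (simp add: ip_repr assms)

lemma repr_mult:
  assumes "linear_endo L"
  shows "repr (\<lambda>b. L (c * b)) = c * repr L"
proof (rule repr_eqI)
  show "linear_endo (\<lambda>b. L (c * b))"
    using assms by (simp add: linear_endo_def distrib_left scale_mult_right)
qed (simp add: ip_mult_left ip_repr assms)

lemma repr_mult_const: "repr (\<lambda>b. b * c) = c"
  by (rule repr_eqI)
    (simp_all add: linear_endo_def distrib_right scale_mult_left, metis cyclic mult_1_left)

lemma repr_zero: "repr (\<lambda>b. 0) = 0"
  by (simp add: repr_def)

lemma repr_add: "repr (\<lambda>b. L b + L' b) = repr L + repr L'"
  by (simp add: repr_def ip_add_left scale_left_distrib sum.distrib)

lemma repr_minus: "repr (\<lambda>b. - L b) = - repr L"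
  by (simp add: repr_def ip_minus sum_negf)

lemma repr_signed: "repr (\<lambda>b. signed n (L b)) = signed n (repr L)"
  by (simp add: signed_def repr_minus)

lemma repr_scale: "repr (\<lambda>b. c *s L b) = c *s repr L"
  by (simp add: repr_def ip_scale_left scale_sum_right)

lemma repr_split_sum: "repr (\<lambda>b. split_sum (\<lambda>u v. X u v b) as) = split_sum (\<lambda>u v. repr (X u v)) as"
  by (induction as arbitrary: X) (simp_all add: split_sum_Cons repr_add)

lemma repr_hd_case: "repr (\<lambda>b. hd_case (\<lambda>a u. X a u b) u) = hd_case (\<lambda>a u. repr (X a u)) u"
  by (simp add: hd_case_def repr_zero)

lemma repr_last_case: "repr (\<lambda>b. last_case (\<lambda>u a. X u a b) u) = last_case (\<lambda>u a. repr (X u a)) u"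
  by (simp add: last_case_def repr_zero)

lemma merge_sum_repr: "merge_sum (\<lambda>u. repr (\<lambda>b. X u b)) as = repr (\<lambda>b. merge_sum (\<lambda>u. X u b) as)"
proof (induction "length as" arbitrary: X as)
  case (Suc n)
  show ?case
    using Suc(1)[of "tl as" "\<lambda>u. X (hd as # u)"] Suc(2)
    by (cases as rule: remdups_adj.cases)
      (simp_all add: repr_zero repr_minus repr_add[of "\<lambda>b. - _ b" "\<lambda>b. - _ b", simplified])
qed (simp add: repr_zero)


section \<open>Multilinear cochains\<close>

lemma cochainsI:
  assumes "\<And>xs ys x y. f (xs @ (x + y) # ys) = f (xs @ x # ys) + f (xs @ y # ys)"
    and "\<And>xs ys c x. f (xs @ (c *s x) # ys) = c *s f (xs @ x # ys)"
    and "\<And>xs ys. f (xs @ 1 # ys) = 0"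
  shows "f \<in> cochains"
  using assms unfolding cochains_def by (auto dest!: split_list)

lemma cochain_add: "f \<in> cochains \<Longrightarrow> f (xs @ (x + y) # ys) = f (xs @ x # ys) + f (xs @ y # ys)"
  by (simp add: cochains_def)

lemma cochain_scale: "f \<in> cochains \<Longrightarrow> f (xs @ (c *s x) # ys) = c *s f (xs @ x # ys)"
  by (simp add: cochains_def)

lemma cochain_one: "f \<in> cochains \<Longrightarrow> 1 \<in> set xs \<Longrightarrow> f xs = 0"
  by (simp add: cochains_def)

lemma cochain_entry_zero: "f \<in> cochains \<Longrightarrow> f (xs @ 0 # ys) = 0"
  using cochain_add[of f xs 0 0 ys] by simp

lemma cochain_entry_minus: "f \<in> cochains \<Longrightarrow> f (xs @ (- x) # ys) = - f (xs @ x # ys)"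
  using cochain_add[of f xs x "- x" ys] cochain_entry_zero[of f xs ys] by (simp add: add_eq_0_iff)

lemma cochain_entry_diff:
  "f \<in> cochains \<Longrightarrow> f (xs @ (x - y) # ys) = f (xs @ x # ys) - f (xs @ y # ys)"
  using cochain_add[of f xs x "- y" ys] by (simp add: cochain_entry_minus)

lemma cochain_entry_signed: "f \<in> cochains \<Longrightarrow> f (xs @ signed n x # ys) = signed n (f (xs @ x # ys))"
  by (simp add: signed_def cochain_entry_minus)

lemma linear_endo_cochain: "f \<in> cochains \<Longrightarrow> linear_endo (\<lambda>b. f (w @ b # u) * c)"
  by (simp add: linear_endo_def cochain_add cochain_scale distrib_right scale_mult_left)

named_theorems cochain_intros

lemma zero_cochain [cochain_intros]: "(\<lambda>as. 0) \<in> cochains"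
  by (rule cochainsI) simp_all

lemma add_cochain [cochain_intros]:
  "f \<in> cochains \<Longrightarrow> g \<in> cochains \<Longrightarrow> (\<lambda>as. f as + g as) \<in> cochains"
  by (rule cochainsI) (simp_all add: cochain_add cochain_scale cochain_one scale_right_distrib)

lemma minus_cochain [cochain_intros]: "f \<in> cochains \<Longrightarrow> (\<lambda>as. - f as) \<in> cochains"
  by (rule cochainsI) (simp_all add: cochain_add cochain_scale cochain_one)

lemma diff_cochain [cochain_intros]:
  "f \<in> cochains \<Longrightarrow> g \<in> cochains \<Longrightarrow> (\<lambda>as. f as - g as) \<in> cochains"
  by (rule cochainsI) (simp_all add: cochain_add cochain_scale cochain_one scale_right_diff_distrib)

lemma scale_cochain [cochain_intros]: "f \<in> cochains \<Longrightarrow> (\<lambda>as. c *s f as) \<in> cochains"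
  by (rule cochainsI) (simp_all add: cochain_add cochain_scale cochain_one scale_right_distrib
      mult.commute)

lemma signed_cochain [cochain_intros]:
  "f \<in> cochains \<Longrightarrow> (\<lambda>as. signed (n (length as)) (f as)) \<in> cochains"
  by (rule cochainsI)
    (simp_all add: cochain_add cochain_scale cochain_one signed_add, simp add: signed_def)

lemma mult_left_cochain [cochain_intros]: "f \<in> cochains \<Longrightarrow> (\<lambda>as. c * f as) \<in> cochains"
  by (rule cochainsI) (simp_all add: cochain_add cochain_scale cochain_one distrib_left
      scale_mult_right)

lemma mult_right_cochain [cochain_intros]: "f \<in> cochains \<Longrightarrow> (\<lambda>as. f as * c) \<in> cochains"
  by (rule cochainsI) (simp_all add: cochain_add cochain_scale cochain_one distrib_right
      scale_mult_left)

lemma repr_cochain [cochain_intros]: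
  assumes "\<And>b. (\<lambda>as. X as b) \<in> cochains"
  shows "(\<lambda>as. repr (X as)) \<in> cochains"
proof (rule cochainsI)
  fix xs ys x y
  show "repr (X (xs @ (x + y) # ys)) = repr (X (xs @ x # ys)) + repr (X (xs @ y # ys))"
    by (simp add: repr_def cochain_add[OF assms] ip_add_left scale_left_distrib sum.distrib)
next
  fix xs ys x c
  show "repr (X (xs @ (c *s x) # ys)) = c *s repr (X (xs @ x # ys))"
    by (simp add: repr_def cochain_scale[OF assms] ip_scale_left scale_sum_right)
next
  fix xs ys
  show "repr (X (xs @ 1 # ys)) = 0"
    by (simp add: repr_def cochain_one[OF assms])
qed

text \<open>
  This lemma and the next two are not collected in \<open>cochain_intros\<close>: their conclusions apply an
  unknown function to a compound list and would unify with every goal.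
\<close>

lemma context_cochain:
  assumes "f \<in> cochains"
  shows "(\<lambda>as. f (p @ as @ q)) \<in> cochains"
proof (rule cochainsI)
  fix xs ys x y
  show "f (p @ (xs @ (x + y) # ys) @ q) = f (p @ (xs @ x # ys) @ q) + f (p @ (xs @ y # ys) @ q)"
    using cochain_add[OF assms, of "p @ xs" x y "ys @ q"] by simp
next
  fix xs ys x c
  show "f (p @ (xs @ (c *s x) # ys) @ q) = c *s f (p @ (xs @ x # ys) @ q)"
    using cochain_scale[OF assms, of "p @ xs" c x "ys @ q"] by simp
qed (simp add: cochain_one assms)

lemma context_cochain':
  assumes "f \<in> cochains"
  shows "(\<lambda>as. f (p @ as)) \<in> cochains" "(\<lambda>as. f (as @ q)) \<in> cochains"
    "(\<lambda>as. f (p @ b # as)) \<in> cochains" "(\<lambda>as. f (p @ b # as @ q)) \<in> cochains"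
  using context_cochain[OF assms, of p "[]"] context_cochain[OF assms, of "[]" q]
    context_cochain[OF assms, of "p @ [b]" "[]"] context_cochain[OF assms, of "p @ [b]" q] by simp_all

lemma entry_cochain:
  assumes "f \<in> cochains" "g \<in> cochains"
  shows "(\<lambda>as. f (p @ g as # q)) \<in> cochains"
  by (rule cochainsI)
    (simp_all add: assms cochain_add cochain_scale cochain_one cochain_entry_zero)

text \<open>
  An entry of the whole list is an entry of exactly one piece of each decomposition, so it is
  enough that every summand is multilinear and normalized in each piece.
\<close>

lemma split_sum_cochain [cochain_intros]:
  assumes "\<And>v. (\<lambda>u. X u v) \<in> cochains" "\<And>u. X u \<in> cochains"
  shows "split_sum X \<in> cochains"
proof (rule cochainsI)
  fix xs ys x y
  show "split_sum X (xs @ (x + y) # ys) = split_sum X (xs @ x # ys) + split_sum X (xs @ y # ys)"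
    by (simp add: split_sum_append_Cons cochain_add[OF assms(1)] cochain_add[OF assms(2)]
        split_sum_add algebra_simps)
next
  fix xs ys x c
  have "split_sum (\<lambda>u v. c *s Y u v) zs = c *s split_sum Y zs" for Y and zs :: "'a list"
    by (simp add: split_sum_def scale_sum_right)
  then show "split_sum X (xs @ (c *s x) # ys) = c *s split_sum X (xs @ x # ys)"
    by (simp add: split_sum_append_Cons cochain_scale[OF assms(1)] cochain_scale[OF assms(2)]
        scale_right_distrib)
next
  fix xs ys
  show "split_sum X (xs @ 1 # ys) = 0"
    by (simp add: split_sum_append_Cons cochain_one[OF assms(1)] cochain_one[OF assms(2)]
        split_sum_zero)
qed

lemma split_sum_param_cochain [cochain_intros]:
  assumes "\<And>u v. (\<lambda>as. X as u v) \<in> cochains"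
  shows "(\<lambda>as. split_sum (X as) s) \<in> cochains"
  using assms by (induction s arbitrary: X) (simp_all add: split_sum_Cons add_cochain)

lemma split_sum3_cochain [cochain_intros]:
  assumes "\<And>v w. (\<lambda>u. X u v w) \<in> cochains" "\<And>u w. (\<lambda>v. X u v w) \<in> cochains"
    "\<And>u v. X u v \<in> cochains"
  shows "split_sum3 X \<in> cochains"
  unfolding split_sum3_def using assms by (intro cochain_intros)

lemma differential_eq:
  "\<delta> f as = hd_case (\<lambda>a as'. a * f as') as + merge_sum f as
     + signed (length as) (last_case (\<lambda>as' a. f as' * a) as)"
  by (simp add: differential_def merge_sum_eq hd_case_def last_case_def Let_def)

lemma cocycles_cochain: "f \<in> cocycles \<Longrightarrow> f \<in> cochains"
  by (simp add: cocycles_def)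

lemma cocycle_merge_sum:
  assumes "f \<in> cocycles"
  shows "merge_sum f as = - hd_case (\<lambda>a as'. a * f as') as
     - signed (length as) (last_case (\<lambda>as' a. f as' * a) as)"
proof -
  have "\<delta> f as = 0" using assms by (simp add: cocycles_def)
  then show ?thesis
    by (simp add: differential_eq algebra_simps eq_neg_iff_add_eq_0)
qed

lemma cup_eq: "f \<smile> g = split_sum (\<lambda>u v. f u * g v)"
  by (simp add: fun_eq_iff cup_def split_sum_def)

lemma hd_case_mult: "hd_case Y u * c = hd_case (\<lambda>a u. Y a u * (c :: 'a)) u"
  by (simp add: hd_case_def)

lemma last_case_mult: "last_case Y u * c = last_case (\<lambda>u a. Y u a * (c :: 'a)) u"
  by (simp add: last_case_def)


section \<open>Insertion of one cochain into another\<close>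

text \<open>
  Gerstenhaber's operation \<open>f \<circ> g\<close> for \<open>k = 0\<close>. Shifted by one, the degree of \<open>g\<close> is \<open>|v| - 1\<close>,
  and the sign is the Koszul sign of passing \<open>u\<close> together with \<open>k\<close> further entries. The offset \<open>k\<close>
  is used when \<open>f\<close> has \<open>k\<close> fixed arguments in front of the list that is being decomposed.
\<close>

definition insertion :: "nat \<Rightarrow> 'a cochain \<Rightarrow> 'a cochain \<Rightarrow> 'a cochain" where
  "insertion k f g = split_sum3 (\<lambda>u v w. signed ((length v + 1) * (k + length u)) (f (u @ g v # w)))"

lemma insertion_cochain [cochain_intros]:
  assumes "f \<in> cochains" "g \<in> cochains"
  shows "insertion k f g \<in> cochains"
proof -
  have "(\<lambda>v. signed ((length v + 1) * (k + length u)) (f (u @ g v # w))) \<in> cochains" for u w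
    by (rule signed_cochain[where n = "\<lambda>n. (n + 1) * (k + length u)"]) (rule entry_cochain[OF assms])
  moreover have "(\<lambda>u. signed ((length v + 1) * (k + length u)) (f (u @ g v # w))) \<in> cochains" for v w
    by (rule signed_cochain[where n = "\<lambda>n. (length v + 1) * (k
        + n)"]) (rule context_cochain'[OF assms(1)])
  moreover have "(\<lambda>w. signed ((length v + 1) * (k + length u)) (f (u @ g v # w))) \<in> cochains" for u v
    by (rule signed_cochain) (rule context_cochain'[OF assms(1)])
  ultimately show ?thesis
    unfolding insertion_def by (intro split_sum3_cochain)
qed

lemma cup_cochain [cochain_intros]:
  "f \<in> cochains \<Longrightarrow> g \<in> cochains \<Longrightarrow> f \<smile> g \<in> cochains"
  unfolding cup_eq by (intro cochain_intros)

text \<open>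
  Merges inside \<open>v\<close> turn, by the cocycle condition for \<open>g\<close>, into products of \<open>g v\<close> with the
  entries next to it. These are exactly the merges of \<open>u @ g v # w\<close> in which the entry \<open>g v\<close> takes
  part, so altogether all merges of the list \<open>u @ g v # w\<close> appear.
\<close>

lemma merge_sum_insertion:
  assumes f: "f \<in> cochains" and g: "g \<in> cocycles"
  shows "merge_sum (insertion k f g) as =
    split_sum3 (\<lambda>u v w. signed ((length v + 1) * (k + length u + 1)) (merge_sum f (u @ g v # w))) as"
proof -
  let ?F = "\<lambda>u v w. f (u @ g v # w)"
  \<comment> \<open>\<open>?A\<close> and \<open>?D\<close> are the merges inside \<open>u\<close> and \<open>w\<close>, \<open>?B\<close> and \<open>?C\<close> the two products that come
    from \<open>v\<close>. In \<open>?B\<close> and \<open>?C\<close> the entry \<open>a\<close> has been taken out of \<open>v\<close>.\<close>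
  let ?A = "\<lambda>u v w. signed ((length v + 1) * (k + length u + 1)) (merge_sum (\<lambda>u. ?F u v w) u)"
  let ?D = "\<lambda>u v w. signed (length u + length v + (length v + 1) * (k + length u))
      (merge_sum (?F u v) w)"
  let ?B = "\<lambda>u a v w. signed (1 + length u + (length v + 1) * (k + length u)) (f (u @ (a * g v) # w))"
  let ?C = "\<lambda>u v a w. signed (length v + length u + (length v + 1) * (k
      + length u)) (f (u @ (g v * a) # w))"
  have A: "merge_sum (\<lambda>u. signed ((length v + 1) * (k + length u)) (?F u v w)) u = ?A u v w" for u v w
    by (subst merge_sum_signed_length[where c = "\<lambda>n. (length v + 1) * (k
        + n)"]) (cases u; auto simp: signed_def)
  have BC: "signed (length u) (merge_sum (\<lambda>v. signed ((length v + 1) * (k + length u)) (?F u v w)) v)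
      = hd_case (\<lambda>a v. ?B u a v w) v + last_case (\<lambda>v a. ?C u v a w) v" for u v w
  proof -
    have "signed (length u) (merge_sum (\<lambda>v. signed ((length v + 1) * (k + length u)) (?F u v w)) v)
      = signed (length u + length v * (k + length u)) (merge_sum (\<lambda>v. ?F u v w) v)"
      by (cases v) (simp_all add: signed_signed
          merge_sum_signed_length[where c = "\<lambda>n. (n + 1) * (k + length u)", simplified])
    also have "merge_sum (\<lambda>v. ?F u v w) v = f (u @ merge_sum g v # w)"
      using merge_sum_additive[of "\<lambda>x. f (u @ x # w)" g v] by (simp add: cochain_add f)
    also have "\<dots> = - hd_case (\<lambda>a v. f (u @ (a * g v) # w)) v
        - signed (length v) (last_case (\<lambda>v a. f (u @ (g v * a) # w)) v)"
      by (simp add: cocycle_merge_sum g cochain_entry_diff cochain_entry_minus f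
          cochain_entry_signed hd_case_additive[of "\<lambda>x. f (u @ x # w)"]
          last_case_additive[of "\<lambda>x. f (u @ x # w)"] cochain_entry_zero)
    also have "signed (length u + length v * (k + length u)) (- hd_case (\<lambda>a v. f (u @ (a * g v) # w)) v
        - signed (length v) (last_case (\<lambda>v a. f (u @ (g v * a) # w)) v))
      = hd_case (\<lambda>a v. ?B u a v w) v + last_case (\<lambda>v a. ?C u v a w) v"
    proof -
      have "- signed (length u + length v * (k + length u)) (hd_case (\<lambda>a v. f (u @ (a * g v) # w)) v)
        = hd_case (\<lambda>a v. ?B u a v w) v"
        by (cases v) (auto simp: signed_def)
      moreover have "- signed (length u + length v * (k + length u) + length v) (last_case
          (\<lambda>v a. f (u @ (g v * a) # w)) v)
        = last_case (\<lambda>v a. ?C u v a w) v"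
        by (cases v rule: rev_cases) (auto simp: signed_def)
      ultimately show ?thesis by (simp add: signed_diff signed_minus signed_signed)
    qed
    finally show ?thesis .
  qed
  have D: "signed (length u + length v) (merge_sum
      (\<lambda>w. signed ((length v + 1) * (k + length u)) (?F u v w)) w)
      = ?D u v w" for u v w
    by (subst merge_sum_signed_length[where c = "\<lambda>n. (length v + 1) * (k
        + length u)"]) (simp add: signed_signed)
  have "merge_sum (insertion k f g) as = split_sum3 (\<lambda>u v w. ?A u v w + ?D u v w) as
      + split_sum3 (\<lambda>u v w. hd_case (\<lambda>a v. ?B u a v w) v) as
      + split_sum3 (\<lambda>u v w. last_case (\<lambda>v a. ?C u v a w) v) as"
    unfolding insertion_def merge_sum_split_sum3 A BC D split_sum3_add by (simp only: add_ac)
  also have "\<dots> = split_sum3 (\<lambda>u v w. ?A u v w + ?D u v w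
      + last_case (\<lambda>u a. ?B u a v w) u + hd_case (\<lambda>a w. ?C u v a w) w) as"
    by (simp only: split_sum3_shift_left[symmetric] split_sum3_shift_right split_sum3_add)
  also have "\<dots> = split_sum3 (\<lambda>u v w. signed ((length v + 1) * (k + length u + 1))
      (merge_sum f (u @ g v # w))) as"
  proof (rule split_sum3_cong)
    fix u v w
    have "last_case (\<lambda>u a. ?B u a v w) u =
      signed ((length v + 1) * (k + length u + 1) + length u) (last_case
          (\<lambda>u a. f (u @ (a * g v) # w)) u)"
      by (cases u rule: rev_cases) (auto simp: signed_def)
    moreover have "hd_case (\<lambda>a w. ?C u v a w) w =
      - signed ((length v + 1) * (k + length u + 1) + length u) (hd_case
        (\<lambda>a w. f (u @ (g v * a) # w)) w)"
      by (cases w) (auto simp: signed_def)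
    moreover have "?D u v w = - signed ((length v + 1) * (k + length u + 1) + length u)
        (merge_sum (?F u v) w)"
      by (auto simp: signed_def)
    ultimately show "?A u v w + ?D u v w
      + last_case (\<lambda>u a. ?B u a v w) u + hd_case (\<lambda>a w. ?C u v a w) w
      = signed ((length v + 1) * (k + length u + 1)) (merge_sum f (u @ g v # w))"
      by (simp only: merge_sum_append[of f u "g v # w"] merge_sum_Cons[of _ "g v" w] hd_case_simps)
        (simp add: signed_add signed_diff signed_minus signed_signed algebra_simps)
  qed
  finally show ?thesis .
qed

lemma degree_sign_cochain [cochain_intros]: "f \<in> cochains \<Longrightarrow> degree_sign f \<in> cochains"
  using signed_cochain[of f "\<lambda>n. n"] by (simp add: degree_sign_def[abs_def])

text \<open>
  The two outer terms of \<open>\<delta> f\<close> involve the inserted value \<open>g v\<close> when \<open>u\<close> or \<open>w\<close> is empty. These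
  terms have no counterpart in \<open>\<delta> (f \<circ> g)\<close> and give the two products of \<open>f\<close> and \<open>g\<close>.
\<close>

lemma differential_insertion:
  assumes f: "f \<in> cochains" and g: "g \<in> cocycles"
  shows "\<delta> (insertion 0 f g) as =
    split_sum3 (\<lambda>u v w. signed ((length v + 1) * (length u + 1)) (\<delta> f (u @ g v # w))) as
    + split_sum (\<lambda>v w. signed (length v) (g v * f w)) as
    - split_sum (\<lambda>u v. signed (length v * (length u + 1)) (f u * g v)) as"
proof -
  let ?L = "\<lambda>a u v w. signed ((length v + 1) * length u) (a * f (u @ g v # w))"
  let ?R = "\<lambda>u v w a. signed (length u + length v + length w + 1
      + (length v + 1) * length u) (f (u @ g v # w) * a)"
  have l: "hd_case (\<lambda>a as. a * insertion 0 f g as) as =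
     split_sum3 (\<lambda>u v w. hd_case (\<lambda>a u. ?L a u v w) u) as"
  proof (cases as)
    case (Cons a xs)
    have "split_sum3 (\<lambda>u v w. hd_case (\<lambda>a u. ?L a u v w) u) (a # xs) = split_sum3 (?L a) xs"
      by (simp add: split_sum3_def split_sum_Cons split_sum_zero)
    then show ?thesis
      by (simp add: Cons insertion_def split_sum3_mult_left signed_mult_right)
  qed (simp add: split_sum3_def)
  have r: "signed (length as) (last_case (\<lambda>as a. insertion 0 f g as * a) as) =
     split_sum3 (\<lambda>u v w. last_case (\<lambda>w a. ?R u v w a) w) as"
  proof (cases as rule: rev_cases)
    case (snoc xs a)
    have "split_sum3 (\<lambda>u v w. last_case (\<lambda>w a. ?R u v w a) w) (xs @ [a])
        = split_sum3 (\<lambda>u v w. ?R u v w a) xs"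
      by (simp add: split_sum3_def split_sum_snoc)
    also have "\<dots> = split_sum3 (\<lambda>u v w. signed (Suc (length xs))
        (signed ((length v + 1) * length u) (f (u @ g v # w)) * a)) xs"
      by (rule split_sum3_cong) (auto simp: signed_def)
    finally show ?thesis
      by (simp add: snoc insertion_def split_sum3_mult_right split_sum3_minus split_sum3_signed)
  qed (simp add: split_sum3_def)
  have e: "signed ((length v + 1) * (length u + 1)) (\<delta> f (u @ g v # w)) =
      signed ((length v + 1) * (length u + 1)) (merge_sum f (u @ g v # w))
      + hd_case (\<lambda>a u. ?L a u v w) u + last_case (\<lambda>w a. ?R u v w a) w
      - (if u = [] then signed (length v) (g v * f w) else 0)
      + (if w = [] then signed (length v * (length u + 1)) (f u * g v) else 0)" for u v w
  proof -
    have 1: "signed ((length v + 1) * (length u + 1)) (hd_case (\<lambda>a xs. a * f xs) (u @ g v # w))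
      = hd_case (\<lambda>a u. ?L a u v w) u - (if u = [] then signed (length v) (g v * f w) else 0)"
      by (cases u) (auto simp: signed_def)
    have 2: "signed ((length v + 1) * (length u + 1)) (signed (length (u @ g v # w))
        (last_case (\<lambda>xs a. f xs * a) (u @ g v # w)))
      = last_case (\<lambda>w a. ?R u v w a) w
        + (if w = [] then signed (length v * (length u + 1)) (f u * g v) else 0)"
    proof (cases w rule: rev_cases)
      case Nil
      then show ?thesis by (auto simp: signed_def)
    next
      case (snoc ys a)
      have "last_case (\<lambda>xs a. f xs * a) (u @ g v # ys @ [a]) = f (u @ g v # ys) * a"
        using last_case_simps(2)[of _ "u @ g v # ys" a] by simp
      then show ?thesis unfolding snoc by (auto simp: signed_def)
    qed
    show ?thesis
      by (simp only: differential_eq[of f] signed_add 1 2) (simp add: algebra_simps)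
  qed
  have 3: "split_sum3 (\<lambda>u v w. if u = [] then signed (length v) (g v * f w) else 0) as
     = split_sum (\<lambda>v w. signed (length v) (g v * f w)) as"
    by (cases as) (simp_all add: split_sum3_def split_sum_Cons split_sum_zero)
  have 4: "split_sum3 (\<lambda>u v w. if w = [] then signed (length v * (length u + 1)) (f u * g v) else 0) as
     = split_sum (\<lambda>u v. signed (length v * (length u + 1)) (f u * g v)) as"
    unfolding split_sum3_def split_sum_last_Nil ..
  have "split_sum3 (\<lambda>u v w. signed ((length v + 1) * (length u + 1)) (\<delta> f (u @ g v # w))) as
    = merge_sum (insertion 0 f g) as
      + split_sum3 (\<lambda>u v w. hd_case (\<lambda>a u. ?L a u v w) u) as
      + split_sum3 (\<lambda>u v w. last_case (\<lambda>w a. ?R u v w a) w) as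
      - split_sum (\<lambda>v w. signed (length v) (g v * f w)) as
      + split_sum (\<lambda>u v. signed (length v * (length u + 1)) (f u * g v)) as"
    unfolding e diff_conv_add_uminus split_sum3_add split_sum3_minus 3 4
    by (simp add: merge_sum_insertion f g)
  then show ?thesis
    by (simp only: differential_eq[of "insertion 0 f g"] l r) simp
qed


section \<open>Cyclic sums and the operator of degree -1\<close>

text \<open>
  \<open>\<Phi> w b u\<close> stands for a multilinear expression in the list \<open>w @ b # u\<close> with a marked entry \<open>b\<close>.
  The sign is the Koszul sign of rotating \<open>w\<close> past \<open>u\<close>, \<open>v\<close> and \<open>b\<close>. For \<open>\<Phi> w b u = f (w @ b # u)\<close>
  this is the cochain \<open>B(f, y)\<close> of the introduction.
\<close>

definition cyclic_sum :: "('a list \<Rightarrow> 'a \<Rightarrow> 'a list \<Rightarrow> 'a) \<Rightarrow> 'a cochain \<Rightarrow> 'a cochain" where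
  "cyclic_sum \<Phi> y = split_sum3 (\<lambda>u v w.
     signed ((length u + length v + 1) * length w) (repr (\<lambda>b. \<Phi> w b u * y v)))"

text \<open>
  The Hochschild differential of \<open>\<Phi>\<close> on the list \<open>w @ b # u\<close>, except for the outer terms in which
  the value of \<open>\<Phi>\<close> would be multiplied by the marked entry \<open>b\<close>.
\<close>

definition cyclic_differential ::
    "('a list \<Rightarrow> 'a \<Rightarrow> 'a list \<Rightarrow> 'a) \<Rightarrow> 'a list \<Rightarrow> 'a \<Rightarrow> 'a list \<Rightarrow> 'a" where
  "cyclic_differential \<Phi> w b u =
     hd_case (\<lambda>a w. a * \<Phi> w b u) w
     + merge_sum (\<lambda>w. \<Phi> w b u) w
     + signed (length w) (last_case (\<lambda>w a. \<Phi> w (a * b) u) w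
         - hd_case (\<lambda>a u. \<Phi> w (b * a) u) u
         - merge_sum (\<Phi> w b) u
         - signed (length u) (last_case (\<lambda>u a. \<Phi> w b u * a) u))"

lemma cyclic_sum_cochain [cochain_intros]:
  assumes "\<And>w b. \<Phi> w b \<in> cochains" "\<And>b u. (\<lambda>w. \<Phi> w b u) \<in> cochains" "y \<in> cochains"
  shows "cyclic_sum \<Phi> y \<in> cochains"
proof -
  have "(\<lambda>u. signed ((length u + length v + 1) * length w) (repr (\<lambda>b. \<Phi> w b u * y v))) \<in> cochains"
      for v w
    by (rule signed_cochain[where n = "\<lambda>n. (n + length v + 1) * length w"])
      (intro repr_cochain mult_right_cochain assms)
  moreover have "(\<lambda>v. signed ((length u + length v + 1) * length w) (repr
      (\<lambda>b. \<Phi> w b u * y v))) \<in> cochains" for u w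
    by (rule signed_cochain[where n = "\<lambda>n. (length u + n + 1) * length w"])
      (intro repr_cochain mult_left_cochain assms)
  moreover have "(\<lambda>w. signed ((length u + length v + 1) * length w) (repr
      (\<lambda>b. \<Phi> w b u * y v))) \<in> cochains" for u v
    by (rule signed_cochain) (intro repr_cochain mult_right_cochain assms)
  ultimately show ?thesis
    unfolding cyclic_sum_def by (rule split_sum3_cochain)
qed

text \<open>
  Read the arguments cyclically as \<open>u, v, w, b\<close>. The outer terms of the differential on the left
  multiply \<open>b\<close> by the first entry of \<open>u\<close> or by the last entry of \<open>w\<close>. The merges inside \<open>v\<close> become
  products of \<open>y v\<close> with its outer entries. Moved across the cuts they multiply the value of \<open>\<Phi>\<close>
  by the last entry of \<open>u\<close> or the first entry of \<open>w\<close>, since all values are multiplied in the end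
  and the product is commutative.
\<close>

lemma differential_cyclic_sum:
  assumes lin: "\<And>w u c. linear_endo (\<lambda>b. \<Phi> w b u * c)" and y: "y \<in> cocycles"
  shows "\<delta> (cyclic_sum \<Phi> y) as = - cyclic_sum (cyclic_differential \<Phi>) y as"
proof -
  let ?e = "\<lambda>u v w. (length u + length v + 1) * length w"
  let ?R = "\<lambda>u v w. repr (\<lambda>b. \<Phi> w b u * y v)"
  \<comment> \<open>\<open>?L1\<close> and \<open>?L2\<close> are the outer terms, \<open>?M1\<close> and \<open>?M3\<close> the merges inside \<open>u\<close> and \<open>w\<close>, and \<open>?B\<close> and
    \<open>?C\<close> the products that come from \<open>v\<close>. The entry \<open>a\<close> has been taken out of its piece, which
    changes the lengths in the exponents.\<close>
  let ?L1 = "\<lambda>a u v w. signed (?e u v w) (repr (\<lambda>b. \<Phi> w (b * a) u * y v))"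
  let ?L2 = "\<lambda>u v w a. signed (length u + length v + length w + 1 + ?e u v w) (repr
      (\<lambda>b. \<Phi> w (a * b) u * y v))"
  let ?M1 = "\<lambda>u v w. signed (length w + ?e u v w) (repr (\<lambda>b. merge_sum (\<Phi> w b) u * y v))"
  let ?M3 = "\<lambda>u v w. - signed (?e u v w) (repr (\<lambda>b. merge_sum (\<lambda>w. \<Phi> w b u) w * y v))"
  let ?B = "\<lambda>u a v w. - signed (length u + ?e u v w) (repr (\<lambda>b. \<Phi> w b u * a * y v))"
  let ?C = "\<lambda>u v a w. signed (length u + length v + ?e u v w) (repr (\<lambda>b. a * \<Phi> w b u * y v))"
  have rm: "repr (\<lambda>b. \<Phi> w (a * b) u * c) = a * repr (\<lambda>b. \<Phi> w b u * c)" for w a u c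
    by (rule repr_mult[OF lin])
  have rm': "repr (\<lambda>b. \<Phi> w (b * a) u * c) = a * repr (\<lambda>b. \<Phi> w b u * c)" for w a u c
    using rm[of w a u c] by (simp only: mult.commute[of _ a])
  have l: "hd_case (\<lambda>a as. a * cyclic_sum \<Phi> y as) as
      = split_sum3 (\<lambda>u v w. hd_case (\<lambda>a u. ?L1 a u v w) u) as"
    unfolding split_sum3_hd cyclic_sum_def rm'
      split_sum3_mult_left signed_mult_right ..
  have r: "signed (length as) (last_case (\<lambda>as a. cyclic_sum \<Phi> y as * a) as)
    = split_sum3 (\<lambda>u v w. last_case (\<lambda>w a. ?L2 u v w a) w) as"
  proof -
    have "signed (Suc (length xs)) (cyclic_sum \<Phi> y xs * a) = split_sum3 (\<lambda>u v w. ?L2 u v w a) xs"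
        for xs a
      unfolding cyclic_sum_def split_sum3_mult_right split_sum3_signed rm
      by (rule split_sum3_cong) (auto simp: signed_def mult.commute)
    then show ?thesis
      unfolding split_sum3_last by (cases as rule: rev_cases) simp_all
  qed
  have M1: "merge_sum (\<lambda>u. signed (?e u v w) (?R u v w)) u = ?M1 u v w" for u v w
    by (subst merge_sum_signed_length[where c = "\<lambda>n. (n + length v + 1) * length w"],
        subst merge_sum_repr, subst merge_sum_additive[of "\<lambda>x. x * y v"])
      (cases u; auto simp: distrib_right signed_def repr_zero)+
  have M2: "signed (length u) (merge_sum (\<lambda>v. signed (?e u v w) (?R u v w)) v)
      = hd_case (\<lambda>a v. ?B u a v w) v + last_case (\<lambda>v a. ?C u v a w) v" for u v w
  proof -
    have "signed (length u) (merge_sum (\<lambda>v. signed (?e u v w) (?R u v w)) v)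
      = signed (length u + length w + ?e u v w) (repr (\<lambda>b. \<Phi> w b u * merge_sum y v))"
      by (subst merge_sum_signed_length[where c = "\<lambda>n. (length u + n + 1) * length w"],
          subst merge_sum_repr, subst merge_sum_additive[of "\<lambda>x. _ * x"])
        (cases v; auto simp: distrib_left signed_def repr_zero)+
    also have "repr (\<lambda>b. \<Phi> w b u * merge_sum y v)
      = - hd_case (\<lambda>a v. repr (\<lambda>b. \<Phi> w b u * a * y v)) v
        - signed (length v) (last_case (\<lambda>v a. repr (\<lambda>b. a * \<Phi> w b u * y v)) v)"
      unfolding cocycle_merge_sum[OF y] diff_conv_add_uminus distrib_left mult_minus_right
          signed_mult_right
        repr_add repr_minus repr_signed hd_case_additive[of "\<lambda>x. \<Phi> w _ u * x", OF mult_zero_right]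
        last_case_additive[of "\<lambda>x. \<Phi> w _ u * x", OF mult_zero_right] repr_hd_case repr_last_case
      by (simp add: mult_ac)
    also have "signed (length u + length w + ?e u v w)
        (- hd_case (\<lambda>a v. repr (\<lambda>b. \<Phi> w b u * a * y v)) v
        - signed (length v) (last_case (\<lambda>v a. repr (\<lambda>b. a * \<Phi> w b u * y v)) v))
      = hd_case (\<lambda>a v. ?B u a v w) v + last_case (\<lambda>v a. ?C u v a w) v"
    proof -
      have "- signed (length u + length w + ?e u v w) (hd_case (\<lambda>a v. repr (\<lambda>b. \<Phi> w b u * a * y v)) v)
        = hd_case (\<lambda>a v. ?B u a v w) v"
        by (cases v) (auto simp: signed_def)
      moreover have "- signed (length u + length w + ?e u v w + length v)
          (last_case (\<lambda>v a. repr (\<lambda>b. a * \<Phi> w b u * y v)) v) = last_case (\<lambda>v a. ?C u v a w) v"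
        by (cases v rule: rev_cases) (auto simp: signed_def)
      ultimately show ?thesis by (simp add: signed_diff signed_minus signed_signed)
    qed
    finally show ?thesis .
  qed
  have M3: "signed (length u + length v) (merge_sum (\<lambda>w. signed (?e u v w) (?R u v w)) w) = ?M3 u v w"
      for u v w
    by (subst merge_sum_signed_length[where c = "\<lambda>n. (length u + length v + 1) * n"],
        subst merge_sum_repr, subst merge_sum_additive[of "\<lambda>x. x * y v"])
      (cases w; auto simp: distrib_right signed_def repr_zero)+
  have "merge_sum (cyclic_sum \<Phi> y) as = split_sum3 (\<lambda>u v w. ?M1 u v w + ?M3 u v w) as
      + split_sum3 (\<lambda>u v w. hd_case (\<lambda>a v. ?B u a v w) v) as
      + split_sum3 (\<lambda>u v w. last_case (\<lambda>v a. ?C u v a w) v) as"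
    unfolding cyclic_sum_def merge_sum_split_sum3 M1 M2 M3 split_sum3_add by (simp only: add_ac)
  also have "\<dots> = split_sum3 (\<lambda>u v w. ?M1 u v w + ?M3 u v w
      + last_case (\<lambda>u a. ?B u a v w) u + hd_case (\<lambda>a w. ?C u v a w) w) as"
    by (simp only: split_sum3_shift_left[symmetric] split_sum3_shift_right split_sum3_add)
  finally have "\<delta> (cyclic_sum \<Phi> y) as = split_sum3 (\<lambda>u v w. hd_case (\<lambda>a u. ?L1 a u v w) u
      + (?M1 u v w + ?M3 u v w + last_case (\<lambda>u a. ?B u a v w) u + hd_case (\<lambda>a w. ?C u v a w) w)
      + last_case (\<lambda>w a. ?L2 u v w a) w) as"
    by (simp only: differential_eq[of "cyclic_sum \<Phi> y"] l r split_sum3_add)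
  also have "\<dots> = split_sum3 (\<lambda>u v w. - signed (?e u v w) (repr
      (\<lambda>b. cyclic_differential \<Phi> w b u * y v))) as"
  proof (rule split_sum3_cong)
    fix u v w
    have 1: "hd_case (\<lambda>a u. ?L1 a u v w) u =
      signed (length w + ?e u v w) (hd_case (\<lambda>a u. repr (\<lambda>b. \<Phi> w (b * a) u * y v)) u)"
      by (cases u) (auto simp: signed_def)
    have 2: "last_case (\<lambda>w a. ?L2 u v w a) w =
      - signed (length w + ?e u v w) (last_case (\<lambda>w a. repr (\<lambda>b. \<Phi> w (a * b) u * y v)) w)"
      by (cases w rule: rev_cases) (auto simp: signed_def)
    have 3: "last_case (\<lambda>u a. ?B u a v w) u =
      signed (length w + length u + ?e u v w) (last_case (\<lambda>u a. repr (\<lambda>b. \<Phi> w b u * a * y v)) u)"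
      by (cases u rule: rev_cases) (auto simp: signed_def)
    have 4: "hd_case (\<lambda>a w. ?C u v a w) w =
      - signed (?e u v w) (hd_case (\<lambda>a w. repr (\<lambda>b. a * \<Phi> w b u * y v)) w)"
      by (cases w) (auto simp: signed_def)
    have 5: "repr (\<lambda>b. cyclic_differential \<Phi> w b u * y v) =
      hd_case (\<lambda>a w. repr (\<lambda>b. a * \<Phi> w b u * y v)) w
      + repr (\<lambda>b. merge_sum (\<lambda>w. \<Phi> w b u) w * y v)
      + signed (length w) (last_case (\<lambda>w a. repr (\<lambda>b. \<Phi> w (a * b) u * y v)) w
         - hd_case (\<lambda>a u. repr (\<lambda>b. \<Phi> w (b * a) u * y v)) u
         - repr (\<lambda>b. merge_sum (\<Phi> w b) u * y v)
         - signed (length u) (last_case (\<lambda>u a. repr (\<lambda>b. \<Phi> w b u * a * y v)) u))"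
      unfolding cyclic_differential_def diff_conv_add_uminus distrib_right mult_minus_left
          signed_mult_left
        repr_add repr_minus repr_signed hd_case_mult last_case_mult repr_hd_case repr_last_case ..
    show "hd_case (\<lambda>a u. ?L1 a u v w) u
      + (?M1 u v w + ?M3 u v w + last_case (\<lambda>u a. ?B u a v w) u + hd_case (\<lambda>a w. ?C u v a w) w)
      + last_case (\<lambda>w a. ?L2 u v w a) w
      = - signed (?e u v w) (repr (\<lambda>b. cyclic_differential \<Phi> w b u * y v))"
      unfolding 1 2 3 4 5
      by (simp add: signed_add signed_diff signed_minus signed_signed add_ac)
  qed
  finally show ?thesis
    by (simp add: cyclic_sum_def split_sum3_minus)
qed


definition marked :: "'a cochain \<Rightarrow> 'a list \<Rightarrow> 'a \<Rightarrow> 'a list \<Rightarrow> 'a" where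
  "marked f w b u = f (w @ b # u)"

definition degree_zero :: "'a \<Rightarrow> 'a cochain" where
  "degree_zero c as = (if as = [] then c else 0)"

lemma degree_zero_cochain [cochain_intros]: "degree_zero c \<in> cochains"
  by (rule cochainsI) (simp_all add: degree_zero_def)

text \<open>
  In degree 1 the differential is \<open>a * c - c * a\<close>, so commutativity is used here.
\<close>

lemma degree_zero_cocycle: "degree_zero c \<in> cocycles"
proof -
  have "\<delta> (degree_zero c) as = 0" for as
    by (cases as rule: remdups_adj.cases)
      (simp_all add: differential_eq degree_zero_def last_case_def mult.commute merge_sum_zero)
  then show ?thesis
    by (simp add: cocycles_def degree_zero_cochain fun_eq_iff)
qed

text \<open>
  The two correction terms are the outer terms of \<open>\<delta> f\<close> that multiply by \<open>b\<close>.
\<close>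

lemma cyclic_differential_marked:
  "cyclic_differential (marked f) w b u =
     \<delta> f (w @ b # u) - (if w = [] then b * f u else 0)
     + signed (length w) (if u = [] then f w * b else 0)"
proof -
  have 1: "hd_case (\<lambda>a xs. a * f xs) (w @ b # u) =
      hd_case (\<lambda>a w. a * f (w @ b # u)) w + (if w = [] then b * f u else 0)"
    by (cases w) simp_all
  have 2: "signed (length (w @ b # u)) (last_case (\<lambda>xs a. f xs * a) (w @ b # u)) =
      - signed (length w + length u) (last_case (\<lambda>u a. f (w @ b # u) * a) u)
      - signed (length w) (if u = [] then f w * b else 0)"
  proof (cases u rule: rev_cases)
    case (snoc ys a)
    have "last_case (\<lambda>xs a. f xs * a) (w @ b # ys @ [a]) = f (w @ b # ys) * a"
      using last_case_simps(2)[of _ "w @ b # ys" a] by simp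
    then show ?thesis unfolding snoc by (auto simp: signed_def)
  qed simp
  show ?thesis
    unfolding differential_eq[of f] 1 2 merge_sum_append[of f w "b # u"] merge_sum_Cons[of _ b u]
      cyclic_differential_def marked_def hd_case_simps
    by (simp add: signed_add signed_diff signed_minus signed_signed algebra_simps)
qed

lemma linear_endo_marked: "f \<in> cochains \<Longrightarrow> linear_endo (\<lambda>b. marked f w b u * c)"
  unfolding marked_def by (rule linear_endo_cochain)

lemma marked_cochain [cochain_intros]:
  assumes "f \<in> cochains"
  shows "marked f w b \<in> cochains" "(\<lambda>w. marked f w b u) \<in> cochains"
  using context_cochain'(1)[OF assms, of "w @ [b]"] context_cochain'(2)[OF assms, of "b # u"]
  by (simp_all add: marked_def[abs_def])

text \<open>
  Only the decompositions with \<open>v = []\<close> contribute, because the unit cochain lives in degree 0.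
\<close>

lemma cyclic_sum_degree_zero_1:
  "cyclic_sum (marked f) (degree_zero 1) as =
     split_sum (\<lambda>u w. signed ((length u + 1) * length w) (repr (\<lambda>b. f (w @ b # u)))) as"
proof -
  have "cyclic_sum (marked f) (degree_zero 1) as = split_sum (\<lambda>u. split_sum (\<lambda>v w. if v = [] then
      signed ((length u + 1) * length w) (repr (\<lambda>b. f (w @ b # u))) else 0)) as"
    unfolding cyclic_sum_def split_sum3_def
    by (intro split_sum_cong) (simp add: marked_def degree_zero_def repr_zero)
  then show ?thesis by (simp only: split_sum_first_Nil)
qed

text \<open>
  The rotation by \<open>j - 1\<close> of \<open>as @ [a]\<close> is \<open>w @ a # u\<close>, where \<open>u\<close> has length \<open>j - 1\<close> and
  \<open>as = u @ w\<close>. The exponents \<open>j |as|\<close> and \<open>(|u| + 1) |w|\<close> have the same parity.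
\<close>

lemma Delta_value:
  assumes f: "f \<in> cochains"
  shows "is_Delta_value f as c \<longleftrightarrow> c = cyclic_sum (marked f) (degree_zero 1) as"
proof -
  have lin: "linear_endo (\<lambda>b. f (w @ b # u))" for w u
    using linear_endo_cochain[OF f, of w u 1] by simp
  have "\<langle>cyclic_sum (marked f) (degree_zero 1) as, a\<rangle> =
     (let n = length as + 1 in
       \<Sum>j = 1..n. signed (j * (n - 1)) \<langle>f (rotate (j - 1) (as @ [a])), 1\<rangle>)" for a
  proof -
    have "(let n = length as + 1 in
       \<Sum>j = 1..n. signed (j * (n - 1)) \<langle>f (rotate (j - 1) (as @ [a])), 1\<rangle>)
      = (\<Sum>p\<le>length as. signed (Suc p * length as) \<langle>f (rotate p (as @ [a])), 1\<rangle>)"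
      unfolding Let_def by (rule sum.reindex_bij_witness[of _ Suc "\<lambda>j. j - 1"]) auto
    also have "\<dots> = (\<Sum>p\<le>length as. signed ((length (take p as) + 1) * length (drop p as))
        \<langle>f (drop p as @ a # take p as), 1\<rangle>)"
    proof (rule sum.cong)
      fix p assume "p \<in> {..length as}"
      then have p: "p \<le> length as" by simp
      have "rotate p (as @ [a]) = drop p as @ a # take p as"
        using p by (cases "p = length as + 1") (simp_all add: rotate_drop_take)
      moreover have "even (Suc p * length as) = even ((p + 1) * (length as - p))"
        using p by auto
      ultimately show "signed (Suc p * length as) \<langle>f (rotate p (as @ [a])), 1\<rangle> =
         signed ((length (take p as) + 1) * length (drop p as)) \<langle>f (drop p as @ a # take p as), 1\<rangle>"
        using p by (auto simp: signed_def)
    qed simp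
    finally show ?thesis
      by (simp only: cyclic_sum_degree_zero_1 split_sum_def ip_sum ip_signed ip_repr[OF lin])
  qed
  then show ?thesis
    unfolding is_Delta_value_def by (metis ip_eqI)
qed

lemma Delta_eq:
  assumes "f \<in> cochains"
  shows "Delta f = cyclic_sum (marked f) (degree_zero 1)"
  by (simp add: fun_eq_iff Delta_def Delta_value[OF assms])


section \<open>The homotopy behind the Batalin-Vilkovisky relation\<close>

text \<open>
  \<open>insertion (length w) (marked f w b) g\<close> inserts the value of \<open>g\<close> into \<open>f (w @ b # u)\<close> behind
  \<open>b\<close>. On the list \<open>u1 @ g v # u2\<close> the differential of \<open>marked f\<close> has two terms more than
  required: \<open>b\<close> absorbs \<open>g v\<close> if \<open>u1\<close> is empty, and \<open>g v\<close> leaves \<open>f\<close> if \<open>u2\<close> is empty. The last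
  two sums compensate for them.
\<close>

lemma cyclic_differential_insertion:
  assumes f: "f \<in> cochains" and g: "g \<in> cocycles"
  shows "cyclic_differential (\<lambda>w b. insertion (length w) (marked f w b) g) w b u =
    split_sum3 (\<lambda>u1 v u2. signed ((length v + 1) * (length w + length u1 + 1))
       (cyclic_differential (marked f) w b (u1 @ g v # u2))) u
    + split_sum (\<lambda>v u2. signed (length v * length w + length v + 1) (f (w @ (b * g v) # u2))) u
    - split_sum (\<lambda>u1 v. signed (length v * (length w + length u1)
      + length v + 1) (f (w @ b # u1) * g v)) u"
proof -
  let ?P = "\<lambda>v u2. signed (length v * length w + length v + 1) (f (w @ (b * g v) # u2))"
  let ?Q = "\<lambda>u1 v. signed (length v * (length w + length u1) + length v + 1) (f (w @ b # u1) * g v)"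
  let ?\<Phi> = "\<lambda>w b. insertion (length w) (marked f w b) g"
  let ?s = "\<lambda>u1 v. (length v + 1) * (length w + length u1 + 1)"
  let ?M = "\<lambda>w b u1 v u2. f (w @ b # u1 @ g v # u2)"
  \<comment> \<open>The facts \<open>a\<close> to \<open>e\<close> and \<open>h\<close> treat the six terms of \<open>cyclic_differential ?\<Phi>\<close>; \<open>X\<close> expands the
    same terms for \<open>marked f\<close> at the list that contains the inserted value.\<close>
  have a: "hd_case (\<lambda>a w. a * ?\<Phi> w b u) w = split_sum3 (\<lambda>u1 v u2. signed (?s u1 v)
      (hd_case (\<lambda>a w. a * ?M w b u1 v u2) w)) u"
  proof (cases w)
    case (Cons a ys)
    show ?thesis
      unfolding Cons hd_case_simps insertion_def split_sum3_mult_left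
      by (rule split_sum3_cong) (auto simp: marked_def signed_def)
  qed (simp add: split_sum3_zero)
  have b: "merge_sum (\<lambda>w. ?\<Phi> w b u) w = split_sum3 (\<lambda>u1 v u2. signed (?s u1 v)
      (merge_sum (\<lambda>w. ?M w b u1 v u2) w)) u"
  proof -
    have "merge_sum (\<lambda>w. ?\<Phi> w b u) w = split_sum3 (\<lambda>u1 v u2.
      merge_sum (\<lambda>w. signed ((length v + 1) * (length w + length u1)) (?M w b u1 v u2)) w) u"
      by (simp only: insertion_def split_sum3_def merge_sum_of_split_sum marked_def)
    moreover have "merge_sum (\<lambda>w. signed ((length v + 1) * (length w + length u1)) (?M w b u1 v u2)) w
      = signed (?s u1 v) (merge_sum (\<lambda>w. ?M w b u1 v u2) w)" for u1 v u2
      by (subst merge_sum_signed_length[where c = "\<lambda>n. (length v + 1) * (n + length u1)"])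
        (cases w; auto simp: signed_def)
    ultimately show ?thesis by (simp only:)
  qed
  have c: "last_case (\<lambda>w a. ?\<Phi> w (a * b) u) w = split_sum3 (\<lambda>u1 v u2. signed (?s u1 v)
      (last_case (\<lambda>w a. ?M w (a * b) u1 v u2) w)) u"
  proof (cases w rule: rev_cases)
    case (snoc ys a)
    show ?thesis
      unfolding snoc last_case_simps insertion_def
      by (rule split_sum3_cong) (auto simp: marked_def signed_def)
  qed (simp add: split_sum3_zero)
  have d: "hd_case (\<lambda>a u. ?\<Phi> w (b * a) u) u = split_sum3 (\<lambda>u1 v u2. signed (?s u1 v)
      (hd_case (\<lambda>a u1. ?M w (b * a) u1 v u2) u1)) u"
  proof -
    have "hd_case (\<lambda>a u. ?\<Phi> w (b * a) u) u = split_sum3 (\<lambda>u1 v u2. 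
      (hd_case (\<lambda>a u1. signed ((length v + 1) * (length w + length u1)) (?M w (b * a) u1 v u2)) u1)) u"
      unfolding split_sum3_hd by (simp add: insertion_def marked_def)
    moreover have "hd_case (\<lambda>a u1. signed ((length v + 1) * (length w
        + length u1)) (?M w (b * a) u1 v u2)) u1
      = signed (?s u1 v) (hd_case (\<lambda>a u1. ?M w (b * a) u1 v u2) u1)" for u1 v u2
      by (cases u1) (auto simp: signed_def)
    ultimately show ?thesis by (simp only:)
  qed
  have e: "merge_sum (?\<Phi> w b) u = split_sum3 (\<lambda>u1 v u2. signed (?s u1 v)
      (merge_sum (marked f w b) (u1 @ g v # u2))) u"
    by (rule merge_sum_insertion[OF marked_cochain(1)[OF f] g])
  have h: "signed (length u) (last_case (\<lambda>u a. ?\<Phi> w b u * a) u) =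
    - split_sum3 (\<lambda>u1 v u2. signed (?s u1 v) (signed (length u1 + length u2)
      (last_case (\<lambda>u2 a. ?M w b u1 v u2 * a) u2))) u"
  proof -
    have "last_case (\<lambda>u a. ?\<Phi> w b u * a) u = split_sum3 (\<lambda>u1 v u2. 
      (last_case (\<lambda>u2 a. signed ((length v + 1) * (length w + length u1)) (?M w b u1 v u2 * a)) u2)) u"
      unfolding split_sum3_last by (simp add: insertion_def marked_def split_sum3_mult_right
          signed_mult_left)
    then have "signed (length u) (last_case (\<lambda>u a. ?\<Phi> w b u * a) u) = split_sum3 (\<lambda>u1 v u2. 
      signed (length u) (last_case (\<lambda>u2 a. signed ((length v + 1) * (length w
          + length u1)) (?M w b u1 v u2 * a)) u2)) u"
      by (simp only: split_sum3_signed)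
    also have "\<dots> = split_sum3 (\<lambda>u1 v u2. - signed (?s u1 v) (signed (length u1 + length u2)
      (last_case (\<lambda>u2 a. ?M w b u1 v u2 * a) u2))) u"
    proof (rule split_sum3_cong)
      fix u1 v u2 assume "u1 @ v @ u2 = u"
      then have "length u = length u1 + length v + length u2" by auto
      then show "signed (length u) (last_case (\<lambda>u2 a. signed ((length v + 1) * (length w
          + length u1)) (?M w b u1 v u2 * a)) u2)
        = - signed (?s u1 v) (signed (length u1 + length u2) (last_case
          (\<lambda>u2 a. ?M w b u1 v u2 * a) u2))"
        by (cases u2 rule: rev_cases) (auto simp: signed_def)
    qed
    finally show ?thesis by (simp add: split_sum3_minus)
  qed
  have X: "signed (?s u1 v) (cyclic_differential (marked f) w b (u1 @ g v # u2)) =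
      signed (?s u1 v) (hd_case (\<lambda>a w. a * ?M w b u1 v u2) w)
      + signed (?s u1 v) (merge_sum (\<lambda>w. ?M w b u1 v u2) w)
      + signed (length w) (signed (?s u1 v) (last_case (\<lambda>w a. ?M w (a * b) u1 v u2) w))
      - signed (length w) (signed (?s u1 v) (hd_case (\<lambda>a u1. ?M w (b * a) u1 v u2) u1))
      - signed (length w) (signed (?s u1 v) (merge_sum (marked f w b) (u1 @ g v # u2)))
      + signed (length w) (signed (?s u1 v) (signed (length u1 + length u2)
          (last_case (\<lambda>u2 a. ?M w b u1 v u2 * a) u2)))
      - (if u1 = [] then ?P v u2 else 0)
      + (if u2 = [] then ?Q u1 v else 0)"
    for u1 v u2
  proof -
    have 1: "hd_case (\<lambda>a u. f (w @ (b * a) # u)) (u1 @ g v # u2) =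
        hd_case (\<lambda>a u1. ?M w (b * a) u1 v u2) u1 + (if u1 = [] then f (w @ (b * g v) # u2) else 0)"
      by (cases u1) simp_all
    have 2: "last_case (\<lambda>u a. f (w @ b # u) * a) (u1 @ g v # u2) =
        last_case (\<lambda>u2 a. ?M w b u1 v u2 * a) u2 + (if u2 = [] then f (w @ b # u1) * g v else 0)"
    proof (cases u2 rule: rev_cases)
      case (snoc ys a)
      have "last_case (\<lambda>u a. f (w @ b # u) * a) (u1 @ g v # ys @ [a]) = ?M w b u1 v ys * a"
        using last_case_simps(2)[of "\<lambda>u a. f (w @ b # u) * a" "u1 @ g v # ys" a] by simp
      then show ?thesis unfolding snoc by simp
    qed simp
    have 3: "signed (?s u1 v) (signed (length w) (if u1 = [] then f (w @ (b * g v) # u2) else 0)) =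
       (if u1 = [] then ?P v u2 else 0)"
      by (auto simp: signed_def)
    have 4: "signed (?s u1 v) (signed (length w) (signed (length (u1 @ g v # u2))
        (if u2 = [] then f (w @ b # u1) * g v else 0))) =
       - (if u2 = [] then ?Q u1 v else 0)"
      by (auto simp: signed_def)
    show ?thesis
      unfolding cyclic_differential_def marked_def 1 2 signed_add signed_diff 3 4
      by (simp add: signed_minus signed_signed add_ac)
  qed
  have Z: "split_sum3 (\<lambda>u1 v u2. if u1 = [] then ?P v u2 else 0) u
      = split_sum (\<lambda>v u2. ?P v u2) u"
    by (cases u) (simp_all add: split_sum3_def split_sum_Cons split_sum_zero)
  have Z': "split_sum3 (\<lambda>u1 v u2. if u2 = [] then ?Q u1 v else 0) u
     = split_sum (\<lambda>u1 v. ?Q u1 v) u"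
    unfolding split_sum3_def split_sum_last_Nil ..
  show ?thesis
    unfolding cyclic_differential_def[of ?\<Phi>] a b c d e h
    unfolding X diff_conv_add_uminus split_sum3_add split_sum3_minus Z Z' split_sum3_signed[symmetric]
    by (simp add: signed_add signed_diff signed_minus add_ac)
qed

text \<open>
  Parity of the degree. A weaker notion than homogeneity is convenient because every cochain is
  the sum of an even and an odd one, while it may have infinitely many homogeneous components.
\<close>

definition parity :: "nat \<Rightarrow> 'a cochain \<Rightarrow> bool" where
  "parity p f \<longleftrightarrow> (\<forall>as. odd (length as + p) \<longrightarrow> f as = 0)"

lemma parityD: "parity p f \<Longrightarrow> odd (length as + p) \<Longrightarrow> f as = 0"
  by (simp add: parity_def)

text \<open>
  As \<open>f\<close> is a cocycle, its contribution to \<open>cyclic_differential\<close> reduces to the term in which the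
  marked entry \<open>b\<close> leaves \<open>f\<close> at the beginning (\<open>T1\<close>). The other two terms are those in which \<open>b\<close>
  absorbs the value of \<open>g\<close> (\<open>T2\<close>) and in which this value leaves \<open>f\<close> at the end (\<open>T3\<close>).
\<close>

lemma differential_cyclic_sum_insertion:
  assumes f: "f \<in> cocycles" "parity p f" and g: "g \<in> cocycles" "parity q g" and h: "h \<in> cocycles"
  shows "\<delta> (cyclic_sum (\<lambda>w b. insertion (length w) (marked f w b) g) h) as =
     signed q ((g \<smile> cyclic_sum (marked f) h) as) - signed q ((insertion 0 f g \<smile> h) as)
     - signed (p * q) (cyclic_sum (marked f) (g \<smile> h) as)"
proof -
  note fc = cocycles_cochain[OF f(1)] and gc = cocycles_cochain[OF g(1)]
  let ?\<Phi> = "\<lambda>w b. insertion (length w) (marked f w b) g"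
  have lin: "linear_endo (\<lambda>b. ?\<Phi> w b u * c)" for w u c
  proof -
    have "split_sum3 (\<lambda>u v w. c *s Y u v w) zs = c *s split_sum3 Y zs" for c Y and zs :: "'a list"
      by (simp add: split_sum3_def split_sum_def scale_sum_right)
    moreover have "signed n (c *s x) = c *s signed n x" for n c x
      by (simp add: signed_def)
    ultimately show ?thesis
      by (simp only: linear_endo_def insertion_def marked_def cochain_add[OF fc] cochain_scale[OF fc]
          signed_add split_sum3_add distrib_right scale_mult_left simp_thms)
  qed
  have D: "cyclic_differential ?\<Phi> w b u =
     (if w = [] then b * signed q (insertion 0 f g u) else 0)
     + split_sum (\<lambda>v u2. signed (length v * length w + length v + 1) (f (w @ (b * g v) # u2))) u
     - split_sum (\<lambda>u1 v. signed (length v * (length w + length u1)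
       + length v + 1) (f (w @ b # u1) * g v)) u"
    for w b u
  proof -
    have "split_sum3 (\<lambda>u1 v u2. signed ((length v + 1) * (length w + length u1 + 1))
       (cyclic_differential (marked f) w b (u1 @ g v # u2))) u =
      split_sum3 (\<lambda>u1 v u2. if w = [] then b * signed q
          (signed ((length v + 1) * (0 + length u1)) (f (u1 @ g v # u2))) else 0) u"
    proof (rule split_sum3_cong)
      fix u1 v u2
      have "cyclic_differential (marked f) w b (u1 @ g v # u2)
          = - (if w = [] then b * f (u1 @ g v # u2) else 0)"
        using f(1) by (simp add: cyclic_differential_marked cocycles_def)
      moreover have "even (length v + q) \<or> f (u1 @ g v # u2) = 0"
        using g(2) cochain_entry_zero[OF fc] by (auto simp: parity_def)
      ultimately show "signed ((length v + 1) * (length w + length u1 + 1))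
         (cyclic_differential (marked f) w b (u1 @ g v # u2)) =
         (if w = [] then b * signed q (signed ((length v + 1) * (0
             + length u1)) (f (u1 @ g v # u2))) else 0)"
        by (auto simp: signed_def)
    qed
    also have "\<dots> = (if w = [] then b * signed q (insertion 0 f g u) else 0)"
      by (simp only: insertion_def split_sum3_signed split_sum3_mult_left split_sum3_zero if_cancel
          split: if_split) (simp add: split_sum3_zero)
    finally show ?thesis
      by (simp only: cyclic_differential_insertion[OF fc g(1)])
  qed
  let ?T1 = "\<lambda>w b u. if w = [] then b * signed q (insertion 0 f g u) else 0"
  let ?T2 = "\<lambda>w b u. split_sum (\<lambda>v u2. signed (length v * length w
      + length v + 1) (f (w @ (b * g v) # u2))) u"
  let ?T3 = "\<lambda>w b u. split_sum (\<lambda>u1 v. signed (length v * (length w + length u1)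
      + length v + 1) (f (w @ b # u1) * g v)) u"
  let ?R2 = "\<lambda>w u x. repr (\<lambda>b. f (w @ b # u) * h x)"
  let ?R3 = "\<lambda>w u v x. repr (\<lambda>b. f (w @ b # u) * (g v * h x))"
  have split: "cyclic_sum (cyclic_differential ?\<Phi>) h as =
    cyclic_sum ?T1 h as + cyclic_sum ?T2 h as - cyclic_sum ?T3 h as"
    unfolding cyclic_sum_def D diff_conv_add_uminus distrib_right mult_minus_left repr_add repr_minus
      signed_add signed_minus split_sum3_add split_sum3_minus ..
  have T1: "cyclic_sum ?T1 h as = signed q ((insertion 0 f g \<smile> h) as)"
  proof -
    have "cyclic_sum ?T1 h as = split_sum3 (\<lambda>u v w.
        if w = [] then signed q (insertion 0 f g u * h v) else 0) as"
      unfolding cyclic_sum_def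
      by (rule split_sum3_cong) (simp add: repr_zero repr_mult_const mult.assoc signed_mult_left)
    then show ?thesis by (simp only: split_sum3_last_Nil cup_eq split_sum_signed)
  qed
  have T2: "cyclic_sum ?T2 h as = - signed q ((g \<smile> cyclic_sum (marked f) h) as)"
  proof -
    have "cyclic_sum ?T2 h as = split_sum3 (\<lambda>u x w. split_sum (\<lambda>v u2.
      - signed q (g v * signed ((length u2 + length x + 1) * length w) (?R2 w u2 x))) u) as"
      unfolding cyclic_sum_def
    proof (rule split_sum3_cong)
      fix u x w
      have "repr (\<lambda>b. ?T2 w b u * h x) = split_sum (\<lambda>v u2. signed (length v * length w + length v + 1)
          (g v * ?R2 w u2 x)) u"
        unfolding split_sum_mult_right repr_split_sum signed_mult_left repr_signed
      proof (rule split_sum_cong)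
        fix v u2
        have "repr (\<lambda>b. f (w @ (b * g v) # u2) * h x) = g v * ?R2 w u2 x"
          using repr_mult[OF linear_endo_cochain[OF fc], of w "g v" u2 "h x"]
          by (simp only: mult.commute[of _ "g v"])
        then show "signed (length v * length w + length v + 1) (repr
            (\<lambda>b. f (w @ (b * g v) # u2) * h x)) =
          signed (length v * length w + length v + 1) (g v * ?R2 w u2 x)" by simp
      qed
      then have "signed ((length u + length x + 1) * length w) (repr (\<lambda>b. ?T2 w b u * h x)) =
        split_sum (\<lambda>v u2. signed ((length u + length x + 1) * length w)
          (signed (length v * length w + length v + 1) (g v * ?R2 w u2 x))) u"
        by (simp only: split_sum_signed)
      also have "\<dots> = split_sum (\<lambda>v u2. - signed q (g v * signed ((length u2 + length x + 1) * length w)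
          (?R2 w u2 x))) u"
      proof (rule split_sum_cong)
        fix v u2 assume "v @ u2 = u"
        then have l: "length u = length v + length u2" by auto
        have "even (length v + q) \<or> g v = 0" using g(2) by (auto simp: parity_def)
        then show "signed ((length u + length x + 1) * length w)
          (signed (length v * length w + length v + 1) (g v * ?R2 w u2 x))
          = - signed q (g v * signed ((length u2 + length x + 1) * length w) (?R2 w u2 x))"
          by (auto simp: l signed_def)
      qed
      finally show "signed ((length u + length x + 1) * length w) (repr (\<lambda>b. ?T2 w b u * h x)) =
        split_sum (\<lambda>v u2. - signed q (g v * signed ((length u2 + length x + 1) * length w)
          (?R2 w u2 x))) u" .
    qed
    also have "\<dots> = - signed q ((g \<smile> cyclic_sum (marked f) h) as)"
      unfolding split_sum3_refine_left cup_eq cyclic_sum_def marked_def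
      by (simp only: split_sum3_minus split_sum_minus split_sum3_signed[symmetric] split_sum_signed
          split_sum3_mult_left)
    finally show ?thesis .
  qed
  have T3: "cyclic_sum ?T3 h as = - signed (p * q) (cyclic_sum (marked f) (g \<smile> h) as)"
  proof -
    have "cyclic_sum ?T3 h as = split_sum3 (\<lambda>u x w. split_sum (\<lambda>u1 v.
      - signed (p * q) (signed ((length u1 + length v
        + length x + 1) * length w) (?R3 w u1 v x))) u) as"
      unfolding cyclic_sum_def
    proof (rule split_sum3_cong)
      fix u x w
      have "signed ((length u + length x + 1) * length w) (repr (\<lambda>b. ?T3 w b u * h x)) =
        split_sum (\<lambda>u1 v. signed ((length u + length x + 1) * length w)
          (signed (length v * (length w + length u1) + length v + 1) (?R3 w u1 v x))) u"
        by (simp only: split_sum_mult_right repr_split_sum signed_mult_left repr_signed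
            split_sum_signed mult.assoc)
      also have "\<dots> = split_sum (\<lambda>u1 v. - signed (p * q)
          (signed ((length u1 + length v + length x + 1) * length w)
          (?R3 w u1 v x))) u"
      proof (rule split_sum_cong)
        fix u1 v assume "u1 @ v = u"
        then have l: "length u = length u1 + length v" by auto
        have 1: "even (length v + q) \<or> g v = 0" using g(2) by (auto simp: parity_def)
        have 2: "even (length w + length u1 + 1 + p) \<or> (\<forall>b. f (w @ b # u1) = 0)"
        proof -
          have "odd (length (w @ b # u1) + p) \<Longrightarrow> f (w @ b # u1) = 0" for b
            using f(2) unfolding parity_def by blast
          then show ?thesis by auto
        qed
        show "signed ((length u + length x + 1) * length w)
          (signed (length v * (length w + length u1) + length v + 1) (?R3 w u1 v x)) =
          - signed (p * q) (signed ((length u1 + length v + length x + 1) * length w)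
          (?R3 w u1 v x))"
        \<comment> \<open>If this does not vanish, then \<open>|v|\<close> has the parity of \<open>q\<close> and
          \<open>|w| + |u1| + 1\<close> that of \<open>p\<close>, and the exponents agree.\<close>
        proof (cases "?R3 w u1 v x = 0")
          case False
          then have "even (length v + q)" "even (length w + length u1 + 1 + p)"
            using 1 2 by (auto simp: repr_zero)
          then show ?thesis by (auto simp: l signed_def)
        qed simp
      qed
      finally show "signed ((length u + length x + 1) * length w) (repr (\<lambda>b. ?T3 w b u * h x)) =
        split_sum (\<lambda>u1 v. - signed (p * q) (signed ((length u1 + length v + length x + 1) * length w)
          (?R3 w u1 v x))) u" .
    qed
    also have "\<dots> = split_sum3 (\<lambda>u1 y w. split_sum (\<lambda>v x.
      - signed (p * q) (signed ((length u1 + length y + 1) * length w) (?R3 w u1 v x))) y) as"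
      unfolding split_sum3_refine_first
      by (intro split_sum3_cong split_sum_cong) (auto simp: add.assoc)
    also have "\<dots> = - signed (p * q) (cyclic_sum (marked f) (g \<smile> h) as)"
      unfolding cyclic_sum_def cup_eq marked_def
      by (simp only: split_sum_mult_left repr_split_sum split_sum3_minus split_sum_minus
          split_sum3_signed[symmetric] split_sum_signed[symmetric])
    finally show ?thesis .
  qed
  show ?thesis
    unfolding differential_cyclic_sum[of ?\<Phi>, OF lin h] split T1 T2 T3 by simp
qed


section \<open>Compatibility of the operations with the differential\<close>

lemma Delta_split:
  "f \<in> cochains \<Longrightarrow> Delta f as =
     split_sum (\<lambda>u w. signed ((length u + 1) * length w) (repr (\<lambda>b. f (w @ b # u)))) as"
  by (simp add: Delta_eq cyclic_sum_degree_zero_1)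

lemma Delta_cochain [cochain_intros]: "f \<in> cochains \<Longrightarrow> Delta f \<in> cochains"
  unfolding Delta_eq by (intro cyclic_sum_cochain marked_cochain degree_zero_cochain)

lemma differential_add: "\<delta> (f + g) = \<delta> f + \<delta> g"
proof
  fix as show "\<delta> (f + g) as = (\<delta> f + \<delta> g) as"
    using merge_sum_add[of f g as]
    by (simp add: differential_eq plus_fun_def hd_case_def last_case_def signed_add algebra_simps)
qed

lemma differential_minus: "\<delta> (- f) = - \<delta> f"
proof
  fix as show "\<delta> (- f) as = (- \<delta> f) as"
    using merge_sum_minus[of f as]
    by (simp add: differential_eq hd_case_def last_case_def signed_minus fun_Compl_def)
qed

lemma differential_diff: "\<delta> (f - g) = \<delta> f - \<delta> g"
  using differential_add[of f "- g"] by (simp add: differential_minus)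

lemma differential_scale: "\<delta> (\<lambda>as. c *s f as) as = c *s \<delta> f as"
proof -
  have "merge_sum (\<lambda>as. c *s f as) as = c *s merge_sum f as"
    by (rule merge_sum_additive) (rule scale_right_distrib)
  then show ?thesis
    by (simp add: differential_eq hd_case_def last_case_def scale_right_distrib scale_mult_left
        scale_mult_right signed_def)
qed

lemma differential_mult: "\<delta> (\<lambda>as. c * f as) as = c * \<delta> f as"
proof -
  have "merge_sum (\<lambda>as. c * f as) as = c * merge_sum f as"
    by (rule merge_sum_additive) (rule distrib_left)
  then show ?thesis
    by (simp add: differential_eq hd_case_def last_case_def distrib_left signed_mult_right mult_ac)
qed

lemma differential_zero: "\<delta> 0 = 0"
  using differential_diff[of 0 0] by simp

lemma differential_degree_sign: "\<delta> (degree_sign f) = - degree_sign (\<delta> f)"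
proof
  fix as
  have "merge_sum (degree_sign f) as = - degree_sign (merge_sum f) as"
    using merge_sum_signed_length[of "\<lambda>n. n" f as]
    by (cases as) (simp_all add: degree_sign_def[abs_def])
  moreover have "hd_case (\<lambda>a as. a * degree_sign f as) as
      = - degree_sign (hd_case (\<lambda>a as. a * f as)) as"
    by (cases as) (simp_all add: degree_sign_def signed_mult_right)
  moreover have "last_case (\<lambda>as a. degree_sign f as * a) as
      = - degree_sign (last_case (\<lambda>as a. f as * a)) as"
    by (cases as rule: rev_cases) (simp_all add: degree_sign_def signed_mult_left)
  ultimately show "\<delta> (degree_sign f) as = (- degree_sign (\<delta> f)) as"
    by (simp add: differential_eq degree_sign_def signed_add signed_minus signed_signed fun_Compl_def)
qed

lemma differential_even_part: "\<delta> (even_part f) = odd_part (\<delta> f)"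
  and differential_odd_part: "\<delta> (odd_part f) = even_part (\<delta> f)"
proof -
  have *: "merge_sum (\<lambda>x. if P (length x) then g x else 0) xs
      = (if P (length xs - 1) then merge_sum g xs else 0)"
    for P g and xs :: "'a list"
  proof (induction g xs arbitrary: P rule: merge_sum.induct)
    case (3 f a b xs)
    show ?case using "3.IH"[of "\<lambda>n. P (Suc n)"] by (simp cong: if_cong)
  qed simp_all
  show "\<delta> (even_part f) = odd_part (\<delta> f)"
  proof
    fix as
    show "\<delta> (even_part f) as = odd_part (\<delta> f) as"
      by (cases as) (simp_all add: differential_eq even_part_def[abs_def] odd_part_def *[of even]
          hd_case_def last_case_def)
  qed
  show "\<delta> (odd_part f) = even_part (\<delta> f)"
  proof
    fix as
    show "\<delta> (odd_part f) as = even_part (\<delta> f) as"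
      by (cases as) (simp_all add: differential_eq odd_part_def[abs_def] even_part_def *[of
          "\<lambda>n. odd n"] hd_case_def last_case_def)
  qed
qed

lemma even_part_cochain [cochain_intros]: "f \<in> cochains \<Longrightarrow> even_part f \<in> cochains"
  and odd_part_cochain [cochain_intros]: "f \<in> cochains \<Longrightarrow> odd_part f \<in> cochains"
  by (rule cochainsI; simp add: even_part_def odd_part_def cochain_add cochain_scale cochain_one)+

lemma parts_add: "even_part f + odd_part f = f"
  by (simp add: fun_eq_iff even_part_def odd_part_def)

lemma parity_parts: "parity 0 (even_part f)" "parity 1 (odd_part f)"
  by (simp_all add: parity_def even_part_def odd_part_def)

text \<open>
  The exponent in the sign of the orientation reversal.
\<close>

definition tri :: "nat \<Rightarrow> nat" where "tri n = n * (n + 1) div 2"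

lemma tri_Suc: "tri (Suc n) = tri n + Suc n"
proof -
  have "Suc n * (Suc n + 1) = n * (n + 1) + Suc n * 2" by simp
  then show ?thesis by (simp only: tri_def div_mult_self3) simp
qed

lemma tri_add: "tri (m + n) = tri m + tri n + m * n"
proof (induction n)
  case 0
  show ?case by (simp add: tri_def)
qed (simp add: tri_Suc)

text \<open>
  The position of a merge in a list of length \<open>n\<close> changes from \<open>j\<close> to \<open>n - j\<close>, and the two factors
  are interchanged, which does not matter in a commutative algebra.
\<close>

lemma merge_sum_rev:
  fixes f :: "'a list \<Rightarrow> 'a"
  shows "merge_sum (\<lambda>as. f (rev as)) as = signed (length as) (merge_sum f (rev as))"
proof (induction as arbitrary: f)
  case (Cons a xs)
  have h: "hd_case (\<lambda>b ys. f (rev ys @ [a * b])) xs = last_case (\<lambda>ys b. f (ys @ [b * a])) (rev xs)"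
    by (cases xs) (simp_all add: mult.commute)
  show ?case
    using Cons.IH[of "\<lambda>zs. f (zs @ [a])"] h
    by (simp add: merge_sum_Cons merge_sum_append[of f "rev xs" "[a]"] signed_add signed_signed)
      (simp add: signed_def)
qed simp

lemma reversal_eq: "reversal f as = signed (tri (length as)) (f (rev as))"
  by (simp only: reversal_def tri_def Let_def)

lemma differential_reversal: "\<delta> (reversal f) = reversal (\<delta> f)"
proof
  fix as
  have h: "hd_case (\<lambda>a as. a * reversal f as) as =
      signed (tri (length as) + length as) (last_case (\<lambda>as a. f as * a) (rev as))"
    by (cases as) (auto simp: reversal_eq tri_Suc signed_mult_right mult.commute signed_def)
  have l: "last_case (\<lambda>as a. reversal f as * a) as =
      signed (tri (length as) + length as) (hd_case (\<lambda>a as. a * f as) (rev as))"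
    by (cases as rule: rev_cases) (auto simp: reversal_eq tri_Suc signed_mult_left mult.commute
        signed_def)
  have m: "merge_sum (reversal f) as = signed (tri (length as)) (merge_sum f (rev as))"
  proof -
    have "merge_sum (reversal f) as = signed (tri (length as - 1)) (merge_sum (\<lambda>as. f (rev as)) as)"
      unfolding merge_sum_signed_length[symmetric] by (simp add: reversal_eq[abs_def])
    then show ?thesis
      by (cases as) (auto simp: merge_sum_rev tri_Suc signed_signed signed_def)
  qed
  show "\<delta> (reversal f) as = reversal (\<delta> f) as"
    unfolding differential_eq[of "reversal f"] h l m
    by (simp add: reversal_eq[of "\<delta> f"] differential_eq[of f] signed_add signed_signed) (auto simp:
        signed_def)
qed

lemma reversal_cochain [cochain_intros]:
  assumes "f \<in> cochains"
  shows "reversal f \<in> cochains"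
  by (rule cochainsI)
    (use cochain_add[OF assms] cochain_scale[OF assms] cochain_one[OF assms] in
      \<open>auto simp: reversal_eq signed_add\<close>, simp add: signed_def)

lemma split_sum_rev: "split_sum X (rev as) = split_sum (\<lambda>u v. X (rev v) (rev u)) as"
proof (induction as arbitrary: X)
  case (Cons a as)
  then show ?case by (simp add: split_sum_snoc split_sum_Cons add.commute)
qed simp

text \<open>
  Reversal exchanges the roles of \<open>u\<close> and \<open>w\<close>. With \<open>n = |u| + |w|\<close> the exponents on the two sides
  are \<open>(|u| + 1) |w| + tri (n + 1)\<close> and \<open>(|w| + 1) |u| + tri n\<close>, which differ by an odd number.
\<close>

lemma Delta_reversal:
  assumes "f \<in> cochains"
  shows "Delta (reversal f) = - reversal (Delta f)"
proof
  fix as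
  show "Delta (reversal f) as = (- reversal (Delta f)) as"
    unfolding Delta_split[OF reversal_cochain[OF assms]] reversal_eq[of "Delta f"] Delta_split[OF assms]
      split_sum_rev fun_Compl_def split_sum_signed split_sum_minus[symmetric, THEN fun_cong]
  proof (rule split_sum_cong)
    fix u w :: "'a list" assume "u @ w = as"
    then have l: "length as = length w + length u" by auto
    show "signed ((length u + 1) * length w) (repr (\<lambda>b. reversal f (w @ b # u))) =
      - signed (tri (length as)) (signed ((length (rev w) + 1) * length (rev u)) (repr
        (\<lambda>b. f (rev u @ b # rev w))))"
      by (simp only: reversal_eq) (auto simp: l tri_Suc signed_def repr_minus)
  qed
qed

lemma reversal_cup:
  assumes "parity p f" "parity q g"
  shows "reversal (f \<smile> g) = signed (p * q) (reversal g \<smile> reversal f)"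
proof -
  have "reversal (f \<smile> g) as = signed (p * q) ((reversal g \<smile> reversal f) as)" for as
    unfolding reversal_eq[of "f \<smile> g"] unfolding cup_eq split_sum_rev split_sum_signed
  proof (rule split_sum_cong)
    fix u v assume "u @ v = as"
    then have l: "tri (length as) = tri (length u) + tri (length v) + length u * length v"
      by (auto simp: tri_add)
    have 1: "even (length v + p) \<or> f (rev v) = 0" using parityD[OF assms(1), of "rev v"] by auto
    have 2: "even (length u + q) \<or> g (rev u) = 0" using parityD[OF assms(2), of "rev u"] by auto
    show "signed (tri (length as)) (f (rev v) * g (rev u))
        = signed (p * q) (reversal g u * reversal f v)"
      using 1 2 by (auto simp: reversal_eq l signed_mult_left signed_mult_right mult.commute) (auto
          simp: signed_def)
  qed
  then show ?thesis by (auto simp: fun_eq_iff signed_def)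
qed

text \<open>
  The terms in which an entry at the cut between the two factors is multiplied to the value of \<open>f\<close>
  or to the value of \<open>g\<close> occur on the right hand side only, and cancel after moving the cut.
\<close>

lemma differential_cup: "\<delta> (f \<smile> g) = \<delta> f \<smile> g + degree_sign f \<smile> \<delta> g"
proof
  fix as
  have h: "hd_case (\<lambda>a as. a * (f \<smile> g) as) as = split_sum (\<lambda>u v. hd_case (\<lambda>a u. a * f u) u * g v) as"
    by (cases as) (simp_all add: cup_eq split_sum_Cons split_sum_mult_left mult.assoc)
  have l: "signed (length as) (last_case (\<lambda>as a. (f \<smile> g) as * a) as) =
      split_sum (\<lambda>u v. signed (length u + length v) (f u * last_case (\<lambda>v a. g v * a) v)) as"
  proof -
    have "last_case (\<lambda>as a. (f \<smile> g) as * a) as = split_sum (\<lambda>u v. f u * last_case (\<lambda>v a. g v * a) v) as"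
      by (cases as rule: rev_cases) (simp_all add: cup_eq split_sum_snoc split_sum_mult_right
          mult.assoc)
    then show ?thesis
      by (simp only: split_sum_signed) (rule split_sum_cong, auto)
  qed
  have m: "merge_sum (f \<smile> g) as =
      split_sum (\<lambda>u v. merge_sum f u * g v + signed (length u) (f u * merge_sum g v)) as"
    unfolding cup_eq merge_sum_split_sum
    by (simp add: merge_sum_additive[of "\<lambda>x. x * _"] merge_sum_additive[of
        "\<lambda>x. _ * x"] distrib_left distrib_right)
  have s: "split_sum (\<lambda>u v. signed (length u) (last_case (\<lambda>u a. f u * a) u * g v)) as =
      - split_sum (\<lambda>u v. signed (length u) (f u * hd_case (\<lambda>a v. a * g v) v)) as"
  proof -
    have "split_sum (\<lambda>u v. signed (length u) (last_case (\<lambda>u a. f u * a) u * g v)) as =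
      split_sum (\<lambda>u v. last_case (\<lambda>u a. - signed (length u) (f u * a * g v)) u) as"
    proof (rule split_sum_cong)
      fix u v
      show "signed (length u) (last_case (\<lambda>u a. f u * a) u * g v) =
         last_case (\<lambda>u a. - signed (length u) (f u * a * g v)) u"
        by (cases u rule: rev_cases) simp_all
    qed
    also have "\<dots> = split_sum (\<lambda>u v. - signed (length u) (f u * hd_case (\<lambda>a v. a * g v) v)) as"
      unfolding split_sum_shift by (rule split_sum_cong) (simp add: hd_case_def mult.assoc)
    finally show ?thesis by (simp add: split_sum_minus)
  qed
  have "(\<delta> f \<smile> g + degree_sign f \<smile> \<delta> g) as = 
     split_sum (\<lambda>u v. hd_case (\<lambda>a u. a * f u) u * g v) as
     + split_sum (\<lambda>u v. merge_sum f u * g v + signed (length u) (f u * merge_sum g v)) as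
     + split_sum (\<lambda>u v. signed (length u + length v) (f u * last_case (\<lambda>v a. g v * a) v)) as
     + (split_sum (\<lambda>u v. signed (length u) (last_case (\<lambda>u a. f u * a) u * g v)) as
        + split_sum (\<lambda>u v. signed (length u) (f u * hd_case (\<lambda>a v. a * g v) v)) as)"
    unfolding cup_eq plus_fun_apply split_sum_add[symmetric, THEN fun_cong]
    by (rule split_sum_cong)
      (simp add: differential_eq degree_sign_def distrib_left distrib_right signed_mult_left
          signed_mult_right
        signed_add signed_signed add_ac)
  then show "\<delta> (f \<smile> g) as = (\<delta> f \<smile> g + degree_sign f \<smile> \<delta> g) as"
    unfolding differential_eq[of "f \<smile> g"] h l m s by simp
qed

text \<open>
  The two terms that multiply the value of \<open>f\<close> by the marked entry both represent \<open>f\<close> itself, with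
  opposite signs.
\<close>

lemma differential_Delta:
  assumes f: "f \<in> cochains"
  shows "\<delta> (Delta f) = - cyclic_sum (marked (\<delta> f)) (degree_zero 1)"
proof
  fix as
  let ?A = "\<lambda>w b u. if w = [] then b * f u else 0"
  let ?B = "\<lambda>w b u. signed (length w) (if u = [] then f w * b else 0)"
  have "cyclic_sum ?A (degree_zero 1) as = split_sum3
      (\<lambda>u v w. if w = [] then f u * degree_zero 1 v else 0) as"
    unfolding cyclic_sum_def by (rule split_sum3_cong) (simp add: repr_zero repr_mult_const mult.assoc)
  also have "\<dots> = split_sum (\<lambda>u v. if v = [] then f u else 0) as"
    unfolding split_sum3_last_Nil by (rule split_sum_cong) (simp add: degree_zero_def)
  finally have A: "cyclic_sum ?A (degree_zero 1) as = f as"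
    by (simp only: split_sum_last_Nil)
  have "cyclic_sum ?B (degree_zero 1) as =
      split_sum (\<lambda>u. split_sum (\<lambda>v w. if v = [] then (if u = [] then f w else 0) else 0)) as"
    unfolding cyclic_sum_def split_sum3_def
  proof (intro split_sum_cong)
    fix u s v w :: "'a list"
    have "repr (\<lambda>b. f w * b) = f w" using repr_mult_const[of "f w"] by (simp add: mult.commute)
    then show "signed ((length u + length v + 1) * length w) (repr (\<lambda>b. ?B w b u * degree_zero 1 v)) =
      (if v = [] then (if u = [] then f w else 0) else 0)"
      by (auto simp: degree_zero_def repr_zero repr_signed signed_signed) (simp add: signed_def)
  qed
  then have B: "cyclic_sum ?B (degree_zero 1) as = f as"
    by (simp only: split_sum_first_Nil)
  have "\<delta> (Delta f) as = - cyclic_sum (cyclic_differential (marked f)) (degree_zero 1) as"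
    unfolding Delta_eq[OF f] by (rule differential_cyclic_sum[OF linear_endo_marked[OF f]
        degree_zero_cocycle])
  also have "cyclic_sum (cyclic_differential (marked f)) (degree_zero 1) as =
     cyclic_sum (marked (\<delta> f)) (degree_zero 1) as - cyclic_sum ?A (degree_zero 1) as
         + cyclic_sum ?B (degree_zero 1) as"
    unfolding cyclic_sum_def cyclic_differential_marked diff_conv_add_uminus distrib_right
        mult_minus_left repr_add repr_minus
      signed_add signed_minus split_sum3_add split_sum3_minus marked_def ..
  finally show "\<delta> (Delta f) as = (- cyclic_sum (marked (\<delta> f)) (degree_zero 1)) as"
    by (simp add: A B)
qed

text \<open>
  In \<open>\<langle>\<Delta> f xs, 1\<rangle>\<close> the marked argument of \<open>f\<close> is 1, so this vanishes for a normalized cochain. The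
  values of \<open>\<Delta> (\<Delta> f)\<close> are determined by such inner products.
\<close>

lemma Delta_Delta:
  assumes f: "f \<in> cochains"
  shows "Delta (Delta f) = 0"
proof
  fix as
  have "\<langle>Delta f xs, 1\<rangle> = 0" for xs
  proof -
    have "\<langle>repr (\<lambda>b. f (w @ b # u)), 1\<rangle> = 0" for u w
      using ip_repr[OF linear_endo_cochain[OF f, of w u 1], of 1] by (simp add: cochain_one f)
    then show ?thesis
      by (simp add: Delta_split f split_sum_def ip_sum ip_signed)
  qed
  then have "repr (\<lambda>b. Delta f (w @ b # u)) = 0" for u w
    by (simp add: repr_def)
  then show "Delta (Delta f) as = 0 as"
    by (simp add: Delta_split[OF Delta_cochain[OF f]] split_sum_zero)
qed


section \<open>The relations up to coboundaries\<close>

lemma cocycle_differential: "f \<in> cocycles \<Longrightarrow> \<delta> f = 0"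
  by (simp add: cocycles_def)

lemma fun_cochain [cochain_intros]:
  shows "f \<in> cochains \<Longrightarrow> g \<in> cochains \<Longrightarrow> f + g \<in> cochains"
    and "f \<in> cochains \<Longrightarrow> g \<in> cochains \<Longrightarrow> f - g \<in> cochains"
    and "f \<in> cochains \<Longrightarrow> - f \<in> cochains"
    and "f \<in> cochains \<Longrightarrow> signed n f \<in> cochains"
    and "0 \<in> cochains"
  using add_cochain[of f g] diff_cochain[of f g] minus_cochain[of f] zero_cochain
  by (simp_all add: plus_fun_def fun_diff_def fun_Compl_def zero_fun_def signed_def)

lemma coboundaryI: "c \<in> cochains \<Longrightarrow> f = \<delta> c \<Longrightarrow> f \<in> coboundaries"
  by (simp add: coboundaries_def)

lemma coboundaries_zero: "0 \<in> coboundaries"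
  by (rule coboundaryI[of 0]) (simp_all add: fun_cochain differential_zero)

lemma coboundaries_add: "f \<in> coboundaries \<Longrightarrow> g \<in> coboundaries \<Longrightarrow> f + g \<in> coboundaries"
  unfolding coboundaries_def by (auto simp: differential_add[symmetric] fun_cochain)

lemma coboundaries_minus: "f \<in> coboundaries \<Longrightarrow> - f \<in> coboundaries"
  unfolding coboundaries_def by (auto simp: differential_minus[symmetric] fun_cochain)

lemma coboundaries_diff: "f \<in> coboundaries \<Longrightarrow> g \<in> coboundaries \<Longrightarrow> f - g \<in> coboundaries"
  unfolding coboundaries_def by (auto simp: differential_diff[symmetric] fun_cochain)

lemma coboundaries_signed: "f \<in> coboundaries \<Longrightarrow> signed n f \<in> coboundaries"
  by (simp add: signed_def coboundaries_minus)

lemma coboundaries_scale: "f \<in> coboundaries \<Longrightarrow> (\<lambda>as. c *s f as) \<in> coboundaries"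
proof -
  assume "f \<in> coboundaries"
  then obtain h where "h \<in> cochains" "f = \<delta> h" by (auto simp: coboundaries_def)
  then show ?thesis
    by (intro coboundaryI[OF scale_cochain[of h c]]) (simp_all add: fun_eq_iff differential_scale)
qed

lemma cup_add_left: "(f + g) \<smile> h = f \<smile> h + g \<smile> h"
  and cup_add_right: "h \<smile> (f + g) = h \<smile> f + h \<smile> g"
  and cup_diff_left: "(f - g) \<smile> h = f \<smile> h - g \<smile> h"
  and cup_diff_right: "h \<smile> (f - g) = h \<smile> f - h \<smile> g"
  and cup_minus_left: "(- f) \<smile> h = - (f \<smile> h)"
  and cup_minus_right: "h \<smile> (- f) = - (h \<smile> f)"
  and cup_zero_left: "0 \<smile> h = 0"
  and cup_zero_right: "h \<smile> 0 = 0"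
  by (simp_all add: fun_eq_iff cup_eq distrib_left distrib_right left_diff_distrib right_diff_distrib
      split_sum_add split_sum_diff split_sum_minus split_sum_zero)

lemma cup_signed_left: "signed n f \<smile> h = signed n (f \<smile> h)"
  and cup_signed_right: "h \<smile> signed n f = signed n (h \<smile> f)"
  by (simp_all add: signed_def cup_minus_left cup_minus_right)

lemma cup_scale_left: "(\<lambda>as. c *s f as) \<smile> g = (\<lambda>as. c *s (f \<smile> g) as)"
  and cup_scale_right: "f \<smile> (\<lambda>as. c *s g as) = (\<lambda>as. c *s (f \<smile> g) as)"
  by (simp_all add: fun_eq_iff cup_def scale_sum_right scale_mult_left scale_mult_right)

lemma cup_assoc: "(f \<smile> g) \<smile> h = f \<smile> (g \<smile> h)"
  by (simp add: fun_eq_iff cup_eq split_sum_mult_left split_sum_mult_right split_sum_assoc mult.assoc)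

lemma degree_sign_degree_sign: "degree_sign (degree_sign f) = f"
  by (simp add: fun_eq_iff degree_sign_def signed_signed signed_def)

lemma degree_sign_cocycle: "f \<in> cocycles \<Longrightarrow> degree_sign f \<in> cocycles"
  by (auto simp: cocycles_def degree_sign_cochain differential_degree_sign fun_eq_iff degree_sign_def)

lemma cup_cocycle: "f \<in> cocycles \<Longrightarrow> g \<in> cocycles \<Longrightarrow> f \<smile> g \<in> cocycles"
  by (simp add: cocycles_def cup_cochain differential_cup cup_zero_left cup_zero_right)

lemma cup_coboundary_left:
  assumes "c \<in> coboundaries" "g \<in> cocycles"
  shows "c \<smile> g \<in> coboundaries"
proof -
  obtain h where "h \<in> cochains" "c = \<delta> h" using assms(1) by (auto simp: coboundaries_def)
  then show ?thesis
    using assms(2) by (intro coboundaryI[of "h \<smile> g"])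
      (auto simp: cocycles_def cup_cochain differential_cup cup_zero_right)
qed

lemma cup_coboundary_right:
  assumes "f \<in> cocycles" "c \<in> coboundaries"
  shows "f \<smile> c \<in> coboundaries"
proof -
  obtain h where "h \<in> cochains" "c = \<delta> h" using assms(2) by (auto simp: coboundaries_def)
  moreover have "\<delta> (degree_sign f) = 0"
    using degree_sign_cocycle[OF assms(1)] by (rule cocycle_differential)
  ultimately show ?thesis
    using assms(1) by (intro coboundaryI[of "degree_sign f \<smile> h"])
      (auto simp: cocycles_cochain cup_cochain degree_sign_cochain differential_cup
          degree_sign_degree_sign cup_zero_left)
qed

lemma cyclic_sum_zero: "cyclic_sum (marked 0) y = 0"
  by (simp add: fun_eq_iff cyclic_sum_def marked_def repr_zero split_sum3_zero)

lemma cyclic_sum_diff: "cyclic_sum (marked (f - g)) y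
    = cyclic_sum (marked f) y - cyclic_sum (marked g) y"
  by (simp only: fun_eq_iff fun_diff_def cyclic_sum_def marked_def diff_conv_add_uminus distrib_right
      mult_minus_left
      repr_add repr_minus signed_add signed_minus split_sum3_add split_sum3_minus simp_thms)

lemma cyclic_sum_add: "cyclic_sum (marked (f + g)) y
    = cyclic_sum (marked f) y + cyclic_sum (marked g) y"
  by (simp only: fun_eq_iff plus_fun_def cyclic_sum_def marked_def distrib_right
      repr_add signed_add split_sum3_add simp_thms)

lemma Delta_cocycle: "f \<in> cocycles \<Longrightarrow> Delta f \<in> cocycles"
  by (auto simp: cocycles_def Delta_cochain differential_Delta cyclic_sum_zero)

lemma Delta_add: "f \<in> cochains \<Longrightarrow> g \<in> cochains \<Longrightarrow> Delta (f + g) = Delta f + Delta g"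
  by (simp add: Delta_eq fun_cochain cyclic_sum_add)

lemma Delta_scale: "f \<in> cochains \<Longrightarrow> Delta (\<lambda>as. c *s f as) = (\<lambda>as. c *s Delta f as)"
proof -
  have "signed n (c *s x) = c *s signed n x" for n x by (simp add: signed_def)
  then show "f \<in> cochains \<Longrightarrow> ?thesis"
    by (simp add: fun_eq_iff Delta_split scale_cochain repr_scale split_sum_def scale_sum_right)
qed

lemma Delta_coboundary:
  assumes "f \<in> cochains" "g \<in> cochains" "f - g \<in> coboundaries"
  shows "Delta f - Delta g \<in> coboundaries"
proof -
  obtain h where h: "h \<in> cochains" "f - g = \<delta> h" using assms(3) by (auto simp: coboundaries_def)
  have "Delta f - Delta g = cyclic_sum (marked (\<delta> h)) (degree_zero 1)"
    by (simp add: Delta_eq assms cyclic_sum_diff[symmetric] h(2))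
  also have "\<dots> = \<delta> (- Delta h)"
    by (simp add: differential_minus differential_Delta h(1))
  finally show ?thesis using h(1) by (intro coboundaryI[of
      "- Delta h"]) (simp_all add: Delta_cochain fun_cochain)
qed

lemma parity_cup: "parity p f \<Longrightarrow> parity q g \<Longrightarrow> parity (p + q) (f \<smile> g)"
  unfolding parity_def
proof (intro allI impI)
  fix as :: "'a list"
  assume f: "\<forall>as. odd (length as + p) \<longrightarrow> f as = 0" and g: "\<forall>as. odd (length as + q) \<longrightarrow> g as = 0"
    and as: "odd (length as + (p + q))"
  have "split_sum (\<lambda>u v. f u * g v) as = split_sum (\<lambda>u v. 0) as"
  proof (rule split_sum_cong)
    fix u v assume "u @ v = as"
    then have "odd (length u + p) \<or> odd (length v + q)" using as by auto
    then show "f u * g v = 0" using f g by auto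
  qed
  then show "(f \<smile> g) as = 0" by (simp add: cup_eq split_sum_zero)
qed

lemma parity_Delta: "f \<in> cochains \<Longrightarrow> parity p f \<Longrightarrow> parity (p + 1) (Delta f)"
  unfolding parity_def
proof (intro allI impI)
  fix as :: "'a list"
  assume f: "f \<in> cochains" "\<forall>as. odd (length as + p) \<longrightarrow> f as = 0" and as: "odd (length as + (p + 1))"
  have "Delta f as = split_sum (\<lambda>u v. 0) as"
    unfolding Delta_split[OF f(1)]
  proof (rule split_sum_cong)
    fix u w assume "u @ w = as"
    then have "odd (length (w @ b # u) + p)" for b using as by auto
    then have "f (w @ b # u) = 0" for b using f(2) by blast
    then show "signed ((length u + 1) * length w) (repr (\<lambda>b. f (w @ b # u))) = 0"
        by (simp add: repr_zero)
  qed
  then show "Delta f as = 0" by (simp add: split_sum_zero)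
qed

text \<open>
  The homotopy is the insertion of \<open>g\<close> into \<open>f\<close>, up to a sign that only depends on the parities.
\<close>

lemma cup_commute_coboundary:
  assumes f: "f \<in> cocycles" "parity p f" and g: "g \<in> cocycles" "parity q g"
  shows "f \<smile> g - signed (p * q) (g \<smile> f) \<in> coboundaries"
proof (rule coboundaryI)
  let ?h = "signed (p * q + q) (insertion 0 f g)"
  show "- ?h \<in> cochains"
    by (intro cochain_intros cocycles_cochain f g)
  have *: "\<delta> (insertion 0 f g) as = signed q ((g \<smile> f) as) - signed (p * q + q) ((f \<smile> g) as)" for as
  proof -
    have "split_sum3 (\<lambda>u v w. signed ((length v + 1) * (length u + 1)) (\<delta> f (u @ g v # w))) as = 0"
      by (simp add: cocycle_differential f split_sum3_zero)
    moreover have "split_sum (\<lambda>v w. signed (length v) (g v * f w)) as = signed q ((g \<smile> f) as)"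
      unfolding cup_eq split_sum_signed
    proof (rule split_sum_cong)
      fix u v show "signed (length u) (g u * f v) = signed q (g u * f v)"
        using parityD[OF g(2), of u] by (auto simp: signed_def)
    qed
    moreover have "split_sum (\<lambda>u v. signed (length v * (length u + 1)) (f u * g v)) as
        = signed (p * q + q) ((f \<smile> g) as)"
      unfolding cup_eq split_sum_signed
    proof (rule split_sum_cong)
      fix u v show "signed (length v * (length u + 1)) (f u * g v) = signed (p * q + q) (f u * g v)"
        using parityD[OF f(2), of u] parityD[OF g(2), of v] by (auto simp: signed_def)
    qed
    ultimately show ?thesis
      by (simp add: differential_insertion cocycles_cochain f g)
  qed
  have "\<delta> (signed n h) = signed n (\<delta> h)" for n h
    by (simp add: signed_def differential_minus)
  then have "\<delta> (- ?h) = f \<smile> g - signed (p * q) (g \<smile> f)"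
    by (auto simp: fun_eq_iff * differential_minus signed_def)
  then show "f \<smile> g - signed (p * q) (g \<smile> f) = \<delta> (- ?h)" ..
qed


lemma differential_signed: "\<delta> (signed n h) = signed n (\<delta> h)"
  by (simp add: signed_def differential_minus)

lemma parity_marked: "parity p f \<Longrightarrow> odd (length w + length u + 1 + p) \<Longrightarrow> marked f w b u = 0"
  using parityD[of p f "w @ b # u"] by (simp add: marked_def)

text \<open>
  On the rotated list \<open>w @ b # u\<close> the product \<open>f \<smile> g\<close> cuts either \<open>u\<close> or \<open>w\<close>. In the first case
  \<open>b\<close> is an argument of \<open>f\<close>, in the second one of \<open>g\<close>. The sign \<open>(-1)\<^sup>p\<^sup>q\<close> in the second case is
  that of rotating the arguments of \<open>f\<close> past the others.
\<close>

lemma Delta_cup: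
  assumes f: "f \<in> cochains" "parity p f" and g: "g \<in> cochains" "parity q g"
  shows "Delta (f \<smile> g) = cyclic_sum (marked f) g + signed (p * q) (cyclic_sum (marked g) f)"
proof -
  have "Delta (f \<smile> g) as = cyclic_sum (marked f) g as + signed (p * q) (cyclic_sum (marked g) f as)"
      for as
  proof -
    let ?s = "\<lambda>u w. (length u + 1) * length w"
    have "Delta (f \<smile> g) as =
        split_sum (\<lambda>u w. split_sum (\<lambda>w1 w2. signed (?s u w) (repr (\<lambda>b. f w1 * g (w2 @ b # u)))) w) as
      + split_sum (\<lambda>u w. split_sum (\<lambda>u1 u2. signed (?s u w) (repr (\<lambda>b. f (w @ b # u1) * g u2))) u) as"
      unfolding Delta_split[OF cup_cochain[OF f(1) g(1)]]
      unfolding cup_eq split_sum_append_Cons repr_add repr_split_sum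
        signed_add split_sum_add split_sum_signed ..
    also have "split_sum (\<lambda>u w. split_sum (\<lambda>u1 u2. signed (?s u w) (repr
        (\<lambda>b. f (w @ b # u1) * g u2))) u) as
      = cyclic_sum (marked f) g as"
    proof -
      have "split_sum (\<lambda>u w. split_sum (\<lambda>u1 u2. signed (?s u w) (repr
          (\<lambda>b. f (w @ b # u1) * g u2))) u) as =
        split_sum (\<lambda>u w. split_sum (\<lambda>u1 u2. signed ((length u1 + length u2 + 1) * length w) (repr
            (\<lambda>b. f (w @ b # u1) * g u2))) u) as"
        by (intro split_sum_cong) auto
      then show ?thesis by (simp only: cyclic_sum_def split_sum3_alt marked_def)
    qed
    also have "split_sum (\<lambda>u w. split_sum (\<lambda>w1 w2. signed (?s u w) (repr
        (\<lambda>b. f w1 * g (w2 @ b # u)))) w) as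
      = signed (p * q) (cyclic_sum (marked g) f as)"
    proof -
      have "split_sum (\<lambda>u w. split_sum (\<lambda>w1 w2. signed (?s u w) (repr
          (\<lambda>b. f w1 * g (w2 @ b # u)))) w) as =
        split_sum (\<lambda>u w. split_sum (\<lambda>w1 w2. signed (p * q)
            (signed ((length u + length w1 + 1) * length w2)
          (repr (\<lambda>b. marked g w2 b u * f w1)))) w) as"
      proof (intro split_sum_cong)
        fix u w w1 w2 :: "'a list" assume "w1 @ w2 = w"
        then have l: "length w = length w1 + length w2" by auto
        have r: "repr (\<lambda>b. f w1 * g (w2 @ b # u)) = repr (\<lambda>b. marked g w2 b u * f w1)"
          by (simp add: marked_def mult.commute)
        show "signed (?s u w) (repr (\<lambda>b. f w1 * g (w2 @ b # u))) =
          signed (p * q) (signed ((length u + length w1 + 1) * length w2) (repr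
              (\<lambda>b. marked g w2 b u * f w1)))"
        proof (cases "odd (length w1 + p) \<or> odd (length w2 + length u + 1 + q)")
          case True
          then have "f w1 = 0 \<or> (\<forall>b. marked g w2 b u = 0)"
            using parityD[OF f(2), of w1] parity_marked[OF g(2), of w2 u] by blast
          then have "repr (\<lambda>b. marked g w2 b u * f w1) = 0"
            by (auto simp: repr_zero)
          then show ?thesis by (simp add: r)
        next
          case False
          then show ?thesis unfolding r l by (auto simp: signed_def)
        qed
      qed
      also have "\<dots> = signed (p * q) (cyclic_sum (marked g) f as)"
        by (simp only: cyclic_sum_def split_sum3_def split_sum_signed)
      finally show ?thesis .
    qed
    finally show ?thesis by (simp add: add.commute)
  qed
  then show ?thesis by (auto simp: fun_eq_iff signed_def)
qed

text \<open>
  The value of \<open>f\<close> is inserted either into the arguments of \<open>g\<close> or into those of \<open>h\<close>. In the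
  second case it passes all the arguments of \<open>g\<close>.
\<close>

lemma insertion_cup:
  assumes f: "parity p f" and g: "parity q g" and h: "h \<in> cochains"
  shows "insertion 0 (g \<smile> h) f = insertion 0 g f \<smile> h + signed ((p + 1) * q) (g \<smile> insertion 0 h f)"
proof -
  let ?s = "\<lambda>u v. (length v + 1) * (0 + length u)"
  have "insertion 0 (g \<smile> h) f as = (insertion 0 g f \<smile> h) as
      + signed ((p + 1) * q) ((g \<smile> insertion 0 h f) as)" for as
  proof -
    have "insertion 0 (g \<smile> h) f as =
      split_sum3 (\<lambda>u v w. split_sum (\<lambda>u1 u2. signed (?s u v) (g u1 * h (u2 @ f v # w))) u) as
      + split_sum3 (\<lambda>u v w. split_sum (\<lambda>w1 w2. signed (?s u v) (g (u @ f v # w1) * h w2)) w) as"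
      unfolding insertion_def cup_eq split_sum_append_Cons signed_add split_sum3_add split_sum_signed ..
    also have "split_sum3 (\<lambda>u v w. split_sum (\<lambda>w1 w2. signed (?s u v) (g (u @ f v # w1) * h w2)) w) as
      = (insertion 0 g f \<smile> h) as"
    proof -
      have "(insertion 0 g f \<smile> h) as = split_sum (\<lambda>s t. split_sum3
          (\<lambda>u v w1. signed (?s u v) (g (u @ f v # w1) * h t)) s) as"
        by (simp only: cup_eq insertion_def split_sum3_mult_right signed_mult_left)
      also have "\<dots> = split_sum (\<lambda>u. split_sum (\<lambda>y t. split_sum
          (\<lambda>v w1. signed (?s u v) (g (u @ f v # w1) * h t)) y)) as"
        unfolding split_sum3_def by (rule split_sum_assoc[symmetric])
      also have "\<dots> = split_sum3 (\<lambda>u v w. split_sum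
          (\<lambda>w1 w2. signed (?s u v) (g (u @ f v # w1) * h w2)) w) as"
        unfolding split_sum3_def by (rule split_sum_cong) (rule split_sum_assoc[symmetric])
      finally show ?thesis by simp
    qed
    also have "split_sum3 (\<lambda>u v w. split_sum (\<lambda>u1 u2. signed (?s u v) (g u1 * h (u2 @ f v # w))) u) as
      = signed ((p + 1) * q) ((g \<smile> insertion 0 h f) as)"
    proof -
      have "split_sum3 (\<lambda>u v w. split_sum (\<lambda>u1 u2. signed (?s u v) (g u1 * h (u2 @ f v # w))) u) as =
        split_sum3 (\<lambda>u v w. split_sum (\<lambda>u1 u2. signed ((p + 1) * q) (g u1 * signed (?s u2 v) (h (u2 @
            f v # w)))) u) as"
      proof (intro split_sum3_cong split_sum_cong)
        fix u v w u1 u2 :: "'a list" assume "u1 @ u2 = u"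
        then have l: "length u = length u1 + length u2" by auto
        show "signed (?s u v) (g u1 * h (u2 @ f v # w))
            = signed ((p + 1) * q) (g u1 * signed (?s u2 v) (h (u2 @ f v # w)))"
        proof (cases "odd (length v + p) \<or> odd (length u1 + q)")
          case True
          then have "g u1 * h (u2 @ f v # w) = 0"
            using parityD[OF f, of v] parityD[OF g, of u1] cochain_entry_zero[OF h] by auto
          then show ?thesis by (simp add: signed_mult_right)
        next
          case False
          then show ?thesis unfolding l signed_mult_right by (auto simp: signed_def)
        qed
      qed
      also have "\<dots> = signed ((p + 1) * q) ((g \<smile> insertion 0 h f) as)"
        unfolding split_sum3_refine_left cup_eq insertion_def
        by (simp only: split_sum3_signed split_sum_signed split_sum3_mult_left signed_mult_right)
      finally show ?thesis .
    qed
    finally show ?thesis by (simp add: add.commute)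
  qed
  then show ?thesis by (auto simp: fun_eq_iff signed_def)
qed

lemma cup_unit_right: "f \<smile> degree_zero 1 = f"
proof
  fix as
  have "(f \<smile> degree_zero 1) as = split_sum (\<lambda>u v. if v = [] then f u else 0) as"
    unfolding cup_eq by (rule split_sum_cong) (simp add: degree_zero_def)
  then show "(f \<smile> degree_zero 1) as = f as" by (simp only: split_sum_last_Nil)
qed

text \<open>
  The central homotopy. Its three terms are explained in the introduction.
\<close>

lemma cyclic_sum_cup_coboundary:
  assumes f: "f \<in> cocycles" "parity p f" and g: "g \<in> cocycles" "parity q g" and h: "h \<in> cocycles"
  shows "signed (p * q) (cyclic_sum (marked f) (g \<smile> h)) - signed q (g \<smile> cyclic_sum (marked f) h)
     + signed q (insertion 0 f g \<smile> h) \<in> coboundaries"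
proof (rule coboundaryI)
  let ?k = "cyclic_sum (\<lambda>w b. insertion (length w) (marked f w b) g) h"
  have sc: "(\<lambda>w. insertion (length w) (marked f w b) g u) \<in> cochains" for b u
    unfolding insertion_def split_sum3_def
    by (intro cochain_intros signed_cochain[where n =
        "\<lambda>n. _ * (n + _)"] marked_cochain cocycles_cochain f)
  show "- ?k \<in> cochains"
    by (intro fun_cochain cyclic_sum_cochain insertion_cochain marked_cochain cocycles_cochain f g h sc)
  show "signed (p * q) (cyclic_sum (marked f) (g \<smile> h)) - signed q (g \<smile> cyclic_sum (marked f) h)
     + signed q (insertion 0 f g \<smile> h) = \<delta> (- ?k)"
    by (auto simp: fun_eq_iff differential_minus differential_cyclic_sum_insertion[OF f g h] signed_def)
qed

text \<open>
  The case \<open>h = 1\<close> of the preceding lemma.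
\<close>

lemma cyclic_sum_coboundary:
  assumes f: "f \<in> cocycles" "parity p f" and g: "g \<in> cocycles" "parity q g"
  shows "signed (p * q) (cyclic_sum (marked f) g) - signed q (g \<smile> Delta f)
      + signed q (insertion 0 f g) \<in> coboundaries"
  using cyclic_sum_cup_coboundary[OF f g degree_zero_cocycle[of 1]]
  by (simp add: cup_unit_right Delta_eq cocycles_cochain f)

text \<open>
  The homotopy for \<open>B(f, g \<smile> h)\<close> is used in two ways: with the pair \<open>(g, h)\<close>, and with the pair
  \<open>(g \<smile> h, 1)\<close>. In the first formula \<open>B(f, h)\<close> is replaced with the help of the pair \<open>(h, 1)\<close>.
  Then all terms with \<open>\<Delta> f\<close> cancel.
\<close>

lemma insertion_cup_coboundary:
  assumes f: "f \<in> cocycles" "parity p f" and g: "g \<in> cocycles" "parity q g" and h: "h \<in> cocycles"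
      "parity r h"
  shows "insertion 0 f (g \<smile> h) - g \<smile> insertion 0 f h
      - signed ((p + 1) * r) (insertion 0 f g \<smile> h) \<in> coboundaries"
proof -
  note 1 = cyclic_sum_cup_coboundary[OF f g h(1)]
  note 2 = cyclic_sum_coboundary[OF f cup_cocycle[OF g(1) h(1)] parity_cup[OF g(2) h(2)]]
  note 3 = cup_coboundary_right[OF g(1) cyclic_sum_coboundary[OF f h]]
  have "insertion 0 f (g \<smile> h) - g \<smile> insertion 0 f h - signed ((p + 1) * r) (insertion 0 f g \<smile> h) =
    signed (q + r) (signed (p * (q + r)) (cyclic_sum (marked f) (g \<smile> h)) - signed (q
        + r) ((g \<smile> h) \<smile> Delta f) + signed (q + r) (insertion 0 f (g \<smile> h)))
    - signed (p * r + q + r) (signed (p * q) (cyclic_sum (marked f) (g \<smile> h))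
      - signed q (g \<smile> cyclic_sum (marked f) h)
     + signed q (insertion 0 f g \<smile> h))
    - signed r (g \<smile> (signed (p * r) (cyclic_sum (marked f) h) - signed r (h \<smile> Delta f)
      + signed r (insertion 0 f h)))"
    unfolding cup_add_right cup_diff_right cup_signed_right cup_assoc
    by (cases "even p"; cases "even q"; cases "even r") (simp_all add: signed_def algebra_simps)
  also have "\<dots> \<in> coboundaries"
    by (intro coboundaries_diff coboundaries_signed 1 2 3)
  finally show ?thesis .
qed

text \<open>
  The Gerstenhaber bracket up to sign conventions, for \<open>f\<close> and \<open>g\<close> of parities \<open>p\<close> and \<open>q\<close>.
\<close>

definition bracket :: "nat \<Rightarrow> nat \<Rightarrow> 'a cochain \<Rightarrow> 'a cochain \<Rightarrow> 'a cochain" where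
  "bracket p q f g = signed ((p + 1) * q) (insertion 0 f g) + signed p (insertion 0 g f)"

lemma Delta_cup_coboundary:
  assumes f: "f \<in> cocycles" "parity p f" and g: "g \<in> cocycles" "parity q g"
  shows "Delta (f \<smile> g) - Delta f \<smile> g - signed p (f \<smile> Delta g) + bracket p q f g \<in> coboundaries"
proof -
  note 1 = cyclic_sum_coboundary[OF f g] and 2 = cyclic_sum_coboundary[OF g f]
  note 3 = cup_commute_coboundary[OF Delta_cocycle[OF f(1)] parity_Delta[OF cocycles_cochain[OF f(1)]
      f(2)] g]
  have "Delta (f \<smile> g) - Delta f \<smile> g - signed p (f \<smile> Delta g) + bracket p q f g =
    signed (p * q) (signed (p * q) (cyclic_sum (marked f) g) - signed q (g \<smile> Delta f)
        + signed q (insertion 0 f g))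
    + (signed (q * p) (cyclic_sum (marked g) f) - signed p (f \<smile> Delta g) + signed p (insertion 0 g f))
    - (Delta f \<smile> g - signed ((p + 1) * q) (g \<smile> Delta f))"
    unfolding Delta_cup[OF cocycles_cochain[OF f(1)] f(2) cocycles_cochain[OF g(1)] g(2)] bracket_def
    by (cases "even p"; cases "even q") (simp_all add: signed_def algebra_simps)
  also have "\<dots> \<in> coboundaries"
    by (intro coboundaries_diff coboundaries_add coboundaries_signed 1 2 3)
  finally show ?thesis .
qed

text \<open>
  Insertion into \<open>f\<close> is a derivation up to coboundaries, insertion of \<open>f\<close> is one exactly.
\<close>

lemma bracket_cup_coboundary:
  assumes f: "f \<in> cocycles" "parity p f" and g: "g \<in> cocycles" "parity q g" and h: "h \<in> cocycles"
      "parity r h"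
  shows "bracket p (q + r) f (g \<smile> h) - bracket p q f g \<smile> h
      - signed ((p + 1) * q) (g \<smile> bracket p r f h) \<in> coboundaries"
proof -
  have "bracket p (q + r) f (g \<smile> h) - bracket p q f g \<smile> h - signed ((p + 1) * q) (g \<smile> bracket p r f h) =
    signed ((p + 1) * (q + r)) (insertion 0 f (g \<smile> h) - g \<smile> insertion 0 f h
        - signed ((p + 1) * r) (insertion 0 f g \<smile> h))"
    unfolding bracket_def insertion_cup[OF f(2) g(2) cocycles_cochain[OF h(1)]] cup_add_left
        cup_add_right cup_signed_left cup_signed_right
    by (cases "even p"; cases "even q"; cases "even r") (simp_all add: signed_def algebra_simps)
  also have "\<dots> \<in> coboundaries"
    using insertion_cup_coboundary[OF f g h] by (rule coboundaries_signed)
  finally show ?thesis .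
qed

text \<open>
  \<open>\<Delta> (f \<smile> (g \<smile> h))\<close> is expressed by the bracket of \<open>f\<close> with \<open>g \<smile> h\<close>, this by the brackets of \<open>f\<close>
  with \<open>g\<close> and with \<open>h\<close>, and these again by \<open>\<Delta>\<close>. It remains to commute \<open>g\<close> with \<open>\<Delta> (f \<smile> h)\<close>, \<open>\<Delta> f\<close>
  and \<open>f\<close>.
\<close>

lemma BV_coboundary_parity:
  assumes f: "f \<in> cocycles" "parity p f" and g: "g \<in> cocycles" "parity q g" and h: "h \<in> cocycles"
      "parity r h"
  shows "Delta (f \<smile> g \<smile> h) - Delta (f \<smile> g) \<smile> h - signed p (f \<smile> Delta (g \<smile> h))
     - signed (q * r) (Delta (f \<smile> h) \<smile> g)
     + Delta f \<smile> g \<smile> h + signed p (f \<smile> Delta g \<smile> h) + signed (p + q) (f \<smile> g \<smile> Delta h) \<in> coboundaries"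
    (is "?X \<in> _")
proof -
  note fc = cocycles_cochain[OF f(1)]
  note 1 = Delta_cup_coboundary[OF f cup_cocycle[OF g(1) h(1)] parity_cup[OF g(2) h(2)]]
  note 2 = bracket_cup_coboundary[OF f g h]
  note 3 = cup_coboundary_left[OF Delta_cup_coboundary[OF f g] h(1)]
  note 4 = cup_coboundary_right[OF g(1) Delta_cup_coboundary[OF f h]]
  note 5 = cup_commute_coboundary[OF g Delta_cocycle[OF cup_cocycle[OF f(1) h(1)]]
      parity_Delta[OF cup_cochain[OF fc cocycles_cochain[OF h(1)]] parity_cup[OF f(2) h(2)]]]
  note 6 = cup_coboundary_left[OF cup_commute_coboundary[OF g Delta_cocycle[OF f(1)] parity_Delta[OF
      fc f(2)]] h(1)]
  note 7 = cup_coboundary_left[OF cup_commute_coboundary[OF g f] Delta_cocycle[OF h(1)]]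
  have "?X = (Delta (f \<smile> (g \<smile> h)) - Delta f \<smile> (g \<smile> h) - signed p (f \<smile> Delta (g \<smile> h)) + bracket p (q
      + r) f (g \<smile> h))
    - (bracket p (q + r) f (g \<smile> h) - bracket p q f g \<smile> h - signed ((p + 1) * q) (g \<smile> bracket p r f h))
    - (Delta (f \<smile> g) - Delta f \<smile> g - signed p (f \<smile> Delta g) + bracket p q f g) \<smile> h
    - signed ((p + 1) * q) (g \<smile> (Delta (f \<smile> h) - Delta f \<smile> h - signed p (f \<smile> Delta h)
      + bracket p r f h))
    + signed ((p + 1) * q) (g \<smile> Delta (f \<smile> h) - signed (q * (p + r + 1)) (Delta (f \<smile> h) \<smile> g))
    - signed ((p + 1) * q) ((g \<smile> Delta f - signed (q * (p + 1)) (Delta f \<smile> g)) \<smile> h)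
    - signed ((p + 1) * q + p) ((g \<smile> f - signed (q * p) (f \<smile> g)) \<smile> Delta h)"
    unfolding cup_add_right cup_diff_right cup_signed_right cup_add_left cup_diff_left cup_signed_left
        cup_assoc
    by (cases "even p"; cases "even q"; cases "even r") (simp_all add: signed_def algebra_simps)
  also have "\<dots> \<in> coboundaries"
    by (intro coboundaries_diff coboundaries_add coboundaries_signed 1 2 3 4 5 6 7)
  finally show ?thesis .
qed


text \<open>
  The difference of the two sides of the Batalin-Vilkovisky relation. The Koszul signs are written
  with \<open>degree_sign\<close> and the even and odd parts, which makes the expression trilinear.
\<close>

definition BV_defect :: "'a cochain \<Rightarrow> 'a cochain \<Rightarrow> 'a cochain \<Rightarrow> 'a cochain" where
  "BV_defect f g h = Delta (f \<smile> g \<smile> h) - Delta (f \<smile> g) \<smile> h - degree_sign f \<smile> Delta (g \<smile> h)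
     - (Delta (f \<smile> even_part h) \<smile> g + Delta (f \<smile> odd_part h) \<smile> degree_sign g)
     + Delta f \<smile> g \<smile> h + degree_sign f \<smile> Delta g \<smile> h + degree_sign f \<smile> degree_sign g \<smile> Delta h"

lemma degree_sign_parity: "parity p f \<Longrightarrow> degree_sign f = signed p f"
proof
  fix as assume "parity p f"
  then show "degree_sign f as = signed p f as"
    using parityD[of p f as] by (auto simp: degree_sign_def signed_def)
qed

lemma parts_parity:
  assumes "parity p f" "p = 0 \<or> p = 1"
  shows "even_part f = (if p = 0 then f else 0)" "odd_part f = (if p = 0 then 0 else f)"
  using assms by (auto simp: fun_eq_iff even_part_def odd_part_def parity_def)

lemma degree_sign_add: "degree_sign (f + g) = degree_sign f + degree_sign g"
  by (simp add: fun_eq_iff degree_sign_def signed_add)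

lemma even_part_add: "even_part (f + g) = even_part f + even_part g"
  and odd_part_add: "odd_part (f + g) = odd_part f + odd_part g"
  by (simp_all add: fun_eq_iff even_part_def odd_part_def)

lemma even_part_cocycle: "f \<in> cocycles \<Longrightarrow> even_part f \<in> cocycles"
  and odd_part_cocycle: "f \<in> cocycles \<Longrightarrow> odd_part f \<in> cocycles"
  by (auto simp: cocycles_def even_part_cochain odd_part_cochain differential_even_part
      differential_odd_part fun_eq_iff even_part_def odd_part_def)

lemma BV_defect_coboundary:
  assumes f: "f \<in> cocycles" and g: "g \<in> cocycles" and h: "h \<in> cocycles"
  shows "BV_defect f g h \<in> coboundaries"
proof -
  \<comment> \<open>For arguments of pure parity the parts and \<open>degree_sign\<close> become signs; the general case follows by
    trilinearity.\<close>
  have *: "BV_defect f g h \<in> coboundaries"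
    if "f \<in> cocycles" "parity p f" "g \<in> cocycles" "parity q g" "h \<in> cocycles" "parity r h"
      "r = 0 \<or> r = 1" for f g h p q r
  proof -
    have D0: "Delta 0 = 0"
      by (simp add: Delta_eq fun_cochain cyclic_sum_zero)
    show ?thesis
      using BV_coboundary_parity[OF that(1-6)] that(7)
      by (auto simp: BV_defect_def degree_sign_parity[OF that(2)] degree_sign_parity[OF that(4)]
          parts_parity[OF that(6,7)]
          cup_zero_right cup_zero_left D0 cup_signed_left cup_signed_right signed_signed
              add.commute[of q p])
  qed
  have add: "BV_defect (f1 + f2) (g1 + g2) (h1 + h2) =
      BV_defect f1 g1 h1 + BV_defect f1 g1 h2 + BV_defect f1 g2 h1 + BV_defect f1 g2 h2
      + BV_defect f2 g1 h1 + BV_defect f2 g1 h2 + BV_defect f2 g2 h1 + BV_defect f2 g2 h2"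
    if "f1 \<in> cochains" "f2 \<in> cochains" "g1 \<in> cochains" "g2 \<in> cochains" "h1 \<in> cochains" "h2 \<in> cochains"
    for f1 f2 g1 g2 h1 h2
    unfolding BV_defect_def degree_sign_add even_part_add odd_part_add
    by (simp add: cup_add_left cup_add_right Delta_add cup_cochain fun_cochain even_part_cochain
        odd_part_cochain that algebra_simps)
  note parts = even_part_cocycle odd_part_cocycle
  have "BV_defect (even_part f + odd_part f) (even_part g + odd_part g) (even_part h
      + odd_part h) \<in> coboundaries"
    using parts[OF f] parts[OF g] parts[OF h] parity_parts
    by (subst add) (auto intro!: coboundaries_add * cocycles_cochain)
  then show ?thesis by (simp only: parts_add)
qed

lemma cup_commute_swap:
  assumes f: "f \<in> cocycles" and g: "g \<in> cocycles"
  shows "even_part g \<smile> f + odd_part g \<smile> degree_sign f - f \<smile> g \<in> coboundaries"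
proof -
  let ?d = "\<lambda>f g. even_part g \<smile> f + odd_part g \<smile> degree_sign f - f \<smile> g"
  have *: "?d f g \<in> coboundaries"
    if "f \<in> cocycles" "parity p f" "g \<in> cocycles" "parity q g" "q = 0 \<or> q = 1" for f g p q
    using cup_commute_coboundary[OF that(3,4) that(1,2)] that(5)
    by (auto simp: degree_sign_parity[OF that(2)] parts_parity[OF that(4,5)]
        cup_zero_right cup_zero_left cup_signed_left cup_signed_right
        intro: coboundaries_minus dest: coboundaries_signed[where n
            = p] simp: signed_diff signed_signed)
      (auto simp: signed_def split: if_splits dest: coboundaries_minus)
  have add: "?d (f1 + f2) (g1 + g2) = ?d f1 g1 + ?d f1 g2 + ?d f2 g1 + ?d f2 g2" for f1 f2 g1 g2
    by (simp add: degree_sign_add even_part_add odd_part_add cup_add_left cup_add_right algebra_simps)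
  note parts = even_part_cocycle odd_part_cocycle
  have "?d (even_part f + odd_part f) (even_part g + odd_part g) \<in> coboundaries"
    unfolding add
    using parts[OF f] parts[OF g] parity_parts
    by (intro coboundaries_add *) auto
  then show ?thesis by (simp only: parts_add)
qed


section \<open>The Casimir element and the Euler element\<close>

text \<open>
  The scaling \<open>sv\<close> of the target is a parameter, since the Casimir identities are applied to maps
  into the algebra and into spaces of tensors.
\<close>

definition bilinear :: "('k \<Rightarrow> 'v \<Rightarrow> 'v) \<Rightarrow> ('a \<Rightarrow> 'a \<Rightarrow> 'v::ab_group_add) \<Rightarrow> bool" where
  "bilinear sv P \<longleftrightarrow>
     (\<forall>x y z. P (x + y) z = P x z + P y z) \<and> (\<forall>x y z. P x (y + z) = P x y + P x z) \<and>
     (\<forall>c x y. P (c *s x) y = sv c (P x y)) \<and> (\<forall>c x y. P x (c *s y) = sv c (P x y))"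

lemma additive_sum:
  assumes "\<And>x y. L (x + y) = L x + (L y :: 'v::ab_group_add)"
  shows "L (\<Sum>i\<in>I. x i :: 'a) = (\<Sum>i\<in>I. L (x i))"
proof -
  have "L 0 = 0" using assms[of 0 0] by simp
  then show ?thesis
    by (induction I rule: infinite_finite_induct) (simp_all add: assms)
qed

lemma bilinear_sum:
  assumes "bilinear sv P"
  shows "P (\<Sum>i\<in>I. c i *s x i) y = (\<Sum>i\<in>I. sv (c i) (P (x i) y))"
    and "P y (\<Sum>i\<in>I. c i *s x i) = (\<Sum>i\<in>I. sv (c i) (P y (x i)))"
proof -
  show "P (\<Sum>i\<in>I. c i *s x i) y = (\<Sum>i\<in>I. sv (c i) (P (x i) y))"
    using assms by (subst additive_sum[of "\<lambda>x. P x y"]) (simp_all add: bilinear_def)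
  show "P y (\<Sum>i\<in>I. c i *s x i) = (\<Sum>i\<in>I. sv (c i) (P y (x i)))"
    using assms by (subst additive_sum[of "P y"]) (simp_all add: bilinear_def)
qed

text \<open>
  Invariance of \<open>\<Sum> e\<^sup>i \<otimes> e\<^sub>i\<close>: after expanding both sides in the bases, the coefficients are
  \<open>\<langle>e\<^sup>i a, e\<^sub>j\<rangle>\<close> and \<open>\<langle>a e\<^sub>j, e\<^sup>i\<rangle>\<close>.
\<close>

lemma casimir_mult:
  assumes "bilinear sv P"
  shows "(\<Sum>e\<in>Basis. P (dual_basis e * a) e) = (\<Sum>e\<in>Basis. P (dual_basis e) (a * e))"
proof -
  have "(\<Sum>e\<in>Basis. P (dual_basis e * a) e) =
      (\<Sum>e\<in>Basis. \<Sum>d\<in>Basis. sv \<langle>dual_basis e * a, d\<rangle> (P (dual_basis d) e))"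
    by (simp add: bilinear_sum(1)[OF assms, symmetric] expand_dual_basis)
  also have "\<dots> = (\<Sum>d\<in>Basis. \<Sum>e\<in>Basis. sv \<langle>a * d, dual_basis e\<rangle> (P (dual_basis d) e))"
  proof -
    have "\<langle>dual_basis e * a, d\<rangle> = \<langle>a * d, dual_basis e\<rangle>" for d e
      using invariant[of "dual_basis e" a d] ip_commute[of "dual_basis e"] by simp
    then show ?thesis by (subst sum.swap) simp
  qed
  also have "\<dots> = (\<Sum>d\<in>Basis. P (dual_basis d) (a * d))"
    by (simp add: bilinear_sum(2)[OF assms, symmetric] expand_basis)
  finally show ?thesis .
qed

lemma casimir_commute:
  assumes "bilinear sv P"
  shows "(\<Sum>e\<in>Basis. P e (dual_basis e)) = (\<Sum>e\<in>Basis. P (dual_basis e) e)"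
proof -
  have "(\<Sum>e\<in>Basis. P e (dual_basis e)) = (\<Sum>e\<in>Basis. \<Sum>d\<in>Basis. sv \<langle>e, d\<rangle> (P (dual_basis d) (dual_basis
      e)))"
    by (simp add: bilinear_sum(1)[OF assms, symmetric] expand_dual_basis)
  also have "\<dots> = (\<Sum>d\<in>Basis. \<Sum>e\<in>Basis. sv \<langle>d, e\<rangle> (P (dual_basis d) (dual_basis e)))"
    by (subst sum.swap) (simp add: ip_commute)
  also have "\<dots> = (\<Sum>d\<in>Basis. P (dual_basis d) d)"
    by (simp add: bilinear_sum(2)[OF assms, symmetric] expand_dual_basis)
  finally show ?thesis .
qed

definition euler :: 'a where
  "euler = (\<Sum>e\<in>Basis. e * dual_basis e)"

text \<open>
  Consider \<open>k as = \<Sum>\<^sub>e f (as @ [e]) e\<^sup>*\<close>. In \<open>\<Sum>\<^sub>e \<delta> f (as @ [e]) e\<^sup>* = 0\<close> the last outer term is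
  \<open>\<plusminus> \<chi> f as\<close>, and the term that merges the last entry \<open>a\<close> of \<open>as\<close> with \<open>e\<close> equals
  \<open>k (butlast as) a\<close> by invariance of the Casimir element. So the other terms form \<open>\<delta> k\<close>. For
  \<open>as = []\<close> there is no such entry \<open>a\<close>, and \<open>\<chi> f []\<close> survives.
\<close>

lemma euler_homotopy:
  assumes f: "f \<in> cocycles"
  obtains h where "h \<in> cochains" "\<And>as. \<delta> h as = (if as = [] then 0 else euler * f as)"
proof
  note fc = cocycles_cochain[OF f]
  define k where "k as = (\<Sum>e\<in>Basis. f (as @ [e]) * dual_basis e)" for as
  have k: "k \<in> cochains"
    unfolding k_def
    by (rule cochainsI)
      (simp_all add: cochain_add[OF fc] cochain_scale[OF fc] cochain_one[OF fc] distrib_right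
          sum.distrib
         scale_mult_left scale_sum_right)
  \<comment> \<open>The differential of \<open>k\<close> carries a sign that depends on the degree; \<open>degree_sign\<close> removes it.\<close>
  then show "- degree_sign k \<in> cochains"
    by (intro cochain_intros fun_cochain)
  show "\<delta> (- degree_sign k) as = (if as = [] then 0 else euler * f as)" for as
  proof (cases as rule: rev_cases)
    case (snoc ys a)
    have e: "\<delta> f (as @ [e]) =
        hd_case (\<lambda>b xs. b * f (xs @ [e])) as + merge_sum (\<lambda>xs. f (xs @ [e])) as
        + signed (length as) (f (ys @ [a * e])) - signed (length as) (f as * e)" for e
    proof -
      have "hd_case (\<lambda>b xs. b * f xs) (as @ [e]) = hd_case (\<lambda>b xs. b * f (xs @ [e])) as"
        by (cases ys) (simp_all add: snoc)
      then show ?thesis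
        unfolding differential_eq merge_sum_append last_case_simps
        by (simp add: snoc signed_minus)
    qed
    have c: "(\<Sum>e\<in>Basis. f (ys @ [a * e]) * dual_basis e) = k ys * a"
    proof -
      have b: "bilinear scl (\<lambda>x y. f (ys @ [y]) * x)"
        by (auto simp: bilinear_def distrib_left distrib_right cochain_add[OF fc] cochain_scale[OF fc]
            scale_mult_left scale_mult_right)
      show ?thesis
        using casimir_mult[OF b, of a] by (simp add: k_def sum_distrib_right mult.assoc)
    qed
    have "0 = (\<Sum>e\<in>Basis. \<delta> f (as @ [e]) * dual_basis e)"
      by (simp add: cocycle_differential[OF f])
    also have "\<dots> = hd_case (\<lambda>b xs. b * k xs) as + merge_sum k as
        + signed (length as) (k ys * a) - signed (length as) (euler * f as)"
    proof -
      have "(\<Sum>e\<in>Basis. hd_case (\<lambda>b xs. b * f (xs @ [e])) as * dual_basis e)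
          = hd_case (\<lambda>b xs. b * k xs) as"
        by (simp add: hd_case_def k_def sum_distrib_left mult.assoc)
      moreover have "(\<Sum>e\<in>Basis. merge_sum (\<lambda>xs. f (xs @ [e])) as * dual_basis e) = merge_sum k as"
      proof -
        have "merge_sum (\<lambda>xs. \<Sum>e\<in>I. X e xs) zs = (\<Sum>e\<in>I. merge_sum (X e) zs)" for X ::
            "'a \<Rightarrow> 'a cochain" and I zs
          by (induction I rule: infinite_finite_induct) (simp_all add: merge_sum_add merge_sum_zero)
        moreover have "merge_sum (\<lambda>xs. f (xs @ [e]) * d) as = merge_sum (\<lambda>xs. f (xs @ [e])) as * d"
            for e d
          by (rule merge_sum_additive) (rule distrib_right)
        ultimately show ?thesis by (simp add: k_def[abs_def])
      qed
      moreover have "(\<Sum>e\<in>Basis. signed (length as) (f (ys @ [a * e])) * dual_basis e)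
          = signed (length as) (k ys * a)"
        by (simp add: c[symmetric] signed_sum signed_mult_left)
      moreover have "(\<Sum>e\<in>Basis. signed (length as) (f as * e) * dual_basis e)
          = signed (length as) (euler * f as)"
        by (simp only: signed_mult_left mult.assoc signed_sum[symmetric] sum_distrib_left[symmetric])
          (simp only: euler_def mult.commute)
      ultimately show ?thesis
        unfolding e diff_conv_add_uminus distrib_right sum.distrib mult_minus_left sum_negf by simp
    qed
    finally have "\<delta> k as = signed (length as) (euler * f as)"
      by (simp add: differential_eq snoc eq_neg_iff_add_eq_0)
    then show ?thesis
      using snoc by (simp add: differential_minus differential_degree_sign degree_sign_def signed_def)
  qed (simp add: differential_def)
qed

text \<open>
  In degree 1 the homotopy has the form \<open>a * h [] - h [] * a = 0\<close>.
\<close>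

lemma euler_derivation:
  assumes f: "f \<in> cocycles"
  shows "euler * f [a] = 0"
proof -
  obtain h where h: "\<And>as. \<delta> h as = (if as = [] then 0 else euler * f as)"
    using euler_homotopy[OF f] by metis
  have "\<delta> h [a] = 0" by (simp add: differential_def mult.commute)
  then show ?thesis using h[of "[a]"] by simp
qed

lemma euler_euler_Delta:
  assumes f: "f \<in> cocycles"
  shows "euler * euler * Delta f [] = 0"
proof (rule ip_eqI)
  fix b
  note fc = cocycles_cochain[OF f]
  have lin: "linear_endo (\<lambda>b. f [b])"
    using linear_endo_cochain[OF fc, of "[]" "[]" 1] by simp
  have "\<delta> f [euler, euler * b] = 0" by (simp add: cocycle_differential[OF f])
  then have "f [euler * (euler * b)] = euler * f [euler * b] + euler * f [euler] * b"
    by (simp add: differential_def numeral_2_eq_2 algebra_simps)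
  then have d: "f [euler * euler * b] = 0"
    by (simp add: euler_derivation[OF f] mult.assoc)
  have "\<langle>euler * euler * Delta f [], b\<rangle> = \<langle>f [euler * euler * b], 1\<rangle>"
    by (simp only: ip_mult_left Delta_split[OF fc] split_sum_Nil) (simp add: ip_repr[OF lin])
  then show "\<langle>euler * euler * Delta f [], b\<rangle> = \<langle>0, b\<rangle>" by (simp add: d)
qed

lemma mult_cocycle: "f \<in> cocycles \<Longrightarrow> (\<lambda>as. c * f as) \<in> cocycles"
  by (auto simp: cocycles_def mult_left_cochain fun_eq_iff differential_mult)

lemma scale_cocycle: "f \<in> cocycles \<Longrightarrow> (\<lambda>as. c *s f as) \<in> cocycles"
  by (auto simp: cocycles_def scale_cochain fun_eq_iff differential_scale)

lemma add_cocycle: "f \<in> cocycles \<Longrightarrow> g \<in> cocycles \<Longrightarrow> f + g \<in> cocycles"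
  by (simp add: cocycles_def fun_cochain differential_add)

lemma zero_cocycle: "0 \<in> cocycles"
  by (simp add: cocycles_def fun_cochain differential_zero)

lemma diff_cocycle: "f \<in> cocycles \<Longrightarrow> g \<in> cocycles \<Longrightarrow> f - g \<in> cocycles"
  by (simp add: cocycles_def fun_cochain differential_diff)

lemma euler_coboundary:
  assumes f: "f \<in> cocycles"
  shows "(\<lambda>as. c * euler * f as) - degree_zero (c * euler * f []) \<in> coboundaries"
proof -
  obtain h where h: "h \<in> cochains" "\<And>as. \<delta> h as = (if as = [] then 0 else euler * f as)"
    using euler_homotopy[OF f] by metis
  show ?thesis
    by (rule coboundaryI[of "\<lambda>as. c * h as"])
      (auto simp: mult_left_cochain h differential_mult fun_eq_iff degree_zero_def mult.assoc)
qed

text \<open>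
  By nondegeneracy the argument \<open>y\<close> can be removed from the defining equation.
\<close>

lemma represents_coproduct_iff:
  "represents_coproduct ps f \<longleftrightarrow>
     (\<forall>(f', f'')\<in>set ps. f' \<in> cocycles \<and> homogeneous 0 f' \<and> f'' \<in> cocycles) \<and>
     (\<forall>x as. (\<Sum>(f', f'')\<leftarrow>ps. \<langle>f' [], x\<rangle> *s f'' as) = x * euler * f as)"
proof -
  have 1: "(\<Sum>e\<in>Basis. \<langle>f as, y * e * x * dual_basis e\<rangle>) = \<langle>x * euler * f as, y\<rangle>" for x y as
  proof -
    have "\<langle>x * euler * f as, y\<rangle> = \<langle>f as, y * x * euler\<rangle>"
      using ip_mult_left[of "x * euler" "f as" y] by (simp add: mult_ac)
    also have "y * x * euler = (\<Sum>e\<in>Basis. y * e * x * dual_basis e)"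
      by (simp add: euler_def sum_distrib_left mult_ac)
    also have "\<langle>f as, \<Sum>e\<in>Basis. y * e * x * dual_basis e\<rangle>
        = (\<Sum>e\<in>Basis. \<langle>f as, y * e * x * dual_basis e\<rangle>)"
      by (subst (1 2) ip_commute) (rule ip_sum)
    finally show ?thesis ..
  qed
  have 2: "(\<Sum>(f', f'')\<leftarrow>ps. \<langle>f' [], x\<rangle> * \<langle>f'' as, y\<rangle>) = \<langle>\<Sum>(f', f'')\<leftarrow>ps. \<langle>f' [], x\<rangle> *s f'' as, y\<rangle>"
      for x y as
    by (induction ps) (auto simp: ip_add_left ip_scale_left)
  show ?thesis
    unfolding represents_coproduct_def 1 2 by (auto intro: ip_eqI)
qed

lemma coproduct_representative:
  assumes f: "f \<in> cocycles"
  obtains ps where "represents_coproduct ps f"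
    "\<And>t. (\<Sum>(f', f'')\<leftarrow>ps. t f' f'') = (\<Sum>e\<in>Basis. t (degree_zero (dual_basis e))
      (\<lambda>as. e * euler * f as) :: 'v::ab_group_add)"
proof -
  obtain es where es: "set es = Basis" "distinct es"
    using finite_distinct_list[OF finite_Basis] by blast
  define ps where "ps = map (\<lambda>e. (degree_zero (dual_basis e), \<lambda>as. e * euler * f as)) es"
  have sum: "(\<Sum>(f', f'')\<leftarrow>ps. t f' f'') = (\<Sum>e\<in>Basis. t (degree_zero (dual_basis e))
      (\<lambda>as. e * euler * f as))"
    for t :: "'a cochain \<Rightarrow> 'a cochain \<Rightarrow> 'w::ab_group_add"
    unfolding ps_def map_map comp_def by (simp add: sum_list_distinct_conv_sum_set es)
  have "represents_coproduct ps f"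
    unfolding represents_coproduct_iff sum
  proof (intro conjI allI)
    show "\<forall>(f', f'')\<in>set ps. f' \<in> cocycles \<and> homogeneous 0 f' \<and> f'' \<in> cocycles"
      by (auto simp: ps_def degree_zero_cocycle homogeneous_def degree_zero_def mult_cocycle f)
    fix x as
    have "(\<Sum>e\<in>Basis. \<langle>degree_zero (dual_basis e) [], x\<rangle> *s (e * euler * f as)) =
        (\<Sum>e\<in>Basis. \<langle>x, dual_basis e\<rangle> *s e) * (euler * f as)"
      by (simp add: degree_zero_def ip_commute sum_distrib_right scale_mult_left mult.assoc)
    then show "(\<Sum>e\<in>Basis. \<langle>degree_zero (dual_basis e) [], x\<rangle> *s (e * euler * f as)) = x * euler * f as"
      by (simp add: expand_basis mult.assoc)
  qed
  then show ?thesis using sum that by blast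
qed

section \<open>Cohomology classes\<close>

lemma equiv_cohomologous: "equiv cocycles cohomologous"
proof (rule equivI)
  show "cohomologous \<subseteq> cocycles \<times> cocycles" by (auto simp: cohomologous_def)
  show "refl_on cocycles cohomologous"
    by (auto simp: refl_on_def cohomologous_def coboundaries_zero)
  show "sym cohomologous"
  proof (rule symI)
    fix f g assume "(f, g) \<in> cohomologous"
    then show "(g, f) \<in> cohomologous"
      using coboundaries_minus[of "f - g"] by (simp add: cohomologous_def)
  qed
  show "trans cohomologous"
  proof (rule transI)
    fix f g h assume "(f, g) \<in> cohomologous" "(g, h) \<in> cohomologous"
    then show "(f, h) \<in> cohomologous"
      using coboundaries_add[of "f - g" "g - h"] by (simp add: cohomologous_def)
  qed
qed

lemma cls_eqI: "f \<in> cocycles \<Longrightarrow> g \<in> cocycles \<Longrightarrow> f - g \<in> coboundaries \<Longrightarrow> cls f = cls g"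
  unfolding cls_def by (rule equiv_class_eq[OF equiv_cohomologous]) (simp add: cohomologous_def)

lemma cls_in_HH: "f \<in> cocycles \<Longrightarrow> cls f \<in> HH"
  unfolding cls_def HH_def by (rule quotientI)

lemma HH_cls:
  assumes "X \<in> HH"
  obtains f where "f \<in> cocycles" "X = cls f"
  using assms unfolding HH_def cls_def by (rule quotientE) (use that in \<open>auto simp: cls_def\<close>)

lemma mem_cls: "g \<in> cls f \<longleftrightarrow> f \<in> cocycles \<and> g \<in> cocycles \<and> f - g \<in> coboundaries"
  by (simp add: cls_def cohomologous_def)

lemma respectsI:
  assumes "\<And>f. f \<in> cocycles \<Longrightarrow> F f \<in> cocycles"
    and "\<And>f g. f \<in> cocycles \<Longrightarrow> g \<in> cocycles \<Longrightarrow> f - g \<in> coboundaries \<Longrightarrow> F f - F g \<in> coboundaries"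
  shows "(\<lambda>f. cls (F f)) respects cohomologous"
  by (rule congruentI, rule cls_eqI) (use assms in \<open>auto simp: cohomologous_def\<close>)

lemma induced_cls:
  assumes "(\<lambda>f. cls (F f)) respects cohomologous" "f \<in> cocycles"
  shows "induced F (cls f) = cls (F f)"
  unfolding induced_def cls_def[of f]
  by (rule UN_equiv_class[OF equiv_cohomologous assms])

text \<open>
  \<open>F\<close> commutes with the differential up to the operations \<open>G\<close> and \<open>F'\<close>, which in the applications
  are \<open>F\<close> itself, \<open>-F\<close>, or the other one of the two projections to the even and the odd part.
\<close>

lemma respects_linear:
  assumes "\<And>f g. F (f - g) = F f - F g" "\<And>f. f \<in> cochains \<Longrightarrow> F f \<in> cochains"
    and "\<And>f. \<delta> (F f) = G (\<delta> f)" "\<And>f. F (\<delta> f) = \<delta> (F' f)" "G 0 = 0"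
    "\<And>f. f \<in> cochains \<Longrightarrow> F' f \<in> cochains"
  shows "F ` cochains \<subseteq> cochains" "F ` cocycles \<subseteq> cocycles" "(\<lambda>f. cls (F f)) respects cohomologous"
proof -
  show "F ` cochains \<subseteq> cochains" "F ` cocycles \<subseteq> cocycles"
    using assms by (auto simp: cocycles_def)
  show "(\<lambda>f. cls (F f)) respects cohomologous"
  proof (rule respectsI)
    fix f g assume "f - g \<in> coboundaries"
    then show "F f - F g \<in> coboundaries"
      unfolding assms(1)[symmetric] coboundaries_def using assms(4,6) by auto
  qed (use assms in \<open>auto simp: cocycles_def\<close>)
qed

lemma
  shows reversal_respects: "(\<lambda>f. cls (reversal f)) respects cohomologous"
    and degree_sign_respects: "(\<lambda>f. cls (degree_sign f)) respects cohomologous"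
    and even_part_respects: "(\<lambda>f. cls (even_part f)) respects cohomologous"
    and odd_part_respects: "(\<lambda>f. cls (odd_part f)) respects cohomologous"
    and reversal_cocycle: "f \<in> cocycles \<Longrightarrow> reversal f \<in> cocycles"
proof -
  have *: "reversal (f - g) = reversal f - reversal g" "reversal 0 = 0" for f g
    by (simp_all add: fun_eq_iff reversal_eq signed_diff)
  show "(\<lambda>f. cls (reversal f)) respects cohomologous"
    by (rule respects_linear[where G = reversal and F' = reversal])
      (simp_all add: * reversal_cochain differential_reversal)
  show "f \<in> cocycles \<Longrightarrow> reversal f \<in> cocycles"
    by (simp add: cocycles_def reversal_cochain differential_reversal *)
  show "(\<lambda>f. cls (degree_sign f)) respects cohomologous"
    by (rule respects_linear[where G = "\<lambda>f. - degree_sign f" and F' = "\<lambda>f. - degree_sign f"])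
      (simp_all add: degree_sign_cochain fun_cochain differential_minus differential_degree_sign,
        simp_all add: fun_eq_iff degree_sign_def signed_diff)
  show "(\<lambda>f. cls (even_part f)) respects cohomologous"
    by (rule respects_linear[where G = odd_part and F' = odd_part])
      (simp_all add: even_part_cochain odd_part_cochain differential_even_part differential_odd_part,
        simp_all add: fun_eq_iff even_part_def odd_part_def)
  show "(\<lambda>f. cls (odd_part f)) respects cohomologous"
    by (rule respects_linear[where G = even_part and F' = even_part])
      (simp_all add: even_part_cochain odd_part_cochain differential_even_part differential_odd_part,
        simp_all add: fun_eq_iff even_part_def odd_part_def)
qed

lemma Delta_respects: "(\<lambda>f. cls (Delta f)) respects cohomologous"
  by (rule respectsI) (auto intro: Delta_cocycle Delta_coboundary cocycles_cochain)

lemma scale_respects: "(\<lambda>f. cls (\<lambda>as. c *s f as)) respects cohomologous"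
proof (rule respectsI)
  fix f g assume "f - g \<in> coboundaries"
  then show "(\<lambda>as. c *s f as) - (\<lambda>as. c *s g as) \<in> coboundaries"
    using coboundaries_scale[of "f - g" c] by (simp add: fun_diff_def scale_right_diff_distrib)
qed (rule scale_cocycle)

lemma respects2I:
  assumes "\<And>f g. f \<in> cocycles \<Longrightarrow> g \<in> cocycles \<Longrightarrow> F f g \<in> cocycles"
    and "\<And>f f' g. f \<in> cocycles \<Longrightarrow> f' \<in> cocycles \<Longrightarrow> g \<in> cocycles \<Longrightarrow> f - f' \<in> coboundaries
       \<Longrightarrow> F f g - F f' g \<in> coboundaries"
    and "\<And>f g g'. f \<in> cocycles \<Longrightarrow> g \<in> cocycles \<Longrightarrow> g' \<in> cocycles \<Longrightarrow> g - g' \<in> coboundaries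
       \<Longrightarrow> F f g - F f g' \<in> coboundaries"
  shows "(\<lambda>f g. cls (F f g)) respects2 cohomologous"
proof (rule congruent2I[OF equiv_cohomologous equiv_cohomologous])
  fix f f' g assume "(f, f') \<in> cohomologous" "g \<in> cocycles"
  then show "cls (F f g) = cls (F f' g)"
    by (intro cls_eqI[OF assms(1) assms(1) assms(2)]) (simp_all add: cohomologous_def)
next
  fix f g g' assume "(g, g') \<in> cohomologous" "f \<in> cocycles"
  then show "cls (F f g) = cls (F f g')"
    by (intro cls_eqI[OF assms(1) assms(1) assms(3)]) (simp_all add: cohomologous_def)
qed

lemma induced2_cls:
  assumes "(\<lambda>f g. cls (F f g)) respects2 cohomologous" "f \<in> cocycles" "g \<in> cocycles"
  shows "induced2 F (cls f) (cls g) = cls (F f g)"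
  unfolding induced2_def cls_def[of f] cls_def[of g]
  by (rule UN_equiv_class2[OF equiv_cohomologous equiv_cohomologous assms])

lemma cup_respects: "(\<lambda>f g. cls (f \<smile> g)) respects2 cohomologous"
proof (rule respects2I)
  fix f f' g assume "f - f' \<in> coboundaries" "g \<in> cocycles"
  then show "f \<smile> g - f' \<smile> g \<in> coboundaries"
    by (simp add: cup_diff_left[symmetric] cup_coboundary_left)
next
  fix f g g' assume "g - g' \<in> coboundaries" "f \<in> cocycles"
  then show "f \<smile> g - f \<smile> g' \<in> coboundaries"
    by (simp add: cup_diff_right[symmetric] cup_coboundary_right)
qed (rule cup_cocycle)

lemma add_respects: "(\<lambda>f g. cls (f + g)) respects2 cohomologous"
  by (rule respects2I) (simp_all add: add_cocycle)

lemmas cls_cup [simp] = induced2_cls[OF cup_respects, folded hcup_def]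
lemmas cls_add [simp] = induced2_cls[OF add_respects, folded hadd_def]
lemmas cls_Delta [simp] = induced_cls[OF Delta_respects, folded hDelta_def]
lemmas cls_reversal [simp] = induced_cls[OF reversal_respects, folded hreversal_def]
lemmas cls_degree_sign [simp] = induced_cls[OF degree_sign_respects, folded hsign_def]
lemmas cls_even_part [simp] = induced_cls[OF even_part_respects, folded heven_def]
lemmas cls_odd_part [simp] = induced_cls[OF odd_part_respects, folded hodd_def]
lemmas cls_scale [simp] = induced_cls[OF scale_respects, folded hscale_def]

lemmas cocycle_intros =
  add_cocycle scale_cocycle zero_cocycle diff_cocycle cup_cocycle Delta_cocycle reversal_cocycle
  degree_sign_cocycle even_part_cocycle odd_part_cocycle degree_zero_cocycle mult_cocycle

declare cocycle_intros [simp]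

end

interpretation fun_space: vector_space "fun_scale :: 'k::field \<Rightarrow> ('b \<Rightarrow> 'k) \<Rightarrow> 'b \<Rightarrow> 'k"
  by (rule vector_space_fun_scale)

context inner_product_algebra
begin

section \<open>Multilinear maps between tensor powers\<close>

lemma HH_closed [simp]:
  assumes "X \<in> HH"
  shows "Y \<in> HH \<Longrightarrow> X \<oplus> Y \<in> HH" "c \<odot> X \<in> HH" "Y \<in> HH \<Longrightarrow> X \<smile>\<^sub>H Y \<in> HH"
    "hDelta X \<in> HH" "hreversal X \<in> HH" "hsign X \<in> HH" "heven X \<in> HH" "hodd X \<in> HH"
  using assms by (auto elim!: HH_cls simp: cls_in_HH)

lemma pure_apply: "multilinear_form \<phi> \<Longrightarrow> pure xs \<phi> = \<phi> xs"
  by (simp add: pure_def)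

lemma pure_add:
  "xs \<in> lists HH \<Longrightarrow> ys \<in> lists HH \<Longrightarrow> X \<in> HH \<Longrightarrow> Y \<in> HH \<Longrightarrow>
     pure (xs @ (X \<oplus> Y) # ys) = pure (xs @ X # ys) + pure (xs @ Y # ys)"
  unfolding pure_def multilinear_form_def by (rule ext) (simp del: lists_eq_set in_lists_conv_set)

lemma pure_scale:
  "xs \<in> lists HH \<Longrightarrow> ys \<in> lists HH \<Longrightarrow> X \<in> HH \<Longrightarrow>
     pure (xs @ (c \<odot> X) # ys) = fun_scale c (pure (xs @ X # ys))"
  unfolding pure_def multilinear_form_def fun_scale_def
      by (rule ext) (simp del: lists_eq_set in_lists_conv_set)

text \<open>
  The sum of all tensor powers. The tensor product is bilinear on this space, but not on arbitrary
  functionals on forms.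
\<close>

definition tensors :: "('a cochain set, 'k) tensor set" where
  "tensors = module.span fun_scale (pure ` lists HH)"

lemma pure_tensors: "xs \<in> lists HH \<Longrightarrow> pure xs \<in> tensors"
  unfolding tensors_def by (rule fun_space.span_base) simp

lemma tensors_zero: "0 \<in> tensors"
  and tensors_add: "s \<in> tensors \<Longrightarrow> t \<in> tensors \<Longrightarrow> s + t \<in> tensors"
  and tensors_scale: "s \<in> tensors \<Longrightarrow> fun_scale c s \<in> tensors"
  and tensors_sum: "(\<And>i. i \<in> I \<Longrightarrow> u i \<in> tensors) \<Longrightarrow> (\<Sum>i\<in>I. u i) \<in> tensors"
  unfolding tensors_def
  by (rule fun_space.span_zero fun_space.span_add fun_space.span_scale fun_space.span_sum; assumption?)+

lemma tensors_induct [consumes 1, case_names zero add]: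
  assumes "t \<in> tensors" "P 0"
    "\<And>c xs t. xs \<in> lists HH \<Longrightarrow> t \<in> tensors \<Longrightarrow> P t \<Longrightarrow> P (fun_scale c (pure xs) + t)"
  shows "P t"
proof -
  have "t \<in> tensors \<and> P t"
    using assms(1)[unfolded tensors_def]
  proof (induction rule: fun_space.span_induct_alt)
    case base
    show ?case using assms(2) tensors_zero by blast
  next
    case (step c x y)
    then obtain xs where "x = pure xs" "xs \<in> lists HH" by blast
    then show ?case
      using step assms(3) by (simp only: tensors_add tensors_scale pure_tensors simp_thms)
  qed
  then show ?thesis ..
qed

lemma tensor_not_multilinear: "t \<in> tensors \<Longrightarrow> \<not> multilinear_form \<phi> \<Longrightarrow> t \<phi> = 0"
  by (induction rule: tensors_induct) (simp_all add: fun_scale_def pure_def)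

text \<open>
  The maps \<open>F\<close> to which \<open>lin_ext\<close> can be applied, that is, for which \<open>lin_ext F (pure xs) = F xs\<close>.
  As in the case of forms, all arities are treated at once.
\<close>

definition multilinear_map :: "('a cochain set list \<Rightarrow> ('a cochain set, 'k) tensor) \<Rightarrow> bool" where
  "multilinear_map F \<longleftrightarrow> (\<forall>xs\<in>lists HH. F xs \<in> tensors) \<and>
     (\<forall>xs\<in>lists HH. \<forall>ys\<in>lists HH. \<forall>X\<in>HH. \<forall>Y\<in>HH.
        F (xs @ (X \<oplus> Y) # ys) = F (xs @ X # ys) + F (xs @ Y # ys)) \<and>
     (\<forall>xs\<in>lists HH. \<forall>ys\<in>lists HH. \<forall>X\<in>HH. \<forall>c.
        F (xs @ (c \<odot> X) # ys) = fun_scale c (F (xs @ X # ys)))"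

lemma multilinear_mapI:
  assumes "\<And>xs. xs \<in> lists HH \<Longrightarrow> F xs \<in> tensors"
    and "\<And>xs ys X Y. xs \<in> lists HH \<Longrightarrow> ys \<in> lists HH \<Longrightarrow> X \<in> HH \<Longrightarrow> Y \<in> HH \<Longrightarrow>
        F (xs @ (X \<oplus> Y) # ys) = F (xs @ X # ys) + F (xs @ Y # ys)"
    and "\<And>xs ys X c. xs \<in> lists HH \<Longrightarrow> ys \<in> lists HH \<Longrightarrow> X \<in> HH \<Longrightarrow>
        F (xs @ (c \<odot> X) # ys) = fun_scale c (F (xs @ X # ys))"
  shows "multilinear_map F"
  unfolding multilinear_map_def by (intro conjI ballI allI) (rule assms; assumption)+

lemma multilinear_mapD:
  assumes "multilinear_map F" "xs \<in> lists HH"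
  shows "F xs \<in> tensors"
    and "ys \<in> lists HH \<Longrightarrow> X \<in> HH \<Longrightarrow> Y \<in> HH \<Longrightarrow>
        F (xs @ (X \<oplus> Y) # ys) = F (xs @ X # ys) + F (xs @ Y # ys)"
    and "ys \<in> lists HH \<Longrightarrow> X \<in> HH \<Longrightarrow> F (xs @ (c \<odot> X) # ys) = fun_scale c (F (xs @ X # ys))"
  using assms unfolding multilinear_map_def by (simp_all del: lists_eq_set in_lists_conv_set)

lemma multilinear_map_form:
  "multilinear_map F \<Longrightarrow> multilinear_form (\<lambda>xs. F xs \<phi>)"
  unfolding multilinear_form_def
  by (simp del: lists_eq_set in_lists_conv_set add: multilinear_mapD fun_scale_def)

lemma lin_ext_pure:
  assumes "multilinear_map F" "xs \<in> lists HH"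
  shows "lin_ext F (pure xs) = F xs"
proof
  fix \<phi>
  show "lin_ext F (pure xs) \<phi> = F xs \<phi>"
    using tensor_not_multilinear[OF multilinear_mapD(1)[OF assms], of \<phi>]
    by (simp add: lin_ext_def pure_apply multilinear_map_form assms)
qed

definition tensor_linear ::
    "(('a cochain set, 'k) tensor \<Rightarrow> ('a cochain set, 'k) tensor) \<Rightarrow> bool" where
  "tensor_linear L \<longleftrightarrow> (\<forall>s t. L (s + t) = L s + L t) \<and> (\<forall>c t. L (fun_scale c t) = fun_scale c (L t))"

lemma tensor_linear_lin_ext: "tensor_linear (lin_ext F)"
  by (auto simp: tensor_linear_def lin_ext_def fun_eq_iff fun_scale_def)

lemma tensor_linear_zero: "tensor_linear L \<Longrightarrow> L 0 = 0"
  unfolding tensor_linear_def by (metis add_cancel_right_left)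

lemma tensor_linear_sum:
  assumes L: "tensor_linear L"
  shows "L (\<Sum>i\<in>I. t i) = (\<Sum>i\<in>I. L (t i))"
proof (induction I rule: infinite_finite_induct)
  case (insert x F)
  have "L (t x + sum t F) = L (t x) + L (sum t F)"
    using L unfolding tensor_linear_def by blast
  then show ?case by (simp only: sum.insert[OF insert(1,2)] insert.IH)
next
  case (infinite A)
  then show ?case by (simp only: sum.infinite[OF infinite] tensor_linear_zero[OF L])
qed (simp only: sum.empty tensor_linear_zero[OF L])

definition tensor_hom ::
    "(('a cochain set, 'k) tensor \<Rightarrow> ('a cochain set, 'k) tensor) \<Rightarrow> bool" where
  "tensor_hom L \<longleftrightarrow> tensor_linear L \<and> (\<forall>t\<in>tensors. L t \<in> tensors)"

lemma tensor_hom_linear: "tensor_hom L \<Longrightarrow> tensor_linear L"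
  by (simp add: tensor_hom_def)

lemma tensor_homI:
  assumes "tensor_linear L" "\<And>xs. xs \<in> lists HH \<Longrightarrow> L (pure xs) \<in> tensors"
  shows "tensor_hom L"
proof -
  have "L t \<in> tensors" if "t \<in> tensors" for t
    using that
  proof (induction rule: tensors_induct)
    case (add c xs t)
    have "L (fun_scale c (pure xs) + t) = fun_scale c (L (pure xs)) + L t"
      using assms(1) unfolding tensor_linear_def by metis
    then show ?case
      using add assms(2) by (simp only: tensors_add tensors_scale)
  qed (simp only: tensor_linear_zero[OF assms(1)] tensors_zero)
  then show ?thesis using assms by (simp add: tensor_hom_def)
qed

lemma tensor_hom_lin_ext: "multilinear_map F \<Longrightarrow> tensor_hom (lin_ext F)"
  by (rule tensor_homI) (simp_all only: tensor_linear_lin_ext lin_ext_pure multilinear_mapD)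

lemma tensor_hom_id: "tensor_hom id"
  by (simp add: tensor_hom_def tensor_linear_def)

lemma tensor_hom_comp: "tensor_hom F \<Longrightarrow> tensor_hom G \<Longrightarrow> tensor_hom (F \<circ> G)"
  by (simp add: tensor_hom_def tensor_linear_def)

lemma tensor_linear_comp: "tensor_linear F \<Longrightarrow> tensor_linear G \<Longrightarrow> tensor_linear (\<lambda>t. F (G t))"
  by (simp add: tensor_linear_def)

lemma tensor_linear_add: "tensor_linear F \<Longrightarrow> tensor_linear G \<Longrightarrow> tensor_linear (\<lambda>t. F t + G t)"
  by (auto simp: tensor_linear_def fun_scale_def fun_eq_iff algebra_simps)

lemma tensor_linear_diff: "tensor_linear F \<Longrightarrow> tensor_linear G \<Longrightarrow> tensor_linear (\<lambda>t. F t - G t)"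
  by (auto simp: tensor_linear_def fun_scale_def fun_eq_iff algebra_simps)

lemma tensor_power_eqI:
  assumes "tensor_linear F" "tensor_linear G" "t \<in> tensor_power n"
    and "\<And>xs. xs \<in> lists HH \<Longrightarrow> length xs = n \<Longrightarrow> F (pure xs) = G (pure xs)"
  shows "F t = G t"
  using assms(3) unfolding tensor_power_def
proof (induction rule: fun_space.span_induct_alt)
  case base
  show ?case by (simp only: tensor_linear_zero[OF assms(1)] tensor_linear_zero[OF assms(2)])
next
  case (step c x y)
  obtain xs where "x = pure xs" "xs \<in> lists HH" "length xs = n" using step(1) by blast
  moreover have "F (fun_scale c x + y) = fun_scale c (F x) + F y"
      "G (fun_scale c x + y) = fun_scale c (G x) + G y"
    using assms(1,2) unfolding tensor_linear_def by metis+
  ultimately show ?case using assms(4) step by (simp only:)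
qed

lemma multilinear_map_pure_append:
  "xs \<in> lists HH \<Longrightarrow> multilinear_map (\<lambda>ys. pure (xs @ ys))"
  using pure_add[of "xs @ _"] pure_scale[of "xs @ _"]
  by (intro multilinear_mapI pure_tensors) auto

lemma tensors_eqI:
  assumes "tensor_linear F" "tensor_linear G" "t \<in> tensors"
    and "\<And>xs. xs \<in> lists HH \<Longrightarrow> F (pure xs) = G (pure xs)"
  shows "F t = G t"
  using assms(3)
proof (induction rule: tensors_induct)
  case zero
  show ?case by (simp only: tensor_linear_zero[OF assms(1)] tensor_linear_zero[OF assms(2)])
next
  case (add c xs t)
  moreover have "F (fun_scale c (pure xs) + t) = fun_scale c (F (pure xs)) + F t"
    "G (fun_scale c (pure xs) + t) = fun_scale c (G (pure xs)) + G t"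
    using assms(1,2) unfolding tensor_linear_def by metis+
  ultimately show ?case using assms(4) by (simp only:)
qed

lemma tensor_linear_scale: "tensor_linear F \<Longrightarrow> tensor_linear (\<lambda>t. fun_scale c (F t))"
  by (auto simp: tensor_linear_def fun_scale_def fun_eq_iff algebra_simps)

text \<open>
  The identities are linear in \<open>t\<close>, so they have to be checked for pure \<open>t\<close> only.
\<close>

lemma multilinear_map_lin_ext_append:
  assumes t: "t \<in> tensors"
  shows "multilinear_map (\<lambda>xs. lin_ext (\<lambda>ys. pure (xs @ ys)) t)"
proof (rule multilinear_mapI)
  fix xs assume "xs \<in> lists HH"
  then show "lin_ext (\<lambda>ys. pure (xs @ ys)) t \<in> tensors"
    using tensor_hom_lin_ext[OF multilinear_map_pure_append] t by (simp add: tensor_hom_def)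
next
  fix xs ys X Y assume *: "xs \<in> lists HH" "ys \<in> lists HH" "X \<in> HH" "Y \<in> HH"
  have e: "lin_ext (\<lambda>zs. pure ((xs @ Z # ys) @ zs)) (pure zs) = pure ((xs @ Z # ys) @ zs)"
    if "Z \<in> HH" "zs \<in> lists HH" for Z zs
    by (rule lin_ext_pure[OF multilinear_map_pure_append]) (use * that in simp_all)
  show "lin_ext (\<lambda>zs. pure ((xs @ (X \<oplus> Y) # ys) @ zs)) t =
     lin_ext (\<lambda>zs. pure ((xs @ X # ys) @ zs)) t + lin_ext (\<lambda>zs. pure ((xs @ Y # ys) @ zs)) t"
  proof (rule tensors_eqI[OF _ _ t])
    fix zs assume "zs \<in> lists HH"
    then show "lin_ext (\<lambda>zs. pure ((xs @ (X \<oplus> Y) # ys) @ zs)) (pure zs) =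
      lin_ext (\<lambda>zs. pure ((xs @ X # ys) @ zs)) (pure zs) + lin_ext
          (\<lambda>zs. pure ((xs @ Y # ys) @ zs)) (pure zs)"
      using * pure_add[of xs "ys @ zs" X Y] e[of _ zs] by simp
  qed (intro tensor_linear_add tensor_linear_lin_ext)+
next
  fix xs ys X c assume *: "xs \<in> lists HH" "ys \<in> lists HH" "X \<in> HH"
  have e: "lin_ext (\<lambda>zs. pure ((xs @ Z # ys) @ zs)) (pure zs) = pure ((xs @ Z # ys) @ zs)"
    if "Z \<in> HH" "zs \<in> lists HH" for Z zs
    by (rule lin_ext_pure[OF multilinear_map_pure_append]) (use * that in simp_all)
  show "lin_ext (\<lambda>zs. pure ((xs @ (c \<odot> X) # ys) @ zs)) t =
     fun_scale c (lin_ext (\<lambda>zs. pure ((xs @ X # ys) @ zs)) t)"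
  proof (rule tensors_eqI[OF _ _ t])
    fix zs assume "zs \<in> lists HH"
    then show "lin_ext (\<lambda>zs. pure ((xs @ (c \<odot> X) # ys) @ zs)) (pure zs) =
      fun_scale c (lin_ext (\<lambda>zs. pure ((xs @ X # ys) @ zs)) (pure zs))"
      using * pure_scale[of xs "ys @ zs" X c] e[of _ zs] by simp
  qed (intro tensor_linear_scale tensor_linear_lin_ext)+
qed

lemma tensor_mult_linear_left: "tensor_linear (\<lambda>s. s \<cdot> t)"
  unfolding tensor_mult_def by (rule tensor_linear_lin_ext)

lemma pure_mult: "xs \<in> lists HH \<Longrightarrow> t \<in> tensors \<Longrightarrow> pure xs \<cdot> t = lin_ext (\<lambda>ys. pure (xs @ ys)) t"
  unfolding tensor_mult_def by (rule lin_ext_pure[OF multilinear_map_lin_ext_append])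

lemma pure_mult_pure:
  "xs \<in> lists HH \<Longrightarrow> ys \<in> lists HH \<Longrightarrow> pure xs \<cdot> pure ys = pure (xs @ ys)"
  by (simp only: pure_mult pure_tensors lin_ext_pure[OF multilinear_map_pure_append])

lemma tensor_mult_tensors: "s \<in> tensors \<Longrightarrow> t \<in> tensors \<Longrightarrow> s \<cdot> t \<in> tensors"
  using tensor_hom_lin_ext[OF multilinear_map_lin_ext_append[of t]]
  by (simp add: tensor_hom_def tensor_mult_def)

lemma tensor_mult_left:
  "(s + s') \<cdot> t = s \<cdot> t + s' \<cdot> t" "fun_scale c s \<cdot> t = fun_scale c (s \<cdot> t)" "0 \<cdot> t = 0"
  "(\<Sum>i\<in>I. u i) \<cdot> t = (\<Sum>i\<in>I. u i \<cdot> t)"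
  using tensor_mult_linear_left[of t] tensor_linear_zero[OF tensor_mult_linear_left, of t]
    tensor_linear_sum[OF tensor_mult_linear_left[of t], of u I]
  by (simp_all add: tensor_linear_def)

text \<open>
  Linearity in the second factor needs that the first one is a tensor, because a general
  functional on forms need not be additive.
\<close>

lemma tensor_mult_right:
  assumes s: "s \<in> tensors" and t: "t \<in> tensors"
  shows "t' \<in> tensors \<Longrightarrow> s \<cdot> (t + t') = s \<cdot> t + s \<cdot> t'"
    and "s \<cdot> fun_scale c t = fun_scale c (s \<cdot> t)"
proof -
  show "s \<cdot> (t + t') = s \<cdot> t + s \<cdot> t'" if t': "t' \<in> tensors"
    using s
  proof (rule tensors_eqI[rotated 2])
    fix xs assume "xs \<in> lists HH"
    then show "pure xs \<cdot> (t + t') = pure xs \<cdot> t + pure xs \<cdot> t'"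
      using tensor_linear_lin_ext[of "\<lambda>ys. pure (xs @ ys)"] t t'
      by (simp only: pure_mult tensors_add tensor_linear_def)
  qed (intro tensor_linear_add tensor_mult_linear_left)+
  show "s \<cdot> fun_scale c t = fun_scale c (s \<cdot> t)"
    using s
  proof (rule tensors_eqI[rotated 2])
    fix xs assume "xs \<in> lists HH"
    then show "pure xs \<cdot> fun_scale c t = fun_scale c (pure xs \<cdot> t)"
      using tensor_linear_lin_ext[of "\<lambda>ys. pure (xs @ ys)"] t
      by (simp only: pure_mult tensors_scale tensor_linear_def)
  qed (intro tensor_linear_scale tensor_mult_linear_left)+
qed

lemma tensor_mult_zero_right: "s \<in> tensors \<Longrightarrow> s \<cdot> 0 = 0"
  using tensor_mult_right(2)[of s 0 0] tensors_zero by (simp add: fun_scale_def zero_fun_def)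

lemma tensor_mult_sum_right:
  "s \<in> tensors \<Longrightarrow> (\<And>i. i \<in> I \<Longrightarrow> u i \<in> tensors) \<Longrightarrow> s \<cdot> (\<Sum>i\<in>I. u i) = (\<Sum>i\<in>I. s \<cdot> u i)"
  by (induction I rule: infinite_finite_induct)
    (simp_all add: tensor_mult_zero_right tensor_mult_right(1) tensors_sum)

lemma HH_linear_funpow:
  assumes "HH_linear h"
  shows "HH_linear (h ^^ d)"
proof (induction d)
  case (Suc d)
  then show ?case using assms by (auto simp: HH_linear_def image_subset_iff)
qed (simp add: HH_linear_def)

lemma HH_linearI:
  assumes "\<And>f. f \<in> cocycles \<Longrightarrow> F (cls f) \<in> HH"
    "\<And>f g. f \<in> cocycles \<Longrightarrow> g \<in> cocycles \<Longrightarrow> F (cls (f + g)) = F (cls f) \<oplus> F (cls g)"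
    "\<And>c f. f \<in> cocycles \<Longrightarrow> F (cls (\<lambda>as. c *s f as)) = c \<odot> F (cls f)"
  shows "HH_linear F"
  unfolding HH_linear_def using assms by (auto elim!: HH_cls)

lemma HH_linear_hsign: "HH_linear hsign"
  by (rule HH_linearI)
    (simp_all add: cls_in_HH degree_sign_add, simp add: degree_sign_def[abs_def] signed_def if_distrib
        cong: if_cong)

text \<open>
  The entry in which linearity is tested lies either among the first \<open>m\<close> entries or behind them.
\<close>

lemma multilinear_map_tensor_map:
  assumes F: "tensor_hom F" and G: "tensor_hom G" and h: "HH_linear h"
  shows "multilinear_map (\<lambda>zs. F (pure (map h (take m zs))) \<cdot> G (pure (drop m zs)))"
proof (rule multilinear_mapI)
  have hHH: "map h xs \<in> lists HH" if "xs \<in> lists HH" for xs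
    using that h by (auto simp: HH_linear_def image_subset_iff)
  have Fp: "F (pure (map h xs)) \<in> tensors" "G (pure xs) \<in> tensors" if "xs \<in> lists HH" for xs
    using F G pure_tensors[OF hHH[OF that]] pure_tensors[OF that] by (auto simp: tensor_hom_def)
  have tl: "take n xs \<in> lists HH" "drop n xs \<in> lists HH" if "xs \<in> lists HH" for xs n
    using that by (auto dest: in_set_takeD in_set_dropD)
  {
    fix xs assume "xs \<in> lists HH"
    then show "F (pure (map h (take m xs))) \<cdot> G (pure (drop m xs)) \<in> tensors"
      by (intro tensor_mult_tensors Fp tl)
  next
    fix xs ys X Y assume *: "xs \<in> lists HH" "ys \<in> lists HH" "X \<in> HH" "Y \<in> HH"
    have hh: "h X \<in> HH" "h Y \<in> HH" "h (X \<oplus> Y) = h X \<oplus> h Y" using h * by (auto simp: HH_linear_def)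
    show "F (pure (map h (take m (xs @ (X \<oplus> Y) # ys)))) \<cdot> G (pure (drop m (xs @ (X \<oplus> Y) # ys))) =
      F (pure (map h (take m (xs @ X # ys)))) \<cdot> G (pure (drop m (xs @ X # ys)))
      + F (pure (map h (take m (xs @ Y # ys)))) \<cdot> G (pure (drop m (xs @ Y # ys)))"
    proof (cases "length xs < m")
      case True
      then obtain k where "m - length xs = Suc k" by (cases "m - length xs") auto
      then show ?thesis
        using True F pure_add[OF hHH[OF *(1)] hHH[OF tl(1)[OF *(2), of k]] hh(1,2)]
        by (simp add: hh tensor_hom_def tensor_linear_def tensor_mult_left)
    next
      case False
      then have "pure (drop m xs @ (X \<oplus> Y) # ys) = pure (drop m xs @ X # ys)
          + pure (drop m xs @ Y # ys)"
        by (intro pure_add tl *)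
      moreover have "drop m xs @ Z # ys \<in> lists HH" if "Z \<in> HH" for Z
        using that * tl(2)[OF *(1), of m] by simp
      ultimately show ?thesis
        using False G * tensor_mult_right(1)[OF Fp(1)[OF tl(1)[OF *(1), of m]] Fp(2) Fp(2)]
        by (simp add: tensor_hom_def tensor_linear_def del: lists_eq_set in_lists_conv_set)
    qed
  next
    fix xs ys X c assume *: "xs \<in> lists HH" "ys \<in> lists HH" "X \<in> HH"
    have hh: "h X \<in> HH" "h (c \<odot> X) = c \<odot> h X" using h * by (auto simp: HH_linear_def)
    show "F (pure (map h (take m (xs @ (c \<odot> X) # ys)))) \<cdot> G (pure (drop m (xs @ (c \<odot> X) # ys))) =
      fun_scale c (F (pure (map h (take m (xs @ X # ys)))) \<cdot> G (pure (drop m (xs @ X # ys))))"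
    proof (cases "length xs < m")
      case True
      then obtain k where "m - length xs = Suc k" by (cases "m - length xs") auto
      then show ?thesis
        using True F pure_scale[OF hHH[OF *(1)] hHH[OF tl(1)[OF *(2), of k]] hh(1)]
        by (simp add: hh tensor_hom_def tensor_linear_def tensor_mult_left)
    next
      case False
      then have "pure (drop m xs @ (c \<odot> X) # ys) = fun_scale c (pure (drop m xs @ X # ys))"
        by (intro pure_scale tl *)
      moreover have "drop m xs @ X # ys \<in> lists HH"
        using * tl(2)[OF *(1), of m] by simp
      ultimately show ?thesis
        using False G * tensor_mult_right(2)[OF Fp(1)[OF tl(1)[OF *(1), of m]] Fp(2)]
        by (simp add: tensor_hom_def tensor_linear_def del: lists_eq_set in_lists_conv_set)
    qed
  }
qed

lemma tensor_hom_tensor_map: "tensor_hom F \<Longrightarrow> tensor_hom G \<Longrightarrow> tensor_hom (F \<otimes>[m,d] G)"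
  unfolding tensor_map_def
  by (intro tensor_hom_lin_ext multilinear_map_tensor_map HH_linear_funpow HH_linear_hsign)

lemma tensor_linear_tensor_map: "tensor_linear (F \<otimes>[m,d] G)"
  unfolding tensor_map_def by (rule tensor_linear_lin_ext)

lemma tensor_map_pure:
  assumes "tensor_hom F" "tensor_hom G" "zs \<in> lists HH"
  shows "(F \<otimes>[m,d] G) (pure zs) = F (pure (map (hsign ^^ d) (take m zs))) \<cdot> G (pure (drop m zs))"
  unfolding tensor_map_def
  by (rule lin_ext_pure[OF multilinear_map_tensor_map[OF assms(1,2) HH_linear_funpow[OF
      HH_linear_hsign]] assms(3)])

lemma multilinear_map_case1:
  assumes "\<And>X. X \<in> HH \<Longrightarrow> G X \<in> tensors"
    "\<And>X Y. X \<in> HH \<Longrightarrow> Y \<in> HH \<Longrightarrow> G (X \<oplus> Y) = G X + G Y"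
    "\<And>c X. X \<in> HH \<Longrightarrow> G (c \<odot> X) = fun_scale c (G X)"
  shows "multilinear_map (\<lambda>zs. case zs of [X] \<Rightarrow> G X | _ \<Rightarrow> 0)"
proof (rule multilinear_mapI)
  fix xs assume "xs \<in> lists HH"
  then show "(case xs of [X] \<Rightarrow> G X | _ \<Rightarrow> 0) \<in> tensors"
    by (auto simp: assms tensors_zero split: list.splits)
next
  fix xs ys X Y assume "xs \<in> lists HH" "ys \<in> lists HH" "X \<in> HH" "Y \<in> HH"
  then show "(case xs @ (X \<oplus> Y) # ys of [X] \<Rightarrow> G X | _ \<Rightarrow> 0) =
     (case xs @ X # ys of [X] \<Rightarrow> G X | _ \<Rightarrow> 0) + (case xs @ Y # ys of [X] \<Rightarrow> G X | _ \<Rightarrow> 0)"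
    by (cases xs; cases ys; cases "tl xs") (simp_all add: assms)
next
  fix xs ys X c assume "xs \<in> lists HH" "ys \<in> lists HH" "X \<in> HH"
  then show "(case xs @ (c \<odot> X) # ys of [X] \<Rightarrow> G X | _ \<Rightarrow> 0) =
     fun_scale c (case xs @ X # ys of [X] \<Rightarrow> G X | _ \<Rightarrow> 0)"
    by (cases xs; cases ys; cases "tl xs") (simp_all add: assms)
qed

lemma multilinear_map_case2:
  assumes "\<And>X Y. X \<in> HH \<Longrightarrow> Y \<in> HH \<Longrightarrow> G X Y \<in> tensors"
    "\<And>X Y Z. X \<in> HH \<Longrightarrow> Y \<in> HH \<Longrightarrow> Z \<in> HH \<Longrightarrow> G (X \<oplus> Y) Z = G X Z + G Y Z"
    "\<And>X Y Z. X \<in> HH \<Longrightarrow> Y \<in> HH \<Longrightarrow> Z \<in> HH \<Longrightarrow> G Z (X \<oplus> Y) = G Z X + G Z Y"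
    "\<And>c X Y. X \<in> HH \<Longrightarrow> Y \<in> HH \<Longrightarrow> G (c \<odot> X) Y = fun_scale c (G X Y)"
    "\<And>c X Y. X \<in> HH \<Longrightarrow> Y \<in> HH \<Longrightarrow> G X (c \<odot> Y) = fun_scale c (G X Y)"
  shows "multilinear_map (\<lambda>zs. case zs of [X, Y] \<Rightarrow> G X Y | _ \<Rightarrow> 0)"
proof (rule multilinear_mapI)
  fix xs assume "xs \<in> lists HH"
  then show "(case xs of [X, Y] \<Rightarrow> G X Y | _ \<Rightarrow> 0) \<in> tensors"
    by (auto simp: assms tensors_zero split: list.splits)
next
  fix xs ys X Y assume "xs \<in> lists HH" "ys \<in> lists HH" "X \<in> HH" "Y \<in> HH"
  then show "(case xs @ (X \<oplus> Y) # ys of [X, Y] \<Rightarrow> G X Y | _ \<Rightarrow> 0) =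
     (case xs @ X # ys of [X, Y] \<Rightarrow> G X Y | _ \<Rightarrow> 0) + (case xs @ Y # ys of [X, Y] \<Rightarrow> G X Y | _ \<Rightarrow> 0)"
    by (cases xs; cases ys; cases "tl xs"; cases "tl ys"; cases "tl (tl xs)") (simp_all add: assms)
next
  fix xs ys X c assume "xs \<in> lists HH" "ys \<in> lists HH" "X \<in> HH"
  then show "(case xs @ (c \<odot> X) # ys of [X, Y] \<Rightarrow> G X Y | _ \<Rightarrow> 0) =
     fun_scale c (case xs @ X # ys of [X, Y] \<Rightarrow> G X Y | _ \<Rightarrow> 0)"
    by (cases xs; cases ys; cases "tl xs"; cases "tl ys"; cases "tl (tl xs)") (simp_all add: assms)
qed


section \<open>The coproduct on cohomology\<close>

definition scalar_class :: "'a \<Rightarrow> 'a cochain set" where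
  "scalar_class c = cls (degree_zero c)"

lemma scalar_class_HH [simp]: "scalar_class c \<in> HH"
  by (simp add: scalar_class_def cls_in_HH)

lemma scalar_class_add: "scalar_class (a + b) = scalar_class a \<oplus> scalar_class b"
proof -
  have "degree_zero (a + b) = degree_zero a + degree_zero b"
    by (simp add: fun_eq_iff degree_zero_def)
  then show ?thesis by (simp add: scalar_class_def)
qed

lemma scalar_class_scale: "scalar_class (c *s a) = c \<odot> scalar_class a"
proof -
  have "degree_zero (c *s a) = (\<lambda>as. c *s degree_zero a as)"
    by (simp add: fun_eq_iff degree_zero_def)
  then show ?thesis by (simp add: scalar_class_def)
qed

lemma scalar_class_zero: "scalar_class 0 = cls 0"
  by (simp add: scalar_class_def degree_zero_def[abs_def] zero_fun_def)

lemma cup_scalar_class: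
  assumes "f \<in> cocycles"
  shows "scalar_class c \<smile>\<^sub>H cls f = cls (\<lambda>as. c * f as)"
      "cls f \<smile>\<^sub>H scalar_class c = cls (\<lambda>as. c * f as)"
proof -
  have "degree_zero c \<smile> f = (\<lambda>as. c * f as)"
  proof
    fix as
    have "(degree_zero c \<smile> f) as = split_sum (\<lambda>u v. if u = [] then c * f v else 0) as"
      unfolding cup_eq by (rule split_sum_cong) (simp add: degree_zero_def)
    then show "(degree_zero c \<smile> f) as = c * f as" by (simp only: split_sum_first_Nil)
  qed
  then show "scalar_class c \<smile>\<^sub>H cls f = cls (\<lambda>as. c * f as)"
    using assms by (simp add: scalar_class_def)
  have "f \<smile> degree_zero c = (\<lambda>as. c * f as)"
  proof
    fix as
    have "(f \<smile> degree_zero c) as = split_sum (\<lambda>u v. if v = [] then c * f u else 0) as"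
      unfolding cup_eq by (rule split_sum_cong) (simp add: degree_zero_def mult.commute)
    then show "(f \<smile> degree_zero c) as = c * f as" by (simp only: split_sum_last_Nil)
  qed
  then show "cls f \<smile>\<^sub>H scalar_class c = cls (\<lambda>as. c * f as)"
    using assms by (simp add: scalar_class_def)
qed

text \<open>
  Multiplication by the Euler element only depends on the component of degree 0.
\<close>

lemma euler_class: "f \<in> cocycles \<Longrightarrow> cls (\<lambda>as. c * euler * f as) = scalar_class (c * euler * f [])"
  unfolding scalar_class_def by (rule cls_eqI) (simp_all add: euler_coboundary)

lemma scalar_class_operations [simp]:
  "hDelta (scalar_class c) = cls 0" "hreversal (scalar_class c) = scalar_class c"
  "hsign (scalar_class c) = scalar_class c" "heven (scalar_class c) = scalar_class c"
  "hodd (scalar_class c) = cls 0"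
proof -
  have "Delta (degree_zero c) = 0"
    by (simp add: fun_eq_iff Delta_split degree_zero_cochain degree_zero_def repr_zero split_sum_zero)
  moreover have "reversal (degree_zero c) = degree_zero c" "degree_sign (degree_zero c) = degree_zero c"
    "even_part (degree_zero c) = degree_zero c" "odd_part (degree_zero c) = 0"
    by (auto simp: fun_eq_iff degree_zero_def reversal_eq degree_sign_def even_part_def odd_part_def
        tri_def)
  ultimately show "hDelta (scalar_class c) = cls 0" "hreversal (scalar_class c) = scalar_class c"
    "hsign (scalar_class c) = scalar_class c" "heven (scalar_class c) = scalar_class c"
    "hodd (scalar_class c) = cls 0"
    by (simp_all add: scalar_class_def)
qed

lemma pure_zero:
  assumes "xs \<in> lists HH" "ys \<in> lists HH"
  shows "pure (xs @ cls 0 # ys) = 0"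
proof -
  have z: "0 \<odot> cls 0 = cls 0" by (simp add: zero_fun_def[symmetric])
  have "pure (xs @ cls 0 # ys) = fun_scale 0 (pure (xs @ cls 0 # ys))"
    using pure_scale[OF assms cls_in_HH[OF zero_cocycle], of 0] unfolding z .
  then show ?thesis by (simp add: fun_scale_def zero_fun_def)
qed

lemma pure_zeros [simp]:
  "pure [cls 0] = 0"
  "Y \<in> HH \<Longrightarrow> pure [cls 0, Y] = 0" "X \<in> HH \<Longrightarrow> pure [X, cls 0] = 0"
  "X \<in> HH \<Longrightarrow> Y \<in> HH \<Longrightarrow> pure [X, Y, cls 0] = 0"
  using pure_zero[of "[]" "[]"] pure_zero[of "[]" "[Y]"] pure_zero[of "[X]" "[]"] pure_zero[of
      "[X, Y]" "[]"] by simp_all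

lemma pure2_add:
  "X \<in> HH \<Longrightarrow> X' \<in> HH \<Longrightarrow> Y \<in> HH \<Longrightarrow> pure [X \<oplus> X', Y] = pure [X, Y] + pure [X', Y]"
  "X \<in> HH \<Longrightarrow> Y \<in> HH \<Longrightarrow> Y' \<in> HH \<Longrightarrow> pure [X, Y \<oplus> Y'] = pure [X, Y] + pure [X, Y']"
  "X \<in> HH \<Longrightarrow> Y \<in> HH \<Longrightarrow> pure [c \<odot> X, Y] = fun_scale c (pure [X, Y])"
  "X \<in> HH \<Longrightarrow> Y \<in> HH \<Longrightarrow> pure [X, c \<odot> Y] = fun_scale c (pure [X, Y])"
  using pure_add[of "[]" "[Y]" X X'] pure_add[of "[X]" "[]" Y Y']
    pure_scale[of "[]" "[Y]" X c] pure_scale[of "[X]" "[]" Y c] by simp_all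

lemma pure3_add:
  "X \<in> HH \<Longrightarrow> Y \<in> HH \<Longrightarrow> Y' \<in> HH \<Longrightarrow> Z \<in> HH \<Longrightarrow> pure [X, Y \<oplus> Y', Z] = pure [X, Y, Z] + pure [X, Y', Z]"
  "X \<in> HH \<Longrightarrow> Y \<in> HH \<Longrightarrow> Z \<in> HH \<Longrightarrow> Z' \<in> HH \<Longrightarrow> pure [X, Y, Z \<oplus> Z'] = pure [X, Y, Z] + pure [X, Y, Z']"
  "X \<in> HH \<Longrightarrow> Y \<in> HH \<Longrightarrow> Z \<in> HH \<Longrightarrow> pure [X, c \<odot> Y, Z] = fun_scale c (pure [X, Y, Z])"
  "X \<in> HH \<Longrightarrow> Y \<in> HH \<Longrightarrow> Z \<in> HH \<Longrightarrow> pure [X, Y, c \<odot> Z] = fun_scale c (pure [X, Y, Z])"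
  using pure_add[of "[X]" "[Z]" Y Y'] pure_add[of "[X, Y]" "[]" Z Z']
    pure_scale[of "[X]" "[Z]" Y c] pure_scale[of "[X, Y]" "[]" Z c] by simp_all

lemma bilinear_pure2: "bilinear fun_scale (\<lambda>x y. pure [scalar_class (x * a), scalar_class (y * b)])"
  by (simp add: bilinear_def scalar_class_add scalar_class_scale pure2_add distrib_right
      scale_mult_left)

lemma bilinear_pure3:
  "X \<in> HH \<Longrightarrow> bilinear fun_scale (\<lambda>x y. pure [X, scalar_class (a * x), scalar_class (y * b)])"
  by (simp add: bilinear_def scalar_class_add scalar_class_scale pure3_add distrib_left distrib_right
      scale_mult_left scale_mult_right)

text \<open>
  The coproduct of every class turns out to have this form.
\<close>

definition casimir :: "'a \<Rightarrow> ('a cochain set, 'k) tensor" where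
  "casimir a = (\<Sum>e\<in>Basis. pure [scalar_class (dual_basis e), scalar_class (e * a)])"

lemma sum_list_sum_swap:
  "(\<Sum>q\<leftarrow>qs. \<Sum>e\<in>I. F q e) = (\<Sum>e\<in>I. \<Sum>q\<leftarrow>qs. F q e :: 'v::comm_monoid_add)"
  by (induction qs) (simp_all add: sum.distrib)

text \<open>
  In a representation \<open>\<Sum> f' \<otimes> f''\<close> of the coproduct, the first factors are elements of the
  algebra. They are expanded in the dual basis, and the second factors are collected. By
  nondegeneracy of the inner product the coefficient of \<open>e\<^sup>*\<close> is \<open>e \<chi> g\<close>, whose class depends on
  \<open>g []\<close> only. Coboundaries vanish on \<open>[]\<close>, so a different choice of \<open>g\<close> in the class gives the
  same tensor.
\<close>

lemma coproduct_values_cls: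
  assumes f: "f \<in> cocycles" and t: "t \<in> coproduct_values (cls f)"
  shows "t = casimir (euler * f [])"
proof -
  obtain g ps where g: "g \<in> cls f" and ps: "represents_coproduct ps g"
    and t: "t = (\<Sum>(f', f'')\<leftarrow>ps. pure [cls f', cls f''])"
    using t unfolding coproduct_values_def by blast
  have gc: "g \<in> cocycles" and fg: "f - g \<in> coboundaries" using g by (auto simp: mem_cls)
  have "f [] = g []"
  proof -
    obtain h where "f - g = \<delta> h" using fg by (auto simp: coboundaries_def)
    then have "(f - g) [] = 0" by (simp add: differential_def)
    then show ?thesis by simp
  qed
  have deg: "f' = degree_zero (f' [])" "f'' \<in> cocycles" if "(f', f'') \<in> set ps" for f' f''
  proof -
    have "homogeneous 0 f'" and "f'' \<in> cocycles" using ps that by (auto simp: represents_coproduct_iff)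
    then show "f' = degree_zero (f' [])" "f'' \<in> cocycles"
      by (auto simp: homogeneous_def degree_zero_def fun_eq_iff)
  qed
  have expand: "pure [scalar_class c, Y] = (\<Sum>e\<in>Basis. fun_scale \<langle>c, e\<rangle> (pure [scalar_class (dual_basis
      e), Y]))"
    if Y: "Y \<in> HH" for c Y
  proof -
    have "pure [scalar_class (\<Sum>e\<in>Basis. \<langle>c, e\<rangle> *s dual_basis e), Y] =
        (\<Sum>e\<in>Basis. pure [scalar_class (\<langle>c, e\<rangle> *s dual_basis e), Y])"
      by (rule additive_sum) (simp only: scalar_class_add pure2_add Y scalar_class_HH)
    then show ?thesis
      by (simp only: expand_dual_basis scalar_class_scale pure2_add Y scalar_class_HH)
  qed
  \<comment> \<open>For a fixed basis element \<open>e\<close> the second factors are combined into one cocycle.\<close>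
  have collect: "(\<Sum>(f', f'')\<leftarrow>qs. fun_scale \<langle>f' [], e\<rangle> (pure [X, cls f''])) =
      pure [X, cls (\<lambda>as. \<Sum>(f', f'')\<leftarrow>qs. \<langle>f' [], e\<rangle> *s f'' as)] \<and>
      (\<lambda>as. \<Sum>(f', f'')\<leftarrow>qs. \<langle>f' [], e\<rangle> *s f'' as) \<in> cocycles"
    if "\<And>f' f''. (f', f'') \<in> set qs \<Longrightarrow> f'' \<in> cocycles" "X \<in> HH" for X e qs
    using that(1)
  proof (induction qs)
    case Nil
    show ?case using that(2) zero_cocycle by (simp add: zero_fun_def[symmetric])
  next
    case (Cons q qs)
    obtain f' f'' where q: "q = (f', f'')" by (cases q)
    let ?s = "\<lambda>as. \<Sum>(f', f'')\<leftarrow>qs. \<langle>f' [], e\<rangle> *s f'' as"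
    have p: "h \<in> cocycles" if "(h', h) \<in> set qs" for h' h
      using Cons.prems[of h' h] that by simp
    have c: "f'' \<in> cocycles" using Cons.prems[of f' f''] q by simp
    have "(\<Sum>(f', f'')\<leftarrow>qs. fun_scale \<langle>f' [], e\<rangle> (pure [X, cls f''])) = pure [X, cls ?s] \<and> ?s \<in> cocycles"
      by (rule Cons.IH) (rule p)
    then have s: "?s \<in> cocycles" and IH: "(\<Sum>(f', f'')\<leftarrow>qs. fun_scale \<langle>f' [], e\<rangle> (pure [X, cls f'']))
        = pure [X, cls ?s]"
      by blast+
    have e: "(\<lambda>as. \<Sum>(f', f'')\<leftarrow>q # qs. \<langle>f' [], e\<rangle> *s f'' as) = (\<lambda>as. \<langle>f' [], e\<rangle> *s f'' as) + ?s"
      by (simp add: q fun_eq_iff)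
    have "cls ((\<lambda>as. \<langle>f' [], e\<rangle> *s f'' as) + ?s) = \<langle>f' [], e\<rangle> \<odot> cls f'' \<oplus> cls ?s"
      using c s by simp
    then have "pure [X, cls ((\<lambda>as. \<langle>f' [], e\<rangle> *s f'' as) + ?s)]
        = fun_scale \<langle>f' [], e\<rangle> (pure [X, cls f'']) + pure [X, cls ?s]"
      using c s that(2) by (simp only: pure2_add cls_in_HH HH_closed)
    then show ?case
      unfolding e using add_cocycle[OF scale_cocycle[OF c] s] by (simp add: IH q)
  qed
  have "t = (\<Sum>(f', f'')\<leftarrow>ps. \<Sum>e\<in>Basis. fun_scale \<langle>f' [], e\<rangle> (pure [scalar_class (dual_basis e), cls
      f'']))"
    unfolding t
  proof (rule arg_cong[of _ _ sum_list], rule map_cong[OF refl], clarify)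
    fix f' f'' assume "(f', f'') \<in> set ps"
    from deg[OF this] have "cls f' = scalar_class (f' [])" "cls f'' \<in> HH"
      by (simp_all add: scalar_class_def cls_in_HH)
    then show "pure [cls f', cls f''] = (\<Sum>e\<in>Basis. fun_scale \<langle>f' [], e\<rangle> (pure [scalar_class
        (dual_basis e), cls f'']))"
      using expand by simp
  qed
  also have "\<dots> = (\<Sum>e\<in>Basis. \<Sum>(f', f'')\<leftarrow>ps. fun_scale \<langle>f' [], e\<rangle> (pure [scalar_class (dual_basis e),
      cls f'']))"
    unfolding case_prod_beta by (rule sum_list_sum_swap)
  also have "\<dots> = (\<Sum>e\<in>Basis. pure [scalar_class (dual_basis e), cls (\<lambda>as. e * euler * g as)])"
  proof (rule sum.cong[OF refl])
    fix e
    have "(\<lambda>as. \<Sum>(f', f'')\<leftarrow>ps. \<langle>f' [], e\<rangle> *s f'' as) = (\<lambda>as. e * euler * g as)"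
      using ps by (simp add: represents_coproduct_iff)
    then show "(\<Sum>(f', f'')\<leftarrow>ps. fun_scale \<langle>f' [], e\<rangle> (pure [scalar_class (dual_basis e), cls f''])) =
      pure [scalar_class (dual_basis e), cls (\<lambda>as. e * euler * g as)]"
      using collect[of ps "scalar_class (dual_basis e)" e] deg(2) by simp
  qed
  also have "\<dots> = casimir (euler * f [])"
    unfolding euler_class[OF gc] by (simp only: casimir_def \<open>f [] = g []\<close> mult.assoc)
  finally show ?thesis .
qed

lemma coproduct_unique:
  assumes f: "f \<in> cocycles"
  shows "\<exists>!t. t \<in> coproduct_values (cls f)" "coproduct (cls f) = casimir (euler * f [])"
proof -
  obtain ps where "represents_coproduct ps f" using coproduct_representative[OF f] by metis
  moreover have "f \<in> cls f" using f by (simp add: mem_cls coboundaries_zero)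
  ultimately have "(\<Sum>(f', f'')\<leftarrow>ps. pure [cls f', cls f'']) \<in> coproduct_values (cls f)"
    unfolding coproduct_values_def by blast
  then show 1: "\<exists>!t. t \<in> coproduct_values (cls f)"
    using coproduct_values_cls[OF f] by (intro ex_ex1I) auto
  show "coproduct (cls f) = casimir (euler * f [])"
    unfolding coproduct_def using theI'[OF 1] by (rule coproduct_values_cls[OF f])
qed

lemma casimir_tensors: "casimir a \<in> tensors"
  unfolding casimir_def by (intro tensors_sum pure_tensors) simp

lemma casimir_add: "casimir (a + b) = casimir a + casimir b"
  by (simp add: casimir_def distrib_left scalar_class_add pure2_add sum.distrib)

lemma casimir_scale: "casimir (c *s a) = fun_scale c (casimir a)"
  by (simp add: casimir_def scale_mult_right scalar_class_scale pure2_add fun_space.scale_sum_right)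

lemma casimir_zero: "casimir 0 = 0"
  by (simp add: casimir_def scalar_class_zero)

lemma coproduct_tensors: "X \<in> HH \<Longrightarrow> coproduct X \<in> tensors"
  by (auto elim!: HH_cls simp: coproduct_unique casimir_tensors)

lemma coproduct_add: "X \<in> HH \<Longrightarrow> Y \<in> HH \<Longrightarrow> coproduct (X \<oplus> Y) = coproduct X + coproduct Y"
  by (auto elim!: HH_cls simp: coproduct_unique distrib_left casimir_add)

lemma coproduct_scale: "X \<in> HH \<Longrightarrow> coproduct (c \<odot> X) = fun_scale c (coproduct X)"
  by (auto elim!: HH_cls simp: coproduct_unique scale_mult_right casimir_scale)

lemma coproduct_scalar_class: "coproduct (scalar_class c) = casimir (euler * c)"
  by (simp add: scalar_class_def coproduct_unique) (simp add: degree_zero_def)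

lemma HH_linear_hDelta: "HH_linear hDelta"
  by (rule HH_linearI) (simp_all add: cls_in_HH Delta_add Delta_scale cocycles_cochain)

lemma HH_linear_hreversal: "HH_linear hreversal"
proof (rule HH_linearI)
  fix f g assume "f \<in> cocycles" "g \<in> cocycles"
  moreover have "reversal (f + g) = reversal f + reversal g"
    by (simp add: fun_eq_iff reversal_eq signed_add)
  ultimately show "hreversal (cls (f + g)) = hreversal (cls f) \<oplus> hreversal (cls g)" by simp
next
  fix c f assume "f \<in> cocycles"
  moreover have "reversal (\<lambda>as. c *s f as) = (\<lambda>as. c *s reversal f as)"
    by (auto simp: fun_eq_iff reversal_eq signed_def)
  ultimately show "hreversal (cls (\<lambda>as. c *s f as)) = c \<odot> hreversal (cls f)" by simp
qed (simp add: cls_in_HH)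

lemma HH_linear_cup:
  assumes "X \<in> HH"
  shows "HH_linear (\<lambda>Y. X \<smile>\<^sub>H Y)" "HH_linear (\<lambda>Y. Y \<smile>\<^sub>H X)"
  using assms by (auto elim!: HH_cls intro!: HH_linearI
      simp: cls_in_HH cup_add_left cup_add_right cup_scale_left cup_scale_right)

lemma HH_linear_parts: "HH_linear heven" "HH_linear hodd"
proof -
  have "even_part (\<lambda>as. c *s f as) = (\<lambda>as. c *s even_part f as)"
    "odd_part (\<lambda>as. c *s f as) = (\<lambda>as. c *s odd_part f as)" for c f
    by (auto simp: fun_eq_iff even_part_def odd_part_def)
  then show "HH_linear heven" "HH_linear hodd"
    by (auto intro!: HH_linearI simp: cls_in_HH even_part_add odd_part_add)
qed

lemma HH_linearD:
  assumes "HH_linear F"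
  shows "X \<in> HH \<Longrightarrow> F X \<in> HH" "X \<in> HH \<Longrightarrow> Y \<in> HH \<Longrightarrow> F (X \<oplus> Y) = F X \<oplus> F Y"
    "X \<in> HH \<Longrightarrow> F (c \<odot> X) = c \<odot> F X"
  using assms by (auto simp: HH_linear_def)

lemma pure1_add:
  "X \<in> HH \<Longrightarrow> Y \<in> HH \<Longrightarrow> pure [X \<oplus> Y] = pure [X] + pure [Y]"
  "X \<in> HH \<Longrightarrow> pure [c \<odot> X] = fun_scale c (pure [X])"
  using pure_add[of "[]" "[]" X Y] pure_scale[of "[]" "[]" X c] by simp_all

lemma multilinear_map_operations:
  shows multilinear_map_mu: "multilinear_map (\<lambda>zs. case zs of [X, Y] \<Rightarrow> pure [X \<smile>\<^sub>H Y] | _ \<Rightarrow> 0)"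
    and multilinear_map_vee: "multilinear_map (\<lambda>zs. case zs of [X] \<Rightarrow> coproduct X | _ \<Rightarrow> 0)"
    and multilinear_map_bv: "multilinear_map (\<lambda>zs. case zs of [X] \<Rightarrow> pure [hDelta X] | _ \<Rightarrow> 0)"
    and multilinear_map_tilde: "multilinear_map (\<lambda>zs. case zs of [X] \<Rightarrow> pure [hreversal X] | _ \<Rightarrow> 0)"
    and multilinear_map_swap: "multilinear_map
      (\<lambda>zs. case zs of [X, Y] \<Rightarrow> pure [heven Y, X] + pure [hodd Y, hsign X] | _ \<Rightarrow> 0)"
  by (rule multilinear_map_case1 multilinear_map_case2;
      simp add: pure_tensors tensors_add coproduct_tensors coproduct_add coproduct_scale pure1_add
          pure2_add
        HH_linearD(2,3)[OF HH_linear_hDelta] HH_linearD(2,3)[OF HH_linear_hreversal]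
        HH_linearD(2,3)[OF HH_linear_hsign] HH_linearD(2,3)[OF HH_linear_parts(1)] HH_linearD(2,3)[OF
            HH_linear_parts(2)]
        HH_linearD(2,3)[OF HH_linear_cup(1)] HH_linearD(2,3)[OF HH_linear_cup(2)]
            fun_space.scale_right_distrib)+

lemmas operations_hom =
  tensor_hom_lin_ext[OF multilinear_map_mu, folded mu_def]
  tensor_hom_lin_ext[OF multilinear_map_vee, folded vee_def]
  tensor_hom_lin_ext[OF multilinear_map_bv, folded bv_def]
  tensor_hom_lin_ext[OF multilinear_map_tilde, folded tilde_def]
  tensor_hom_lin_ext[OF multilinear_map_swap, folded swap_def]
  tensor_hom_id tensor_hom_comp tensor_hom_tensor_map

lemma operations_pure [simp]:
  "X \<in> HH \<Longrightarrow> Y \<in> HH \<Longrightarrow> \<mu> (pure [X, Y]) = pure [X \<smile>\<^sub>H Y]"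
  "X \<in> HH \<Longrightarrow> \<nu> (pure [X]) = coproduct X"
  "X \<in> HH \<Longrightarrow> \<Delta> (pure [X]) = pure [hDelta X]"
  "X \<in> HH \<Longrightarrow> \<rho> (pure [X]) = pure [hreversal X]"
  "X \<in> HH \<Longrightarrow> Y \<in> HH \<Longrightarrow> \<tau> (pure [X, Y]) = pure [heven Y, X] + pure [hodd Y, hsign X]"
  using lin_ext_pure[OF multilinear_map_mu, of "[X, Y]"] lin_ext_pure[OF multilinear_map_vee, of "[X]"]
    lin_ext_pure[OF multilinear_map_bv, of "[X]"] lin_ext_pure[OF multilinear_map_tilde, of "[X]"]
    lin_ext_pure[OF multilinear_map_swap, of "[X, Y]"]
  unfolding mu_def vee_def bv_def tilde_def swap_def by simp_all

lemma tensor_map_pure_simps: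
  assumes "tensor_hom F" "tensor_hom G" "X \<in> HH" "Y \<in> HH"
  shows "(F \<otimes>[1,d] G) (pure [X, Y]) = F (pure [(hsign ^^ d) X]) \<cdot> G (pure [Y])"
    and "Z \<in> HH \<Longrightarrow> (F \<otimes>[1,d] G) (pure [X, Y, Z]) = F (pure [(hsign ^^ d) X]) \<cdot> G (pure [Y, Z])"
    and "Z \<in> HH \<Longrightarrow> (F \<otimes>[2,0] G) (pure [X, Y, Z]) = F (pure [X, Y]) \<cdot> G (pure [Z])"
  using tensor_map_pure[OF assms(1,2), of "[X, Y]" 1 d] tensor_map_pure[OF assms(1,2), of
      "[X, Y, Z]" 1 d]
    tensor_map_pure[OF assms(1,2), of "[X, Y, Z]" 2 0] assms by (simp_all add: numeral_2_eq_2)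

text \<open>
  The simplifier rewrites \<open>1\<close> to \<open>Suc 0\<close> in the indices of \<open>\<otimes>[m,d]\<close>; both forms are provided.
\<close>

lemmas tensor_map_simps = tensor_map_pure_simps tensor_map_pure_simps[unfolded One_nat_def]

lemma pure_mult_simps [simp]:
  "X \<in> HH \<Longrightarrow> Y \<in> HH \<Longrightarrow> pure [X] \<cdot> pure [Y] = pure [X, Y]"
  "X \<in> HH \<Longrightarrow> Y \<in> HH \<Longrightarrow> Z \<in> HH \<Longrightarrow> pure [X, Y] \<cdot> pure [Z] = pure [X, Y, Z]"
  "X \<in> HH \<Longrightarrow> Y \<in> HH \<Longrightarrow> Z \<in> HH \<Longrightarrow> pure [X] \<cdot> pure [Y, Z] = pure [X, Y, Z]"
  by (simp_all add: pure_mult_pure)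

lemma HH_zero [simp]: "cls 0 \<in> HH"
  by (simp add: cls_in_HH)


section \<open>The identities on pure tensors\<close>

lemma euler_cup:
  assumes "f \<in> cocycles"
  shows "scalar_class (c * euler) \<smile>\<^sub>H cls f = scalar_class (c * euler * f [])"
    and "cls f \<smile>\<^sub>H scalar_class (c * euler) = scalar_class (c * euler * f [])"
  using assms by (simp_all only: cup_scalar_class euler_class)

lemma tensor_hom_sum: "tensor_hom L \<Longrightarrow> L (\<Sum>i\<in>I. t i) = (\<Sum>i\<in>I. L (t i))"
  by (rule tensor_linear_sum[OF tensor_hom_linear])

text \<open>
  The invariance of the Casimir element brings the coproduct of the first factor into the form
  that arises from the coproduct of the second factor in the next lemma.
\<close>

lemma vee_casimir_left:
  "(\<nu> \<otimes>[1,0] id) (casimir a) =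
     (\<Sum>d\<in>Basis. \<Sum>e\<in>Basis. pure [scalar_class (dual_basis d), scalar_class (dual_basis e), scalar_class
         (d * euler * e * a)])"
proof -
  have "(\<nu> \<otimes>[1,0] id) (casimir a) =
    (\<Sum>e\<in>Basis. (\<nu> \<otimes>[1,0] id) (pure [scalar_class (dual_basis e), scalar_class (e * a)]))"
    unfolding casimir_def by (intro tensor_hom_sum operations_hom)
  also have "\<dots> = (\<Sum>e\<in>Basis. \<Sum>d\<in>Basis. pure [scalar_class (dual_basis d), scalar_class (d * euler *
      dual_basis e), scalar_class (e * a)])"
    by (simp add: tensor_map_simps operations_hom coproduct_scalar_class casimir_def tensor_mult_left
        mult.assoc)
  also have "\<dots> = (\<Sum>d\<in>Basis. \<Sum>e\<in>Basis. pure [scalar_class (dual_basis d), scalar_class (dual_basis e *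
      (d * euler)), scalar_class (e * a)])"
    by (subst sum.swap) (simp add: mult_ac)
  also have "\<dots> = (\<Sum>d\<in>Basis. \<Sum>e\<in>Basis. pure [scalar_class (dual_basis d), scalar_class (dual_basis e),
      scalar_class (d * euler * e * a)])"
    using casimir_mult[OF bilinear_pure3[of "scalar_class (dual_basis _)" 1 a]] by simp
  finally show ?thesis .
qed

lemma vee_casimir_right:
  "(id \<otimes>[1,0] \<nu>) (casimir a) =
     (\<Sum>d\<in>Basis. \<Sum>e\<in>Basis. pure [scalar_class (dual_basis d), scalar_class (dual_basis e), scalar_class
         (d * euler * e * a)])"
proof -
  have "(id \<otimes>[1,0] \<nu>) (casimir a) =
    (\<Sum>e\<in>Basis. (id \<otimes>[1,0] \<nu>) (pure [scalar_class (dual_basis e), scalar_class (e * a)]))"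
    unfolding casimir_def by (intro tensor_hom_sum operations_hom)
  also have "\<dots> = (\<Sum>d\<in>Basis. pure [scalar_class (dual_basis d)] \<cdot> casimir (euler * (d * a)))"
    by (simp add: tensor_map_simps operations_hom coproduct_scalar_class)
  also have "\<dots> = (\<Sum>d\<in>Basis. \<Sum>e\<in>Basis. pure [scalar_class (dual_basis d), scalar_class (dual_basis e),
      scalar_class (d * euler * e * a)])"
    by (simp add: casimir_def tensor_mult_sum_right pure_tensors mult_ac)
  finally show ?thesis .
qed

text \<open>
  All classes involved have degree 0, so there are no signs, and the Casimir element is symmetric.
\<close>

lemma swap_casimir: "\<tau> (casimir a) = casimir a"
proof -
  have "\<tau> (casimir a) = (\<Sum>e\<in>Basis. \<tau> (pure [scalar_class (dual_basis e), scalar_class (e * a)]))"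
    unfolding casimir_def by (intro tensor_hom_sum operations_hom)
  also have "\<dots> = (\<Sum>e\<in>Basis. pure [scalar_class (e * a), scalar_class (dual_basis e)])"
    by simp
  also have "\<dots> = (\<Sum>e\<in>Basis. pure [scalar_class (dual_basis e * a), scalar_class e])"
    using casimir_commute[OF bilinear_pure2[of a 1]] by simp
  also have "\<dots> = casimir a"
    using casimir_mult[OF bilinear_pure2[of 1 1], of a] by (simp add: casimir_def mult.commute)
  finally show ?thesis .
qed

text \<open>
  The coproduct of either factor contains \<open>\<chi>\<close>. Multiplying the other factor by \<open>\<chi>\<close> leaves its
  component of degree 0. In the second identity \<open>\<chi>\<close> has to be moved to the factor that is
  multiplied by \<open>X\<close> first.
\<close>

lemma vee_mu:
  assumes "X \<in> HH" "Y \<in> HH"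
  shows "(id \<otimes>[1,0] \<mu>) ((\<nu> \<otimes>[1,0] id) (pure [X, Y])) = \<nu> (\<mu> (pure [X, Y]))"
    and "(\<mu> \<otimes>[2,0] id) ((id \<otimes>[1,0] \<nu>) (pure [X, Y])) = \<nu> (\<mu> (pure [X, Y]))"
proof -
  obtain f g where f: "f \<in> cocycles" "X = cls f" and g: "g \<in> cocycles" "Y = cls g"
    using assms by (auto elim!: HH_cls)
  have "\<nu> (\<mu> (pure [X, Y])) = coproduct (cls (f \<smile> g))"
    using f g by (simp add: cls_in_HH)
  also have "\<dots> = casimir (euler * f [] * g [])"
    using coproduct_unique(2)[OF cup_cocycle[OF f(1) g(1)]] by (simp add: cup_def mult.assoc)
  finally have 0: "\<nu> (\<mu> (pure [X, Y])) = casimir (euler * f [] * g [])" .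
  have "(id \<otimes>[1,0] \<mu>) ((\<nu> \<otimes>[1,0] id) (pure [X, Y])) =
    (id \<otimes>[1,0] \<mu>) (\<Sum>e\<in>Basis. pure [scalar_class (dual_basis e), scalar_class (e * f [] * euler), Y])"
    using assms f by (simp add: tensor_map_simps operations_hom coproduct_unique casimir_def
        tensor_mult_left mult_ac)
  also have "\<dots> = (\<Sum>e\<in>Basis. (id \<otimes>[1,0] \<mu>) (pure [scalar_class (dual_basis e), scalar_class (e * f [] *
      euler), Y]))"
    by (intro tensor_hom_sum operations_hom)
  also have "\<dots> = casimir (euler * f [] * g [])"
    using assms by (simp add: tensor_map_simps operations_hom g euler_cup casimir_def) (simp add:
        mult_ac)
  finally show "(id \<otimes>[1,0] \<mu>) ((\<nu> \<otimes>[1,0] id) (pure [X, Y])) = \<nu> (\<mu> (pure [X, Y]))"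
    by (simp only: 0)
  have b: "bilinear fun_scale (\<lambda>x y. pure [X \<smile>\<^sub>H scalar_class x, scalar_class (y * g [])])"
    using assms(1) by (simp add: bilinear_def scalar_class_add scalar_class_scale pure2_add
        distrib_right scale_mult_left
        HH_linearD(2,3)[OF HH_linear_cup(1)])
  have "(\<mu> \<otimes>[2,0] id) ((id \<otimes>[1,0] \<nu>) (pure [X, Y])) =
    (\<mu> \<otimes>[2,0] id) (\<Sum>e\<in>Basis. pure [X, scalar_class (dual_basis e), scalar_class (euler * e * g [])])"
    using assms g by (simp add: tensor_map_simps operations_hom coproduct_unique casimir_def
        tensor_mult_sum_right pure_tensors) (simp add: mult_ac)
  also have "\<dots> = (\<Sum>e\<in>Basis. (\<mu> \<otimes>[2,0] id) (pure [X, scalar_class (dual_basis e), scalar_class (euler *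
      e * g [])]))"
    by (intro tensor_hom_sum operations_hom)
  also have "\<dots> = (\<Sum>e\<in>Basis. pure [X \<smile>\<^sub>H scalar_class (dual_basis e), scalar_class (euler * e * g [])])"
    using assms by (simp add: tensor_map_simps operations_hom)
  also have "\<dots> = (\<Sum>e\<in>Basis. pure [X \<smile>\<^sub>H scalar_class (dual_basis e * euler), scalar_class (e * g [])])"
    using casimir_mult[OF b, of euler] by simp
  also have "\<dots> = (\<Sum>e\<in>Basis. pure [scalar_class (dual_basis e * (euler * f [])), scalar_class (e * g
      [])])"
    by (simp add: f euler_cup mult.assoc)
  also have "\<dots> = (\<Sum>e\<in>Basis. pure [scalar_class (dual_basis e), scalar_class (euler * f [] * e * g [])])"
    using casimir_mult[OF bilinear_pure2[of 1 "g []"], of "euler * f []"] by simp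
  also have "\<dots> = casimir (euler * f [] * g [])"
    by (simp add: casimir_def mult_ac)
  finally show "(\<mu> \<otimes>[2,0] id) ((id \<otimes>[1,0] \<nu>) (pure [X, Y])) = \<nu> (\<mu> (pure [X, Y]))"
    by (simp only: 0)
qed

text \<open>
  In all terms but the first, \<open>\<Delta>\<close> is applied to classes of degree 0. The first term contains the
  square of the Euler element times \<open>\<Delta> f []\<close>.
\<close>

lemma coBV_pure:
  assumes X: "X \<in> HH"
  shows "(\<nu> \<otimes>[1,0] id) (\<nu> (\<Delta> (pure [X]))) = 0"
    and "((\<nu> \<circ> \<Delta>) \<otimes>[1,0] id) (\<nu> (pure [X])) = 0"
    and "(id \<otimes>[1,1] (\<nu> \<circ> \<Delta>)) (\<nu> (pure [X])) = 0"
    and "(\<Delta> \<otimes>[1,0] (id \<otimes>[1,0] id)) ((\<nu> \<otimes>[1,0] id) (\<nu> (pure [X]))) = 0"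
    and "(id \<otimes>[1,1] (\<Delta> \<otimes>[1,0] id)) ((\<nu> \<otimes>[1,0] id) (\<nu> (pure [X]))) = 0"
    and "(id \<otimes>[1,1] (id \<otimes>[1,1] \<Delta>)) ((\<nu> \<otimes>[1,0] id) (\<nu> (pure [X]))) = 0"
proof -
  obtain f where f: "f \<in> cocycles" "X = cls f" using X by (rule HH_cls)
  have D0: "coproduct (cls 0) = 0"
    using coproduct_unique(2)[OF zero_cocycle] by (simp add: casimir_zero)
  have nd: "\<nu> 0 = 0"
    by (rule tensor_linear_zero[OF tensor_hom_linear[OF operations_hom(2)]])
  have v: "\<nu> (pure [X]) = casimir (euler * f [])"
    using X by (simp add: f coproduct_unique)
  let ?a = "euler * f []"
  have "\<nu> (\<Delta> (pure [X])) = casimir (euler * Delta f [])"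
    using X f cls_in_HH[OF Delta_cocycle[OF f(1)]] by (simp add: coproduct_unique)
  moreover have "d * euler * e * (euler * Delta f []) = 0" for d e
    using euler_euler_Delta[OF f(1)] by (metis mult.assoc mult.commute mult_zero_right)
  ultimately show "(\<nu> \<otimes>[1,0] id) (\<nu> (\<Delta> (pure [X]))) = 0"
    by (simp add: vee_casimir_left[unfolded One_nat_def] scalar_class_zero)
  have "((\<nu> \<circ> \<Delta>) \<otimes>[1,0] id) (casimir ?a) = (\<Sum>e\<in>Basis. ((\<nu> \<circ> \<Delta>) \<otimes>[1,0] id) (pure [scalar_class
      (dual_basis e), scalar_class (e * ?a)]))"
    unfolding casimir_def by (intro tensor_hom_sum operations_hom)
  then show "((\<nu> \<circ> \<Delta>) \<otimes>[1,0] id) (\<nu> (pure [X])) = 0"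
    by (simp add: v tensor_map_simps operations_hom nd D0 tensor_mult_left)
  have "(id \<otimes>[1,1] (\<nu> \<circ> \<Delta>)) (casimir ?a) = (\<Sum>e\<in>Basis. (id \<otimes>[1,1] (\<nu> \<circ> \<Delta>)) (pure [scalar_class
      (dual_basis e), scalar_class (e * ?a)]))"
    unfolding casimir_def by (intro tensor_hom_sum operations_hom)
  then show "(id \<otimes>[1,1] (\<nu> \<circ> \<Delta>)) (\<nu> (pure [X])) = 0"
    by (simp add: v tensor_map_simps operations_hom nd D0 tensor_mult_zero_right pure_tensors)
  have u: "L ((\<nu> \<otimes>[1,0] id) (\<nu> (pure [X]))) = 0"
    if "tensor_hom L" "\<And>a b c. L (pure [scalar_class a, scalar_class b, scalar_class c]) = 0" for L
    by (simp only: v vee_casimir_left tensor_hom_sum that sum.neutral_const)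
  show "(\<Delta> \<otimes>[1,0] (id \<otimes>[1,0] id)) ((\<nu> \<otimes>[1,0] id) (\<nu> (pure [X]))) = 0"
    by (rule u[of "\<Delta> \<otimes>[1,0] (id \<otimes>[1,0] id)"]) (simp_all add: operations_hom tensor_map_simps
        tensor_mult_left)
  show "(id \<otimes>[1,1] (\<Delta> \<otimes>[1,0] id)) ((\<nu> \<otimes>[1,0] id) (\<nu> (pure [X]))) = 0"
    by (rule u[of "id \<otimes>[1,1] (\<Delta> \<otimes>[1,0] id)"]) (simp_all add: operations_hom tensor_map_simps
        tensor_mult_left tensor_mult_zero_right pure_tensors)
  show "(id \<otimes>[1,1] (id \<otimes>[1,1] \<Delta>)) ((\<nu> \<otimes>[1,0] id) (\<nu> (pure [X]))) = 0"
    by (rule u[of "id \<otimes>[1,1] (id \<otimes>[1,1] \<Delta>)"]) (simp_all add: operations_hom tensor_map_simps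
        tensor_mult_left tensor_mult_zero_right pure_tensors)
qed


lemma BV_cls:
  assumes f: "f \<in> cocycles" and g: "g \<in> cocycles" and h: "h \<in> cocycles"
  shows "pure [hDelta (cls f \<smile>\<^sub>H cls g \<smile>\<^sub>H cls h)] =
     pure [hDelta (cls f \<smile>\<^sub>H cls g) \<smile>\<^sub>H cls h]
     + pure [hsign (cls f) \<smile>\<^sub>H hDelta (cls g \<smile>\<^sub>H cls h)]
     + (pure [hDelta (cls f \<smile>\<^sub>H heven (cls h)) \<smile>\<^sub>H cls g]
        + pure [hDelta (cls f \<smile>\<^sub>H hodd (cls h)) \<smile>\<^sub>H hsign (cls g)])
     - (pure [hDelta (cls f) \<smile>\<^sub>H cls g \<smile>\<^sub>H cls h]
        + pure [hsign (cls f) \<smile>\<^sub>H hDelta (cls g) \<smile>\<^sub>H cls h]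
        + pure [hsign (cls f) \<smile>\<^sub>H hsign (cls g) \<smile>\<^sub>H hDelta (cls h)])"
proof -
  have P: "pure [cls (a + b)] = pure [cls a] + pure [cls b]" if "a \<in> cocycles" "b \<in> cocycles" for a b
    using pure1_add(1)[of "cls a" "cls b"] that by (simp add: cls_in_HH)
  let ?L = "Delta (f \<smile> g \<smile> h) + (Delta f \<smile> g \<smile> h + degree_sign f \<smile> Delta g \<smile> h
      + degree_sign f \<smile> degree_sign g \<smile> Delta h)"
  let ?R = "Delta (f \<smile> g) \<smile> h + degree_sign f \<smile> Delta (g \<smile> h)
     + (Delta (f \<smile> even_part h) \<smile> g + Delta (f \<smile> odd_part h) \<smile> degree_sign g)"
  have "?L - ?R = BV_defect f g h"
    by (simp add: BV_defect_def algebra_simps)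
  then have "?L - ?R \<in> coboundaries"
    using BV_defect_coboundary[OF f g h] by (simp only:)
  then have "cls ?L = cls ?R"
    using f g h by (intro cls_eqI) (simp_all only: cocycle_intros)
  then have "pure [cls ?L] = pure [cls ?R]" by (simp only:)
  then have "pure [cls (Delta (f \<smile> g \<smile> h))] + (pure [cls (Delta f \<smile> g \<smile> h)]
      + pure [cls (degree_sign f \<smile> Delta g \<smile> h)] + pure [cls (degree_sign f \<smile> degree_sign g \<smile> Delta h)])
    = pure [cls (Delta (f \<smile> g) \<smile> h)] + pure [cls (degree_sign f \<smile> Delta (g \<smile> h))]
      + (pure [cls (Delta (f \<smile> even_part h) \<smile> g)]
        + pure [cls (Delta (f \<smile> odd_part h) \<smile> degree_sign g)])"
    using f g h by (simp only: P cocycle_intros)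
  then show ?thesis
    using f g h by (simp add: eq_diff_eq)
qed

lemma BV_pure:
  assumes "X \<in> HH" "Y \<in> HH" "Z \<in> HH"
  shows "\<Delta> (\<mu> ((\<mu> \<otimes>[2,0] id) (pure [X, Y, Z]))) =
          \<mu> (((\<Delta> \<circ> \<mu>) \<otimes>[2,0] id) (pure [X, Y, Z]))
          + \<mu> ((id \<otimes>[1,1] (\<Delta> \<circ> \<mu>)) (pure [X, Y, Z]))
          + \<mu> (((\<Delta> \<circ> \<mu>) \<otimes>[2,0] id) ((id \<otimes>[1,0] \<tau>) (pure [X, Y, Z])))
          - \<mu> ((\<mu> \<otimes>[2,0] id)
              ((\<Delta> \<otimes>[1,0] (id \<otimes>[1,0] id)) (pure [X, Y, Z])
               + (id \<otimes>[1,1] (\<Delta> \<otimes>[1,0] id)) (pure [X, Y, Z])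
               + (id \<otimes>[1,1] (id \<otimes>[1,1] \<Delta>)) (pure [X, Y, Z])))"
proof -
  obtain f g h where c: "f \<in> cocycles" "g \<in> cocycles" "h \<in> cocycles" and X: "X = cls f" "Y = cls g"
      "Z = cls h"
    using assms by (auto elim!: HH_cls)
  have add: "L (s + t) = L s + L t" if "tensor_hom L" for L s t
    using that by (auto simp: tensor_hom_def tensor_linear_def)
  have m: "(\<mu> \<otimes>[2,0] id) (s + t) = (\<mu> \<otimes>[2,0] id) s + (\<mu> \<otimes>[2,0] id) t"
    "((\<Delta> \<circ> \<mu>) \<otimes>[2,0] id) (s + t) = ((\<Delta> \<circ> \<mu>) \<otimes>[2,0] id) s + ((\<Delta> \<circ> \<mu>) \<otimes>[2,0] id) t"
    "\<mu> (s + t) = \<mu> s + \<mu> t" for s t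
    by (rule add; intro operations_hom)+
  have p: "pure [hsign X] \<cdot> (pure [Y, Z] + pure [Y', Z'])
      = pure [hsign X, Y, Z] + pure [hsign X, Y', Z']"
    "pure [X] \<cdot> (pure [Y, Z] + pure [Y', Z']) = pure [X, Y, Z] + pure [X, Y', Z']"
    if "X \<in> HH" "Y \<in> HH" "Z \<in> HH" "Y' \<in> HH" "Z' \<in> HH" for X Y Z Y' Z'
    using that by (simp_all add: tensor_mult_right(1) pure_tensors)
  note hom = operations_hom
  have 1: "\<Delta> (\<mu> ((\<mu> \<otimes>[2,0] id) (pure [X, Y, Z]))) = pure [hDelta (X \<smile>\<^sub>H Y \<smile>\<^sub>H Z)]"
    using assms by (simp add: tensor_map_simps hom)
  have 2: "\<mu> (((\<Delta> \<circ> \<mu>) \<otimes>[2,0] id) (pure [X, Y, Z])) = pure [hDelta (X \<smile>\<^sub>H Y) \<smile>\<^sub>H Z]"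
    using assms by (simp add: tensor_map_simps hom)
  have 3: "\<mu> ((id \<otimes>[1,1] (\<Delta> \<circ> \<mu>)) (pure [X, Y, Z])) = pure [hsign X \<smile>\<^sub>H hDelta (Y \<smile>\<^sub>H Z)]"
    using assms by (simp add: tensor_map_simps hom)
  have t: "(id \<otimes>[1,0] \<tau>) (pure [X, Y, Z]) = pure [X, heven Z, Y] + pure [X, hodd Z, hsign Y]"
    using assms by (simp add: tensor_map_simps hom p)
  have 4: "\<mu> (((\<Delta> \<circ> \<mu>) \<otimes>[2,0] id) ((id \<otimes>[1,0] \<tau>) (pure [X, Y, Z]))) =
      pure [hDelta (X \<smile>\<^sub>H heven Z) \<smile>\<^sub>H Y] + pure [hDelta (X \<smile>\<^sub>H hodd Z) \<smile>\<^sub>H hsign Y]"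
    unfolding t m using assms by (simp add: tensor_map_simps hom)
  have 5: "(\<Delta> \<otimes>[1,0] (id \<otimes>[1,0] id)) (pure [X, Y, Z]) = pure [hDelta X, Y, Z]"
    "(id \<otimes>[1,1] (\<Delta> \<otimes>[1,0] id)) (pure [X, Y, Z]) = pure [hsign X, hDelta Y, Z]"
    "(id \<otimes>[1,1] (id \<otimes>[1,1] \<Delta>)) (pure [X, Y, Z]) = pure [hsign X, hsign Y, hDelta Z]"
    using assms by (simp_all add: tensor_map_simps hom)
  have 6: "\<mu> ((\<mu> \<otimes>[2,0] id) (pure [U, V, W])) = pure [U \<smile>\<^sub>H V \<smile>\<^sub>H W]"
    if "U \<in> HH" "V \<in> HH" "W \<in> HH" for U V W
    using that by (simp add: tensor_map_simps hom)
  show ?thesis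
    unfolding 1 2 3 4 5 m using assms by (simp only: 6 HH_closed) (simp only: X BV_cls[OF c])
qed


section \<open>Verification of the asserted properties\<close>

lemma operations_induced_holds: "operations_induced"
  unfolding operations_induced_def
proof (intro conjI)
  show "descends2 (\<smile>)"
    by (auto simp: descends2_def cup_cochain cup_respects)
  show "descends Delta"
    using Delta_respects by (auto simp: descends_def Delta_cochain)
  show "descends reversal"
    using reversal_respects by (auto simp: descends_def reversal_cochain)
  show "\<forall>f\<in>cochains. \<forall>as. \<exists>!c. is_Delta_value f as c"
    by (simp add: Delta_value)
  show "\<forall>f\<in>cocycles. \<exists>ps. represents_coproduct ps f"
    by (metis coproduct_representative)
  show "\<forall>X\<in>HH. \<exists>!t. t \<in> coproduct_values X"
    using coproduct_unique(1) by (metis HH_cls)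
qed (rule equiv_cohomologous)

lemma operations_linear_holds: "operations_linear"
  unfolding operations_linear_def
  by (intro conjI ballI allI HH_linear_cup HH_linear_hDelta HH_linear_hreversal coproduct_add
      coproduct_scale)

lemma HH_degree_cls:
  assumes "X \<in> HH_degree n"
  obtains f where "f \<in> cocycles" "homogeneous n f" "X = cls f"
  using assms unfolding HH_degree_def by blast

lemma cls_HH_degree: "f \<in> cocycles \<Longrightarrow> homogeneous n f \<Longrightarrow> cls f \<in> HH_degree n"
  unfolding HH_degree_def by blast

lemma homogeneous_parity: "homogeneous n f \<Longrightarrow> parity n f"
  unfolding homogeneous_def parity_def by auto

lemma homogeneous_cup:
  assumes "homogeneous p f" "homogeneous q g"
  shows "homogeneous (p + q) (f \<smile> g)"
  unfolding homogeneous_def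
proof (intro allI impI)
  fix as :: "'a list" assume as: "length as \<noteq> p + q"
  have "(f \<smile> g) as = split_sum (\<lambda>u v. 0) as"
    unfolding cup_eq
  proof (rule split_sum_cong)
    fix u v assume "u @ v = as"
    then have "length u \<noteq> p \<or> length v \<noteq> q" using as by auto
    then show "f u * g v = 0" using assms by (auto simp: homogeneous_def)
  qed
  then show "(f \<smile> g) as = 0" by (simp add: split_sum_zero)
qed

lemma homogeneous_Delta:
  assumes f: "f \<in> cochains" "homogeneous (n + 1) f"
  shows "homogeneous n (Delta f)"
  unfolding homogeneous_def
proof (intro allI impI)
  fix as :: "'a list" assume as: "length as \<noteq> n"
  have "Delta f as = split_sum (\<lambda>u v. 0) as"
    unfolding Delta_split[OF f(1)]
  proof (rule split_sum_cong)
    fix u w assume "u @ w = as"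
    then have "length (w @ b # u) \<noteq> n + 1" for b using as by auto
    then have "f (w @ b # u) = 0" for b using f(2) unfolding homogeneous_def by blast
    then show "signed ((length u + 1) * length w) (repr (\<lambda>b. f (w @ b # u))) = 0"
        by (simp add: repr_zero)
  qed
  then show "Delta f as = 0" by (simp add: split_sum_zero)
qed

lemma homogeneous_degree_zero: "homogeneous 0 f \<longleftrightarrow> f = degree_zero (f [])"
  by (auto simp: homogeneous_def degree_zero_def fun_eq_iff)

text \<open>
  A class of positive degree has no component of degree 0, hence its coproduct is zero.
\<close>

lemma operations_graded_holds: "operations_graded"
  unfolding operations_graded_def
proof (intro conjI allI ballI)
  fix p q X Y assume "X \<in> HH_degree p" "Y \<in> HH_degree q"
  then show "X \<smile>\<^sub>H Y \<in> HH_degree (p + q)"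
    by (auto elim!: HH_degree_cls intro!: cls_HH_degree homogeneous_cup)
next
  fix n X assume "X \<in> HH_degree n"
  then obtain f where f: "f \<in> cocycles" "homogeneous n f" "X = cls f" by (rule HH_degree_cls)
  show "coproduct X \<in> fun_space.span {pure [U, V] | U V. U \<in> HH_degree 0 \<and> V \<in> HH_degree n}"
  proof (cases "n = 0")
    case True
    have "scalar_class c \<in> HH_degree 0" for c
      unfolding scalar_class_def by (rule cls_HH_degree) (simp_all add: homogeneous_def
          degree_zero_def degree_zero_cocycle)
    then show ?thesis
      unfolding f(3) coproduct_unique(2)[OF f(1)] casimir_def True
      by (intro fun_space.span_sum fun_space.span_base) blast
  next
    case False
    then have "f [] = 0" using f(2) by (simp add: homogeneous_def)
    then have "coproduct X = 0"
      using coproduct_unique(2)[OF f(1)] by (simp only: f(3) mult_zero_right casimir_zero)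
    then show ?thesis by (simp only: fun_space.span_zero)
  qed
next
  fix X assume "X \<in> HH_degree 0"
  then obtain f where f: "f \<in> cocycles" "homogeneous 0 f" "X = cls f" by (rule HH_degree_cls)
  then show "hDelta X = cls 0"
    using scalar_class_operations(1)[of "f []"] by (metis homogeneous_degree_zero scalar_class_def)
next
  fix n X assume "X \<in> HH_degree (n + 1)"
  then show "hDelta X \<in> HH_degree n"
    by (auto elim!: HH_degree_cls intro!: cls_HH_degree homogeneous_Delta cocycles_cochain)
next
  fix n X assume "X \<in> HH_degree n"
  then show "hreversal X \<in> HH_degree n"
    by (auto elim!: HH_degree_cls intro!: cls_HH_degree simp: homogeneous_def reversal_eq)
qed

lemma minus_one_power_scale: "(- 1) ^ n *s x = signed n x"
  by (cases "even n") (simp_all add: signed_def)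

lemma signed_class: "f \<in> cocycles \<Longrightarrow> (- 1) ^ n \<odot> cls f = cls (signed n f)"
proof -
  have "(\<lambda>as. (- 1) ^ n *s f as) = signed n f"
    by (simp add: fun_eq_iff minus_one_power_scale signed_def)
  then show "f \<in> cocycles \<Longrightarrow> ?thesis" by simp
qed

lemma signed_cocycle: "f \<in> cocycles \<Longrightarrow> signed n f \<in> cocycles"
  by (simp add: cocycles_def fun_cochain differential_signed)

lemmas mu_linear = tensor_hom_linear[OF operations_hom(1)]
lemmas vee_linear = tensor_hom_linear[OF operations_hom(2)]
lemmas bv_linear = tensor_hom_linear[OF operations_hom(3)]
lemmas swap_linear = tensor_hom_linear[OF operations_hom(5)]

lemma frobenius_algebra_holds: "frobenius_algebra"
  unfolding frobenius_algebra_def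
proof (intro conjI allI ballI)
  fix X Y Z assume "X \<in> HH" "Y \<in> HH" "Z \<in> HH"
  then show "(X \<smile>\<^sub>H Y) \<smile>\<^sub>H Z = X \<smile>\<^sub>H (Y \<smile>\<^sub>H Z)"
    by (auto elim!: HH_cls simp: cup_assoc)
next
  fix p q X Y assume "X \<in> HH_degree p" "Y \<in> HH_degree q"
  then obtain f g where f: "f \<in> cocycles" "homogeneous p f" "X = cls f"
    and g: "g \<in> cocycles" "homogeneous q g" "Y = cls g"
    by (auto elim!: HH_degree_cls)
  have "cls (f \<smile> g) = cls (signed (p * q) (g \<smile> f))"
    using f g by (intro cls_eqI cup_commute_coboundary homogeneous_parity cup_cocycle signed_cocycle)
  then show "X \<smile>\<^sub>H Y = (- 1) ^ (p * q) \<odot> (Y \<smile>\<^sub>H X)"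
    by (simp only: f(3) g(3) cls_cup[OF f(1) g(1)] cls_cup[OF g(1) f(1)] signed_class[OF
        cup_cocycle[OF g(1) f(1)]])
next
  fix t assume t: "t \<in> tensor_power 2"
  show "\<mu> (\<tau> t) = \<mu> t"
  proof (rule tensor_power_eqI[OF tensor_linear_comp[OF mu_linear swap_linear] mu_linear t])
    fix xs assume "xs \<in> lists HH" "length xs = 2"
    then obtain X Y where xs: "xs = [X, Y]" "X \<in> HH" "Y \<in> HH"
      by (auto simp: length_Suc_conv numeral_2_eq_2)
    obtain f g where f: "f \<in> cocycles" "X = cls f" and g: "g \<in> cocycles" "Y = cls g"
      using xs by (auto elim!: HH_cls)
    have "\<mu> (s + t) = \<mu> s + \<mu> t" for s t
      using mu_linear by (simp only: tensor_linear_def)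
    then have "\<mu> (\<tau> (pure xs)) = pure [heven Y \<smile>\<^sub>H X] + pure [hodd Y \<smile>\<^sub>H hsign X]"
      using xs by simp
    also have "\<dots> = pure [(heven Y \<smile>\<^sub>H X) \<oplus> (hodd Y \<smile>\<^sub>H hsign X)]"
      using xs by (simp add: pure1_add)
    also have "(heven Y \<smile>\<^sub>H X) \<oplus> (hodd Y \<smile>\<^sub>H hsign X)
        = cls (even_part g \<smile> f + odd_part g \<smile> degree_sign f)"
      using f g by simp
    also have "\<dots> = cls (f \<smile> g)"
      using f g by (intro cls_eqI cup_commute_swap cocycle_intros)
    also have "pure [cls (f \<smile> g)] = \<mu> (pure xs)"
      using xs f g by simp
    finally show "\<mu> (\<tau> (pure xs)) = \<mu> (pure xs)" .
  qed
  have two: "F t = G t" if "tensor_linear F" "tensor_linear G"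
    "\<And>X Y. X \<in> HH \<Longrightarrow> Y \<in> HH \<Longrightarrow> F (pure [X, Y]) = G (pure [X, Y])" for F G
    by (rule tensor_power_eqI[OF that(1,2) t]) (use that(3) in \<open>auto simp: length_Suc_conv
        numeral_2_eq_2\<close>)
  show "\<nu> (\<mu> t) = (id \<otimes>[1,0] \<mu>) ((\<nu> \<otimes>[1,0] id) t)"
    by (rule two[OF tensor_linear_comp[OF vee_linear mu_linear]
          tensor_linear_comp[OF tensor_linear_tensor_map tensor_linear_tensor_map]]) (simp only: vee_mu)
  show "\<nu> (\<mu> t) = (\<mu> \<otimes>[2,0] id) ((id \<otimes>[1,0] \<nu>) t)"
    by (rule two[OF tensor_linear_comp[OF vee_linear mu_linear]
          tensor_linear_comp[OF tensor_linear_tensor_map tensor_linear_tensor_map]]) (simp only: vee_mu)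
next
  fix t assume t: "t \<in> tensor_power 1"
  have one: "F t = G t" if "tensor_linear F" "tensor_linear G"
    "\<And>f. f \<in> cocycles \<Longrightarrow> F (pure [cls f]) = G (pure [cls f])" for F G
    by (rule tensor_power_eqI[OF that(1,2) t]) (use that(3) in \<open>auto simp: length_Suc_conv elim!:
        HH_cls\<close>)
  have v: "\<nu> (pure [cls f]) = casimir (euler * f [])" if "f \<in> cocycles" for f
    using that by (simp add: coproduct_unique cls_in_HH)
  show "(\<nu> \<otimes>[1,0] id) (\<nu> t) = (id \<otimes>[1,0] \<nu>) (\<nu> t)"
    by (rule one[OF tensor_linear_comp[OF tensor_linear_tensor_map vee_linear]
          tensor_linear_comp[OF tensor_linear_tensor_map vee_linear]])
      (simp only: v vee_casimir_left vee_casimir_right)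
  show "\<tau> (\<nu> t) = \<nu> t"
    by (rule one[OF tensor_linear_comp[OF swap_linear vee_linear] vee_linear]) (simp only: v
        swap_casimir)
qed

lemma compatible_BV_operator_holds: "compatible_BV_operator"
  unfolding compatible_BV_operator_def Let_def
proof (intro conjI ballI)
  fix X assume "X \<in> HH"
  then show "hDelta (hDelta X) = cls 0"
    by (auto elim!: HH_cls simp: Delta_Delta cocycles_cochain)
next
  fix t assume t: "t \<in> tensor_power 3"
  let ?F = "\<lambda>t. \<Delta> (\<mu> ((\<mu> \<otimes>[2,0] id) t))"
  let ?G = "\<lambda>t. \<mu> (((\<Delta> \<circ> \<mu>) \<otimes>[2,0] id) t)
          + \<mu> ((id \<otimes>[1,1] (\<Delta> \<circ> \<mu>)) t)
          + \<mu> (((\<Delta> \<circ> \<mu>) \<otimes>[2,0] id) ((id \<otimes>[1,0] \<tau>) t))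
          - \<mu> ((\<mu> \<otimes>[2,0] id)
              ((\<Delta> \<otimes>[1,0] (id \<otimes>[1,0] id)) t
               + (id \<otimes>[1,1] (\<Delta> \<otimes>[1,0] id)) t
               + (id \<otimes>[1,1] (id \<otimes>[1,1] \<Delta>)) t))"
  show "?F t = ?G t"
  proof (rule tensor_power_eqI[OF _ _ t, where F = ?F and G = ?G])
    show "tensor_linear ?F"
      by (rule tensor_linear_comp[OF bv_linear tensor_linear_comp[OF mu_linear
          tensor_linear_tensor_map]])
    show "tensor_linear ?G"
      by (intro tensor_linear_add tensor_linear_diff tensor_linear_comp[OF mu_linear]
          tensor_linear_comp[OF tensor_linear_tensor_map] tensor_linear_tensor_map)
    fix xs assume "xs \<in> lists HH" "length xs = 3"
    then obtain X Y Z where xs: "xs = [X, Y, Z]" "X \<in> HH" "Y \<in> HH" "Z \<in> HH"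
      by (auto simp: length_Suc_conv numeral_3_eq_3)
    show "?F (pure xs) = ?G (pure xs)"
      unfolding xs(1) by (rule BV_pure[OF xs(2-4)])
  qed
next
  fix t assume t: "t \<in> tensor_power 1"
  have zero: "F t = 0" if "tensor_linear F" "\<And>X. X \<in> HH \<Longrightarrow> F (pure [X]) = 0" for F
  proof -
    have "tensor_linear (\<lambda>t. 0)"
      by (simp add: tensor_linear_def fun_scale_def fun_eq_iff)
    then show ?thesis
    proof (rule tensor_power_eqI[OF that(1) _ t])
      fix xs assume "xs \<in> lists HH" "length xs = 1"
      then obtain X where "xs = [X]" "X \<in> HH" by (auto simp: length_Suc_conv)
      then show "F (pure xs) = 0" using that(2) by (simp only:)
    qed
  qed
  note u = tensor_linear_comp[OF tensor_linear_tensor_map tensor_linear_comp[OF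
      tensor_linear_tensor_map vee_linear]]
  have z: "(\<nu> \<otimes>[1,0] id) (\<nu> (\<Delta> t)) = 0" "((\<nu> \<circ> \<Delta>) \<otimes>[1,0] id) (\<nu> t) = 0"
    "(id \<otimes>[1,1] (\<nu> \<circ> \<Delta>)) (\<nu> t) = 0"
    "(\<Delta> \<otimes>[1,0] (id \<otimes>[1,0] id)) ((\<nu> \<otimes>[1,0] id) (\<nu> t)) = 0"
    "(id \<otimes>[1,1] (\<Delta> \<otimes>[1,0] id)) ((\<nu> \<otimes>[1,0] id) (\<nu> t)) = 0"
    "(id \<otimes>[1,1] (id \<otimes>[1,1] \<Delta>)) ((\<nu> \<otimes>[1,0] id) (\<nu> t)) = 0"
    using zero[OF tensor_linear_comp[OF tensor_linear_tensor_map tensor_linear_comp[OF vee_linear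
        bv_linear]] coBV_pure(1)]
      zero[OF tensor_linear_comp[OF tensor_linear_tensor_map vee_linear] coBV_pure(2)]
      zero[OF tensor_linear_comp[OF tensor_linear_tensor_map vee_linear] coBV_pure(3)]
      zero[OF u coBV_pure(4)] zero[OF u coBV_pure(5)] zero[OF u coBV_pure(6)]
    by (simp_all only:)
  have "(id \<otimes>[1,0] \<tau>) 0 = 0"
    by (rule tensor_linear_zero[OF tensor_linear_tensor_map])
  then show "(\<nu> \<otimes>[1,0] id) (\<nu> (\<Delta> t)) =
          ((\<nu> \<circ> \<Delta>) \<otimes>[1,0] id) (\<nu> t)
          + (id \<otimes>[1,1] (\<nu> \<circ> \<Delta>)) (\<nu> t)
          + (id \<otimes>[1,0] \<tau>) (((\<nu> \<circ> \<Delta>) \<otimes>[1,0] id) (\<nu> t))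
          - ((\<Delta> \<otimes>[1,0] (id \<otimes>[1,0] id)) ((\<nu> \<otimes>[1,0] id) (\<nu> t))
               + (id \<otimes>[1,1] (\<Delta> \<otimes>[1,0] id)) ((\<nu> \<otimes>[1,0] id) (\<nu> t))
               + (id \<otimes>[1,1] (id \<otimes>[1,1] \<Delta>)) ((\<nu> \<otimes>[1,0] id) (\<nu> t)))"
    by (simp only: z add_0_right diff_0_right)
qed

lemma reversal_involution_holds: "reversal_involution"
proof -
  have "reversal (reversal f) = f" for f :: "'a cochain"
    by (simp add: fun_eq_iff reversal_eq signed_signed) (simp add: signed_def)
  then show ?thesis
    by (auto simp: reversal_involution_def elim!: HH_cls)
qed

lemma hDelta_hreversal: "X \<in> HH \<Longrightarrow> hreversal (hDelta X) = (- 1) \<odot> hDelta (hreversal X)"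
proof (elim HH_cls)
  fix f assume f: "f \<in> cocycles" "X = cls f"
  have "(\<lambda>as. (- 1) *s Delta (reversal f) as) = reversal (Delta f)"
    by (simp add: Delta_reversal cocycles_cochain f fun_eq_iff)
  then show "hreversal (hDelta X) = (- 1) \<odot> hDelta (hreversal X)"
    using f by simp
qed

lemma Delta_swaps_eigenspaces_holds: "Delta_swaps_eigenspaces"
proof -
  have 1: "1 \<odot> X = X" and m: "(- 1) \<odot> ((- 1) \<odot> X) = X" if X: "X \<in> HH" for X
  proof -
    obtain f where f: "f \<in> cocycles" "X = cls f" using X by (rule HH_cls)
    show "1 \<odot> X = X" using f by simp
    show "(- 1) \<odot> ((- 1) \<odot> X) = X" by (simp only: f cls_scale scale_cocycle) simp
  qed
  show ?thesis
    by (auto simp: Delta_swaps_eigenspaces_def eigenspace_def hDelta_hreversal 1 m HH_linearD(3)[OF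
        HH_linear_hDelta])
qed

lemma reversal_anti_algebra_map_holds: "reversal_anti_algebra_map"
  unfolding reversal_anti_algebra_map_def
proof (intro allI ballI)
  fix p q X Y assume "X \<in> HH_degree p" "Y \<in> HH_degree q"
  then obtain f g where f: "f \<in> cocycles" "homogeneous p f" "X = cls f"
    and g: "g \<in> cocycles" "homogeneous q g" "Y = cls g"
    by (auto elim!: HH_degree_cls)
  note r = reversal_cocycle[OF f(1)] reversal_cocycle[OF g(1)]
  show "hreversal (X \<smile>\<^sub>H Y) = (- 1) ^ (p * q) \<odot> (hreversal Y \<smile>\<^sub>H hreversal X)"
    by (simp only: f(3) g(3) cls_cup[OF f(1) g(1)] cls_reversal f(1) g(1) cup_cocycle cls_cup[OF r(2,1)]
        signed_class[OF cup_cocycle[OF r(2,1)]] reversal_cup[OF homogeneous_parity[OF f(2)]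
            homogeneous_parity[OF g(2)]])
qed

lemma reversal_anti_coalgebra_map_holds: "reversal_anti_coalgebra_map"
  unfolding reversal_anti_coalgebra_map_def
proof
  fix X assume "X \<in> HH"
  then obtain f where f: "f \<in> cocycles" "X = cls f" by (rule HH_cls)
  have "(\<rho> \<otimes>[1,0] \<rho>) (casimir a) = (\<Sum>e\<in>Basis. (\<rho> \<otimes>[1,0] \<rho>) (pure [scalar_class (dual_basis e),
      scalar_class (e * a)]))" for a
    unfolding casimir_def by (intro tensor_hom_sum operations_hom)
  then have "(\<rho> \<otimes>[1,0] \<rho>) (casimir a) = casimir a" for a
    by (simp add: tensor_map_simps operations_hom casimir_def)
  moreover have "coproduct (hreversal X) = casimir (euler * f [])"
    using coproduct_unique(2)[OF reversal_cocycle[OF f(1)]] f by (simp add: reversal_eq tri_def)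
  ultimately show "coproduct (hreversal X) = (\<rho> \<otimes>[1,0] \<rho>) (\<tau> (coproduct X))"
    by (simp only: f(2) coproduct_unique(2)[OF f(1)] swap_casimir)
qed

end

theorem corollary4p4:
  fixes scl :: "'k::field \<Rightarrow> 'a::{comm_ring, comm_monoid_mult} \<Rightarrow> 'a"
    and Basis :: "'a set"
    and ip :: "'a \<Rightarrow> 'a \<Rightarrow> 'k"
  assumes "inner_product_algebra scl Basis ip"
  shows "inner_product_algebra.operations_induced scl Basis ip \<and>
    inner_product_algebra.operations_linear scl Basis ip \<and>
    inner_product_algebra.operations_graded scl Basis ip \<and>
    inner_product_algebra.frobenius_algebra scl Basis ip \<and>
    inner_product_algebra.compatible_BV_operator scl Basis ip \<and>
    inner_product_algebra.reversal_involution scl \<and>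
    inner_product_algebra.Delta_swaps_eigenspaces scl ip \<and>
    inner_product_algebra.reversal_anti_algebra_map scl \<and>
    inner_product_algebra.reversal_anti_coalgebra_map scl Basis ip"
proof -
  interpret inner_product_algebra scl Basis ip by (rule assms)
  show ?thesis
    by (intro conjI operations_induced_holds operations_linear_holds operations_graded_holds
        frobenius_algebra_holds compatible_BV_operator_holds reversal_involution_holds
        Delta_swaps_eigenspaces_holds reversal_anti_algebra_map_holds reversal_anti_coalgebra_map_holds)
qed

end
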